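(* Let $B$ be a decomposable $C^*$-algebra, $\Theta\subseteq\mathrm{PAut}(B)$ an admissible inverse semigroup, and $(\pi,\upsilon)$ a covariant representation of $(B,\Theta)$ on a Hilbert space $\mathfrak K$ with $\pi$ faithful. Let $\mathscr C$ and $\mathscr D$ be $\Theta$-admissible $C^*$-families on right $C^*$-$B$-$B$-bimodules $E$ and $F$, respectively. Then $$\mathrm{Ad}_{\tau_{E,F}}^{-1}\big(\mathbf J(\mathscr C\otimes\mathscr D)\big)\subseteq(\mathbf J\mathscr C)\,{}_{\alpha(E)}\underset{\mathfrak H}{*}{}_{\beta(F)}(\mathbf J\mathscr D),$$ where $\mathrm{Ad}_{\tau_{E,F}}:\mathcal L\big(\mathbf IE\,{}_{\alpha(E)}\underset{\mathfrak H}{\otimes}{}_{\beta(F)}\mathbf IF\big)\to\mathcal L(\mathbf I(E\otimes F))$ denotes conjugation by the unitary $\tau_{E,F}$.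
   Context: Conventions. $[Y]$ is the closed linear span of $Y$. A right $C^*$-$B$-$B$-bimodule is a full right Hilbert $C^*$-module $E$ over $B$ with a fixed nondegenerate $*$-homomorphism $B\to\mathcal L_B(E)$ (left multiplication). $E\otimes F$ is the internal tensor product ($\langle\xi\otimes\eta|\xi'\otimes\eta'\rangle=\langle\eta|\langle\xi|\xi'\rangle\eta'\rangle$). A partial automorphism of $B$ is a $*$-isomorphism $\theta:\mathrm{Dom}(\theta)\to\mathrm{Im}(\theta)$ between closed ideals of $B$; these form the inverse semigroup $\mathrm{PAut}(B)$, $\theta^*:=\theta^{-1}$; $\theta'\le\theta$ means $\theta$ extends $\theta'$; $\theta\wedge\theta'$ is the largest partial automorphism extended by both; $\mathrm{id}=\mathrm{id}_B$; $\rho\perp\sigma$ (compatible) means $\rho\sigma^*\le\mathrm{id}$ and $\rho^*\sigma\le\mathrm{id}$. Homogeneous operators. For $\rho,\sigma\in\mathrm{PAut}(B)$, a map $T:E\to F$ is $(\rho,\sigma)$-homogeneous if $T(E)\subseteq[\mathrm{Im}(\rho)F]$, $T(a\xi)=\rho(a)T\xi$ for $a\in\mathrm{Dom}(\rho)$, and there is a map $T^*:F\to E$ with $\langle T^*\eta|\xi\rangle\in\mathrm{Dom}(\sigma)$ and $\langle\eta|T\xi\rangle=\sigma(\langle T^*\eta|\xi\rangle)$ ($T$ is then linear, bounded, $T^*$ unique). The set of these is $\mathscr L^\rho_\sigma(E,F)$; $\mathscr L^\rho_\sigma(E)=\mathscr L^\rho_\sigma(E,E)$. A family $\mathscr C\subseteq\mathscr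 L(E,F)$ is a family of closed subspaces $\mathscr C^\rho_\sigma\subseteq\mathscr L^\rho_\sigma(E,F)$; inclusion is componentwise. $(\mathscr C^* )^\rho_\sigma=(\mathscr C^{\rho^*}_{\sigma^*})^*$; $[\mathscr D\mathscr C]^{\rho''}_{\sigma''}$ is the closed span of all $T'T$, $T'\in\mathscr D^{\rho'}_{\sigma'}$, $T\in\mathscr C^\rho_\sigma$, $\rho'\rho\le\rho''$, $\sigma'\sigma\le\sigma''$; $[\mathscr CE]$ is the closed span of all $T\xi$. $\mathscr C$ is $\Theta$-supported if each $\mathscr C^\rho_\sigma$ is the closed span of the $\mathscr C^{\rho'}_{\sigma'}$ with $\rho',\sigma'\in\Theta$, $\rho'\le\rho$, $\sigma'\le\sigma$. Homogeneous elements. $\mathscr H_\theta(E)=\{\xi\in E\,\mathrm{Dom}(\theta):\xi b=\theta(b)\xi\ \forall b\in\mathrm{Dom}(\theta)\}$. $E$ is decomposable (resp. $\Theta$-decomposable) if the $\mathscr H_\theta(E)$, $\theta\in\mathrm{PAut}(B)$ (resp. $\theta\in\Theta$), span a dense subspace; $E$ is $\Theta$-supported if each $\mathscr H_\theta(E)$ is the closed span of the $\mathscr H_{\theta'}(E)$, $\theta'\in\Theta$, $\theta'\le\theta$. $B$ is a bimodule over itself. For $\xi\in\mathscr H_\theta(E)$: $l(\xi)\in\mathscr L^\theta_{\mathrm{id}}(B,E)$, $l(\xi)b=\xi b$; $r(\xi)\in\mathscr L^{\mathrm{id}}_{\theta^*}(B,E)$, $r(\xi)b=b\xi$. For $b\in\mathscr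 H_\theta(B)$: $l_E(b)\in\mathscr L^\theta_{\mathrm{id}}(E)$, $\xi\mapsto b\xi$; $r_E(b)\in\mathscr L^{\mathrm{id}}_{\theta^*}(E)$, $\xi\mapsto\xi b$. $l(\mathscr H(E))$ is the family with entry $l(\mathscr H_\theta(E))$ at $(\theta,\mathrm{id})$, $0$ elsewhere; $r(\mathscr H(E))$ has entry $r(\mathscr H_{\theta^*}(E))$ at $(\mathrm{id},\theta)$, $0$ elsewhere. $\Theta$ is admissible if $B$ is $\Theta$-supported, $\mathrm{id}\in\Theta$, and $\Theta$ is closed under $\wedge$. $E$ is $\Theta$-admissible if it is $\Theta$-decomposable, $[l(\mathscr H(E))^*l(\mathscr H(E))]=l(\mathscr H(B))$ and $[r(\mathscr H(E))^*r(\mathscr H(E))]=r(\mathscr H(B))$. $C^*$-families. A $C^*$-family on $E$ is a family $\mathscr C\subseteq\mathscr L(E)$ with $[\mathscr C^*\mathscr C]=\mathscr C$; nondegenerate if $[\mathscr CE]=E$. $\mathscr O(E)$ is the $C^*$-family $\mathscr O(E)^\rho_\sigma=[l_E(\mathscr H_\rho(B))\,r_E(\mathscr H_{\sigma^*}(B))]$. $\mathscr C$ is $\Theta$-admissible if $E$ is $\Theta$-admissible, $\mathscr C$ is nondegenerate and $\Theta$-supported, $[\mathscr C\mathscr O(E)]\subseteq\mathscr C$, and $[\mathscr C^\rho_\sigma\mathscr O(E)^{\rho^*\rho}_{\sigma^*\sigma}]=\mathscr C^\rho_\sigma$ for $\rho,\sigma\in\Theta$. For families $\mathscr C\subseteq\mathscr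 L(E)$, $\mathscr D\subseteq\mathscr L(F)$, the fiber product $\mathscr C\otimes\mathscr D\subseteq\mathscr L(E\otimes F)$ is: $(\mathscr C\otimes\mathscr D)^\rho_\sigma$ is the closed span of the operators $c\otimes d:\xi\otimes\eta\mapsto c\xi\otimes d\eta$ with $c\in\mathscr C^\rho_{\sigma'}$, $d\in\mathscr D^{\rho'}_\sigma$, $\sigma'\perp\rho'$. Covariant representation. A $*$-homomorphism $\pi:B\to\mathcal L(\mathfrak K)$ and a map $\upsilon:\Theta\to\mathcal L(\mathfrak K)$ with $\upsilon(\theta)\upsilon(\theta')=\upsilon(\theta\theta')$, $\upsilon(\theta)^*=\upsilon(\theta^* )$, $\upsilon(\theta)\mathfrak K=[\pi(\mathrm{Im}(\theta))\mathfrak K]$, $\upsilon(\theta)\pi(b)\upsilon(\theta)^*=\pi(\theta(b))$ for $b\in\mathrm{Dom}(\theta)$. $\mathbf IE=E\otimes_\pi\mathfrak K$; for $T\in\mathscr L^\rho_\sigma(E,F)$, $\rho,\sigma\in\Theta$, $\mathbf IT:\mathbf IE\to\mathbf IF$, $\xi\otimes\zeta\mapsto T\xi\otimes\upsilon(\sigma)\zeta$ (well defined, bounded, independent of the choice of $\rho,\sigma\in\Theta$). $\mathbf J\mathscr C$ is the closed span of all $\mathbf Ic$, $c\in\mathscr C^\rho_\sigma$, $\rho,\sigma\in\Theta$. $\mathfrak H=\mathbf IB$, $\mathfrak B=\mathbf J\,l(\mathscr H(B))$, $\mathfrak B^\dagger=\mathbf J\,r(\mathscr H(B))$; these form a $C^*$-base: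 $\mathfrak B,\mathfrak B^\dagger\subseteq\mathcal L(\mathfrak H)$ are commuting nondegenerate $C^*$-algebras. $\alpha(E)=\mathbf J\,l(\mathscr H(E))$, $\beta(E)=\mathbf J\,r(\mathscr H(E))\subseteq\mathcal L(\mathfrak H,\mathbf IE)$. Factorizations and fiber products. A $C^*$-factorization of a Hilbert space $H$ with respect to $(\mathfrak H,\mathfrak B,\mathfrak B^\dagger)$ is a closed subspace $\alpha\subseteq\mathcal L(\mathfrak H,H)$ with $[\alpha^*\alpha]=\mathfrak B$, $[\alpha\mathfrak B]=\alpha$, $[\alpha\mathfrak H]=H$; the opposite base is $(\mathfrak H,\mathfrak B^\dagger,\mathfrak B)$. ($\alpha(E)$ is one with respect to the base, $\beta(E)$ with respect to the opposite base.) If $\alpha$ is a factorization of $H$ with respect to the base and $\delta$ one of $K$ with respect to the opposite base, $H\,{}_\alpha\underset{\mathfrak H}{\otimes}{}_\delta K$ is the Hilbert space densely spanned by $\xi\otimes\zeta\otimes\eta$ ($\xi\in\alpha,\zeta\in\mathfrak H,\eta\in\delta$) with $\langle\xi\otimes\zeta\otimes\eta|\xi'\otimes\zeta'\otimes\eta'\rangle=\langle\zeta|\xi^*\xi'\eta^*\eta'\zeta'\rangle$; $|\xi\rangle_1:K\to H\,{}_\alpha\underset{\mathfrak H}{\otimes}{}_\delta K$, $\eta\zeta\mapsto\xi\otimes\zeta\otimes\eta$; $|\eta\rangle_2:H\to H\,{}_\alpha\underset{\mathfrak H}{\otimes}{}_\delta K$, $\xi\zeta\mapsto\xi\otimes\zeta\otimes\eta$;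 $|\alpha\rangle_1=\{|\xi\rangle_1:\xi\in\alpha\}$, $|\delta\rangle_2=\{|\eta\rangle_2:\eta\in\delta\}$. For $C^*$-algebras $A\subseteq\mathcal L(H)$, $C\subseteq\mathcal L(K)$, the fiber product $A\,{}_\alpha\underset{\mathfrak H}{*}{}_\delta C$ is the set of all $T\in\mathcal L(H\,{}_\alpha\underset{\mathfrak H}{\otimes}{}_\delta K)$ with $T|\alpha\rangle_1,T^*|\alpha\rangle_1\subseteq[|\alpha\rangle_1C]$ and $T|\delta\rangle_2,T^*|\delta\rangle_2\subseteq[|\delta\rangle_2A]$. The map $\tau$. $\xi\mapsto(b\otimes k\mapsto\xi b\otimes k)=:l(\xi)\otimes\mathrm{id}$ is a bijection $E\to\alpha(E)$. $\tau_{E,F}:\mathbf IE\,{}_{\alpha(E)}\underset{\mathfrak H}{\otimes}{}_{\beta(F)}\mathbf IF\to\mathbf I(E\otimes F)=E\otimes F\otimes_\pi\mathfrak K$ is the unitary $(l(\xi)\otimes\mathrm{id})\otimes\zeta\otimes\omega\mapsto\xi\otimes\omega\zeta$ for $\xi\in E$, $\zeta\in\mathfrak H$, $\omega\in\beta(F)$. *)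

theory Defs
  imports "HOL-Analysis.Analysis"
begin

section \<open>Complex Banach spaces, C*-algebras and Hilbert spaces\<close>

class complex_banach = banach +
  fixes scaleC :: "complex \<Rightarrow> 'a \<Rightarrow> 'a"  (infixr "*\<^sub>C" 75)
  assumes scaleC_add_right: "c *\<^sub>C (x + y) = c *\<^sub>C x + c *\<^sub>C y"
    and scaleC_add_left: "(c + d) *\<^sub>C x = c *\<^sub>C x + d *\<^sub>C x"
    and scaleC_scaleC: "c *\<^sub>C d *\<^sub>C x = (c * d) *\<^sub>C x"
    and scaleR_scaleC: "r *\<^sub>R x = complex_of_real r *\<^sub>C x"
    and norm_scaleC: "norm (c *\<^sub>C x) = cmod c * norm x"

class cstar_algebra = complex_banach + real_normed_algebra +
  fixes star :: "'a \<Rightarrow> 'a"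
  assumes mult_scaleC_left: "(c *\<^sub>C a) * b = c *\<^sub>C (a * b)"
    and mult_scaleC_right: "a * (c *\<^sub>C b) = c *\<^sub>C (a * b)"
    and star_add: "star (a + b) = star a + star b"
    and star_scaleC: "star (c *\<^sub>C a) = cnj c *\<^sub>C star a"
    and star_mult: "star (a * b) = star b * star a"
    and star_star: "star (star a) = a"
    and cstar_identity: "norm (star a * a) = (norm a)\<^sup>2"

text \<open>Inner products are linear in the second variable.\<close>

class chilbert_space = complex_banach +
  fixes cinner :: "'a \<Rightarrow> 'a \<Rightarrow> complex"
  assumes cinner_commute: "cinner x y = cnj (cinner y x)"
    and cinner_add_right: "cinner x (y + z) = cinner x y + cinner x z"
    and cinner_scaleC_right: "cinner x (c *\<^sub>C y) = c * cinner x y"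
    and cinner_self: "cinner x x = complex_of_real ((norm x)\<^sup>2)"

instantiation blinfun :: (real_normed_vector, complex_banach) complex_banach
begin

definition scaleC_blinfun :: "complex \<Rightarrow> ('a \<Rightarrow>\<^sub>L 'b) \<Rightarrow> ('a \<Rightarrow>\<^sub>L 'b)" where
  "scaleC_blinfun c T = Blinfun (\<lambda>x. c *\<^sub>C T x)"

lemma blinfun_apply_scaleC: "blinfun_apply (c *\<^sub>C T) x = c *\<^sub>C T x"
  for T :: "'a \<Rightarrow>\<^sub>L 'b"
proof -
  have "bounded_linear (\<lambda>x. c *\<^sub>C T x)"
  proof (rule bounded_linear_intro[where K = "cmod c * norm T"])
    show "c *\<^sub>C T (x + y) = c *\<^sub>C T x + c *\<^sub>C T y" for x y
      by (simp add: blinfun.add_right scaleC_add_right)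
    show "c *\<^sub>C T (r *\<^sub>R x) = r *\<^sub>R c *\<^sub>C T x" for r x
      by (simp add: blinfun.scaleR_right scaleR_scaleC scaleC_scaleC mult.commute)
    show "norm (c *\<^sub>C T x) \<le> norm x * (cmod c * norm T)" for x
      using mult_left_mono[OF norm_blinfun[of T x], of "cmod c"]
      by (simp add: norm_scaleC mult_ac)
  qed
  then show ?thesis
    by (simp add: scaleC_blinfun_def bounded_linear_Blinfun_apply)
qed

instance
proof
  fix c d :: complex and r :: real and S T :: "'a \<Rightarrow>\<^sub>L 'b"
  show "c *\<^sub>C (S + T) = c *\<^sub>C S + c *\<^sub>C T"
    by (rule blinfun_eqI) (simp add: blinfun_apply_scaleC blinfun.add_left scaleC_add_right)
  show "(c + d) *\<^sub>C T = c *\<^sub>C T + d *\<^sub>C T"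
    by (rule blinfun_eqI) (simp add: blinfun_apply_scaleC blinfun.add_left scaleC_add_left)
  show "c *\<^sub>C d *\<^sub>C T = (c * d) *\<^sub>C T"
    by (rule blinfun_eqI) (simp add: blinfun_apply_scaleC scaleC_scaleC)
  show "r *\<^sub>R T = complex_of_real r *\<^sub>C T"
    by (rule blinfun_eqI) (simp add: blinfun_apply_scaleC blinfun.scaleR_left scaleR_scaleC)
  show "norm (c *\<^sub>C T) = cmod c * norm T"
  proof (rule antisym)
    have le: "norm (c *\<^sub>C T) \<le> cmod c * norm T" for c and T :: "'a \<Rightarrow>\<^sub>L 'b"
    proof (rule norm_blinfun_bound)
      show "norm ((c *\<^sub>C T) x) \<le> cmod c * norm T * norm x" for x
        using mult_left_mono[OF norm_blinfun[of T x], of "cmod c"]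
        by (simp add: blinfun_apply_scaleC norm_scaleC mult_ac)
    qed simp
    show "norm (c *\<^sub>C T) \<le> cmod c * norm T" by (rule le)
    show "cmod c * norm T \<le> norm (c *\<^sub>C T)"
    proof (cases "c = 0")
      case False
      have one: "1 *\<^sub>C x = x" for x :: 'b
        using scaleR_scaleC[of 1 x] by simp
      have "T = inverse c *\<^sub>C c *\<^sub>C T"
        using False by (intro blinfun_eqI) (simp add: blinfun_apply_scaleC scaleC_scaleC one)
      then have "norm T \<le> cmod (inverse c) * norm (c *\<^sub>C T)"
        using le[of "inverse c" "c *\<^sub>C T"] by simp
      then show ?thesis
        using False by (simp add: norm_divide norm_inverse divide_simps mult.commute split: if_splits)
    qed simp
  qed
qed

end

abbreviation csubspace :: "'a::complex_banach set \<Rightarrow> bool" where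
  "csubspace \<equiv> module.subspace scaleC"

definition closed_span :: "'a::complex_banach set \<Rightarrow> 'a set"  ("\<lbrakk>_\<rbrakk>") where
  "\<lbrakk>S\<rbrakk> = closure (module.span scaleC S)"

text \<open>The library's bounded linear maps are only real-linear.\<close>

definition clinear_op :: "('a::complex_banach \<Rightarrow>\<^sub>L 'b::complex_banach) \<Rightarrow> bool" where
  "clinear_op T \<longleftrightarrow> (\<forall>c x. T (c *\<^sub>C x) = c *\<^sub>C T x)"

definition adj :: "('h::chilbert_space \<Rightarrow>\<^sub>L 'k::chilbert_space) \<Rightarrow> ('k \<Rightarrow>\<^sub>L 'h)" where
  "adj T = (THE S :: 'k \<Rightarrow>\<^sub>L 'h. \<forall>x y. cinner (S y) x = cinner y (T x))"

definition unitary_op :: "('h::chilbert_space \<Rightarrow>\<^sub>L 'k::chilbert_space) \<Rightarrow> bool" where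
  "unitary_op U \<longleftrightarrow> clinear_op U \<and> surj U \<and> (\<forall>x y. cinner (U x) (U y) = cinner x y)"

definition Ad :: "('h::chilbert_space \<Rightarrow>\<^sub>L 'k::chilbert_space) \<Rightarrow> ('h \<Rightarrow>\<^sub>L 'h) \<Rightarrow> ('k \<Rightarrow>\<^sub>L 'k)" where
  "Ad U T = U o\<^sub>L T o\<^sub>L adj U"


section \<open>Partial automorphisms\<close>

text \<open>
  Partial maps model partial automorphisms: the product is the composition of partial maps
  \<open>\<circ>\<^sub>m\<close>, the order is \<open>\<subseteq>\<^sub>m\<close> and the identity automorphism is \<open>Some\<close>.
\<close>

definition closed_ideal :: "'b::cstar_algebra set \<Rightarrow> bool" where
  "closed_ideal I \<longleftrightarrow> csubspace I \<and> closed I \<and> (\<forall>a\<in>I. \<forall>b. a * b \<in> I \<and> b * a \<in> I)"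

definition PAut :: "('b::cstar_algebra \<rightharpoonup> 'b) set" where
  "PAut = {\<theta>. closed_ideal (dom \<theta>) \<and> closed_ideal (ran \<theta>) \<and> inj_on \<theta> (dom \<theta>) \<and>
     (\<forall>a b a' b'. \<theta> a = Some a' \<longrightarrow> \<theta> b = Some b' \<longrightarrow>
        \<theta> (a + b) = Some (a' + b') \<and> \<theta> (a * b) = Some (a' * b') \<and>
        \<theta> (star a) = Some (star a') \<and> (\<forall>c. \<theta> (c *\<^sub>C a) = Some (c *\<^sub>C a')))}"

abbreviation pid :: "'b \<rightharpoonup> 'b" where
  "pid \<equiv> Some"

definition pinv :: "('b \<rightharpoonup> 'b) \<Rightarrow> ('b \<rightharpoonup> 'b)" where
  "pinv \<theta> = (\<lambda>y. if y \<in> ran \<theta> then Some (THE x. \<theta> x = Some y) else None)"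

definition is_pmeet :: "('b::cstar_algebra \<rightharpoonup> 'b) \<Rightarrow> ('b \<rightharpoonup> 'b) \<Rightarrow> ('b \<rightharpoonup> 'b) \<Rightarrow> bool" where
  "is_pmeet \<theta> \<theta>' \<mu> \<longleftrightarrow> \<mu> \<in> PAut \<and> \<mu> \<subseteq>\<^sub>m \<theta> \<and> \<mu> \<subseteq>\<^sub>m \<theta>' \<and>
     (\<forall>\<nu>\<in>PAut. \<nu> \<subseteq>\<^sub>m \<theta> \<longrightarrow> \<nu> \<subseteq>\<^sub>m \<theta>' \<longrightarrow> \<nu> \<subseteq>\<^sub>m \<mu>)"

definition compatible :: "('b \<rightharpoonup> 'b) \<Rightarrow> ('b \<rightharpoonup> 'b) \<Rightarrow> bool" where
  "compatible \<rho> \<sigma> \<longleftrightarrow> \<rho> \<circ>\<^sub>m pinv \<sigma> \<subseteq>\<^sub>m pid \<and> pinv \<rho> \<circ>\<^sub>m \<sigma> \<subseteq>\<^sub>m pid"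

definition inverse_subsemigroup :: "('b::cstar_algebra \<rightharpoonup> 'b) set \<Rightarrow> bool" where
  "inverse_subsemigroup \<Theta> \<longleftrightarrow> \<Theta> \<subseteq> PAut \<and>
     (\<forall>\<theta>\<in>\<Theta>. pinv \<theta> \<in> \<Theta>) \<and> (\<forall>\<theta>\<in>\<Theta>. \<forall>\<theta>'\<in>\<Theta>. \<theta> \<circ>\<^sub>m \<theta>' \<in> \<Theta>)"


section \<open>Right C*-B-B-bimodules\<close>

record ('b, 'e) bimodule =
  ip :: "'e \<Rightarrow> 'e \<Rightarrow> 'b"
  ract :: "'e \<Rightarrow> 'b \<Rightarrow> 'e"
  lact :: "'b \<Rightarrow> 'e \<Rightarrow> 'e"

definition cstar_bimodule :: "('b::cstar_algebra, 'e::complex_banach) bimodule \<Rightarrow> bool" where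
  "cstar_bimodule E \<longleftrightarrow>
     \<comment> \<open>Hilbert C*-module; completeness is part of the type class of \<open>'e\<close>\<close>
     (\<forall>\<xi> \<eta> b. ract E (\<xi> + \<eta>) b = ract E \<xi> b + ract E \<eta> b) \<and>
     (\<forall>\<xi> a b. ract E \<xi> (a + b) = ract E \<xi> a + ract E \<xi> b) \<and>
     (\<forall>\<xi> a b. ract E (ract E \<xi> a) b = ract E \<xi> (a * b)) \<and>
     (\<forall>c \<xi> b. ract E (c *\<^sub>C \<xi>) b = c *\<^sub>C ract E \<xi> b \<and> ract E \<xi> (c *\<^sub>C b) = c *\<^sub>C ract E \<xi> b) \<and>
     (\<forall>\<xi> \<eta> \<eta>'. ip E \<xi> (\<eta> + \<eta>') = ip E \<xi> \<eta> + ip E \<xi> \<eta>') \<and>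
     (\<forall>\<xi> \<eta> c. ip E \<xi> (c *\<^sub>C \<eta>) = c *\<^sub>C ip E \<xi> \<eta>) \<and>
     (\<forall>\<xi> \<eta> b. ip E \<xi> (ract E \<eta> b) = ip E \<xi> \<eta> * b) \<and>
     (\<forall>\<xi> \<eta>. star (ip E \<xi> \<eta>) = ip E \<eta> \<xi>) \<and>
     (\<forall>\<xi>. \<exists>b. ip E \<xi> \<xi> = star b * b) \<and>
     (\<forall>\<xi>. (norm \<xi>)\<^sup>2 = norm (ip E \<xi> \<xi>)) \<and>
     \<comment> \<open>full\<close>
     \<lbrakk>{ip E \<xi> \<eta> | \<xi> \<eta>. True}\<rbrakk> = UNIV \<and>
     \<comment> \<open>nondegenerate *-homomorphism into the adjointable operators\<close>
     (\<forall>b \<xi> \<eta>. ip E (lact E (star b) \<xi>) \<eta> = ip E \<xi> (lact E b \<eta>)) \<and>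
     (\<forall>a b \<xi>. lact E (a + b) \<xi> = lact E a \<xi> + lact E b \<xi>) \<and>
     (\<forall>c b \<xi>. lact E (c *\<^sub>C b) \<xi> = c *\<^sub>C lact E b \<xi>) \<and>
     (\<forall>a b \<xi>. lact E (a * b) \<xi> = lact E a (lact E b \<xi>)) \<and>
     \<lbrakk>{lact E b \<xi> | b \<xi>. True}\<rbrakk> = UNIV"

definition self_bimodule :: "('b::cstar_algebra, 'b) bimodule" where
  "self_bimodule = \<lparr>ip = (\<lambda>a b. star a * b), ract = (*), lact = (*)\<rparr>"

text \<open>
  Internal tensor products are determined up to a unique unitary by the inner products of, and the
  density of the span of, the elementary tensors \<open>t \<xi> \<eta>\<close>; bilinearity of \<open>t\<close> follows from the
  inner product formula.  The same notion is used for Hilbert modules over \<open>B\<close> and, with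
  \<open>L = \<pi>\<close>, for Hilbert spaces.
\<close>

definition internal_tensor ::
  "('e::complex_banach \<Rightarrow> 'e \<Rightarrow> 'b) \<Rightarrow> ('b \<Rightarrow> 'f::complex_banach \<Rightarrow> 'f) \<Rightarrow> ('f \<Rightarrow> 'f \<Rightarrow> 'c) \<Rightarrow>
   ('x::complex_banach \<Rightarrow> 'x \<Rightarrow> 'c) \<Rightarrow> ('e \<Rightarrow> 'f \<Rightarrow> 'x) \<Rightarrow> bool" where
  "internal_tensor ipE L ipF ipX t \<longleftrightarrow>
     (\<forall>\<xi> \<eta> \<xi>' \<eta>'. ipX (t \<xi> \<eta>) (t \<xi>' \<eta>') = ipF \<eta> (L (ipE \<xi> \<xi>') \<eta>')) \<and>
     \<lbrakk>{t \<xi> \<eta> | \<xi> \<eta>. True}\<rbrakk> = UNIV"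

definition bimodule_tensor ::
  "('b::cstar_algebra, 'e::complex_banach) bimodule \<Rightarrow> ('b, 'f::complex_banach) bimodule \<Rightarrow>
   ('b, 'x::complex_banach) bimodule \<Rightarrow> ('e \<Rightarrow> 'f \<Rightarrow> 'x) \<Rightarrow> bool" where
  "bimodule_tensor E F X t \<longleftrightarrow> cstar_bimodule X \<and>
     internal_tensor (ip E) (lact F) (ip F) (ip X) t \<and>
     (\<forall>\<xi> \<eta> b. lact X b (t \<xi> \<eta>) = t (lact E b \<xi>) \<eta>) \<and>
     (\<forall>\<xi> \<eta> b. ract X (t \<xi> \<eta>) b = t \<xi> (ract F \<eta> b))"

text \<open>\<open>S \<otimes> T\<close>, sending \<open>x \<otimes> y\<close> to \<open>S x \<otimes> T y\<close>, for tensor maps \<open>t\<close> and \<open>t'\<close>.\<close>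

definition tensor_op ::
  "('e::real_normed_vector \<Rightarrow> 'f::real_normed_vector \<Rightarrow> 'x::real_normed_vector) \<Rightarrow>
   ('e'::real_normed_vector \<Rightarrow> 'f'::real_normed_vector \<Rightarrow> 'x'::real_normed_vector) \<Rightarrow>
   ('e \<Rightarrow>\<^sub>L 'e') \<Rightarrow> ('f \<Rightarrow>\<^sub>L 'f') \<Rightarrow> ('x \<Rightarrow>\<^sub>L 'x')" where
  "tensor_op t t' S T = (THE X :: 'x \<Rightarrow>\<^sub>L 'x'. \<forall>x y. X (t x y) = t' (S x) (T y))"


section \<open>Homogeneous operators and elements\<close>

definition hom_adjoint ::
  "('b::cstar_algebra \<rightharpoonup> 'b) \<Rightarrow> ('b, 'e::complex_banach) bimodule \<Rightarrow>
   ('b, 'f::complex_banach) bimodule \<Rightarrow> ('e \<Rightarrow> 'f) \<Rightarrow> ('f \<Rightarrow> 'e) \<Rightarrow> bool" where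
  "hom_adjoint \<sigma> E F T S \<longleftrightarrow> (\<forall>\<xi> \<eta>. \<sigma> (ip E (S \<eta>) \<xi>) = Some (ip F \<eta> (T \<xi>)))"

text \<open>Homogeneous maps are automatically bounded and linear, so it is no restriction to
  consider them as elements of the normed space of bounded linear maps.\<close>

definition hom_ops ::
  "('b::cstar_algebra, 'e::complex_banach) bimodule \<Rightarrow> ('b, 'f::complex_banach) bimodule \<Rightarrow>
   ('b \<rightharpoonup> 'b) \<Rightarrow> ('b \<rightharpoonup> 'b) \<Rightarrow> ('e \<Rightarrow>\<^sub>L 'f) set" where
  "hom_ops E F \<rho> \<sigma> = {T :: 'e \<Rightarrow>\<^sub>L 'f.
     range T \<subseteq> \<lbrakk>{lact F b \<eta> | b \<eta>. b \<in> ran \<rho>}\<rbrakk> \<and>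
     (\<forall>a a' \<xi>. \<rho> a = Some a' \<longrightarrow> T (lact E a \<xi>) = lact F a' (T \<xi>)) \<and>
     (\<exists>S. hom_adjoint \<sigma> E F T S)}"

text \<open>The submodule \<open>E Dom(\<theta>)\<close> is closed, and hence a closed span, by Cohen's factorization
  theorem.\<close>

definition hom_elts ::
  "('b::cstar_algebra \<rightharpoonup> 'b) \<Rightarrow> ('b, 'e::complex_banach) bimodule \<Rightarrow> 'e set" where
  "hom_elts \<theta> E = {\<xi> \<in> \<lbrakk>{ract E \<eta> b | \<eta> b. b \<in> dom \<theta>}\<rbrakk>.
     \<forall>b b'. \<theta> b = Some b' \<longrightarrow> ract E \<xi> b = lact E b' \<xi>}"

definition decomposable_wrt ::
  "('b::cstar_algebra \<rightharpoonup> 'b) set \<Rightarrow> ('b, 'e::complex_banach) bimodule \<Rightarrow> bool" where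
  "decomposable_wrt \<Theta> E \<longleftrightarrow> \<lbrakk>\<Union>\<theta>\<in>\<Theta>. hom_elts \<theta> E\<rbrakk> = UNIV"

abbreviation decomposable :: "('b::cstar_algebra, 'e::complex_banach) bimodule \<Rightarrow> bool" where
  "decomposable \<equiv> decomposable_wrt PAut"

definition supported_by ::
  "('b::cstar_algebra \<rightharpoonup> 'b) set \<Rightarrow> ('b, 'e::complex_banach) bimodule \<Rightarrow> bool" where
  "supported_by \<Theta> E \<longleftrightarrow>
     (\<forall>\<theta>\<in>PAut. hom_elts \<theta> E = \<lbrakk>\<Union>\<theta>'\<in>{\<theta>' \<in> \<Theta>. \<theta>' \<subseteq>\<^sub>m \<theta>}. hom_elts \<theta>' E\<rbrakk>)"

definition admissible_semigroup :: "('b::cstar_algebra \<rightharpoonup> 'b) set \<Rightarrow> bool" where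
  "admissible_semigroup \<Theta> \<longleftrightarrow> inverse_subsemigroup \<Theta> \<and> supported_by \<Theta> self_bimodule \<and>
     pid \<in> \<Theta> \<and> (\<forall>\<theta>\<in>\<Theta>. \<forall>\<theta>'\<in>\<Theta>. \<exists>\<mu>\<in>\<Theta>. is_pmeet \<theta> \<theta>' \<mu>)"


section \<open>Families of homogeneous operators\<close>

type_synonym ('b, 'e, 'f) opfam = "('b \<rightharpoonup> 'b) \<Rightarrow> ('b \<rightharpoonup> 'b) \<Rightarrow> ('e \<Rightarrow>\<^sub>L 'f) set"

text \<open>Only the entries of a family at indices in \<open>PAut\<close> are relevant.\<close>

definition op_family ::
  "('b::cstar_algebra, 'e::complex_banach) bimodule \<Rightarrow> ('b, 'f::complex_banach) bimodule \<Rightarrow>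
   ('b, 'e, 'f) opfam \<Rightarrow> bool" where
  "op_family E F \<C> \<longleftrightarrow>
     (\<forall>\<rho>\<in>PAut. \<forall>\<sigma>\<in>PAut. \<C> \<rho> \<sigma> \<subseteq> hom_ops E F \<rho> \<sigma> \<and> csubspace (\<C> \<rho> \<sigma>) \<and> closed (\<C> \<rho> \<sigma>))"

definition fam_le :: "('b::cstar_algebra, 'e, 'f) opfam \<Rightarrow> ('b, 'e, 'f) opfam \<Rightarrow> bool" where
  "fam_le \<C> \<D> \<longleftrightarrow> (\<forall>\<rho>\<in>PAut. \<forall>\<sigma>\<in>PAut. \<C> \<rho> \<sigma> \<subseteq> \<D> \<rho> \<sigma>)"

definition fam_eq :: "('b::cstar_algebra, 'e, 'f) opfam \<Rightarrow> ('b, 'e, 'f) opfam \<Rightarrow> bool" where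
  "fam_eq \<C> \<D> \<longleftrightarrow> (\<forall>\<rho>\<in>PAut. \<forall>\<sigma>\<in>PAut. \<C> \<rho> \<sigma> = \<D> \<rho> \<sigma>)"

definition fam_adj ::
  "('b::cstar_algebra, 'e::complex_banach) bimodule \<Rightarrow> ('b, 'f::complex_banach) bimodule \<Rightarrow>
   ('b, 'e, 'f) opfam \<Rightarrow> ('b, 'f, 'e) opfam" where
  "fam_adj E F \<C> \<rho> \<sigma> =
     {S. \<exists>T\<in>\<C> (pinv \<rho>) (pinv \<sigma>). hom_adjoint (pinv \<sigma>) E F (blinfun_apply T) (blinfun_apply S)}"

definition fam_prod ::
  "('b::cstar_algebra, 'f::complex_banach, 'g::complex_banach) opfam \<Rightarrow>
   ('b, 'e::complex_banach, 'f) opfam \<Rightarrow> ('b, 'e, 'g) opfam" where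
  "fam_prod \<D> \<C> \<rho>'' \<sigma>'' =
     \<lbrakk>{T' o\<^sub>L T | T' T. \<exists>\<rho>'\<in>PAut. \<exists>\<sigma>'\<in>PAut. \<exists>\<rho>\<in>PAut. \<exists>\<sigma>\<in>PAut.
         T' \<in> \<D> \<rho>' \<sigma>' \<and> T \<in> \<C> \<rho> \<sigma> \<and> \<rho>' \<circ>\<^sub>m \<rho> \<subseteq>\<^sub>m \<rho>'' \<and> \<sigma>' \<circ>\<^sub>m \<sigma> \<subseteq>\<^sub>m \<sigma>''}\<rbrakk>"

definition fam_nondegenerate ::
  "('b::cstar_algebra, 'e::complex_banach, 'e) opfam \<Rightarrow> bool" where
  "fam_nondegenerate \<C> \<longleftrightarrow>
     \<lbrakk>{blinfun_apply T \<xi> | T \<xi>. \<exists>\<rho>\<in>PAut. \<exists>\<sigma>\<in>PAut. T \<in> \<C> \<rho> \<sigma>}\<rbrakk> = UNIV"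

definition fam_supported_by ::
  "('b::cstar_algebra \<rightharpoonup> 'b) set \<Rightarrow> ('b, 'e::complex_banach, 'f::complex_banach) opfam \<Rightarrow> bool" where
  "fam_supported_by \<Theta> \<C> \<longleftrightarrow> (\<forall>\<rho>\<in>PAut. \<forall>\<sigma>\<in>PAut.
     \<C> \<rho> \<sigma> = \<lbrakk>{T. \<exists>\<rho>'\<in>\<Theta>. \<exists>\<sigma>'\<in>\<Theta>. \<rho>' \<subseteq>\<^sub>m \<rho> \<and> \<sigma>' \<subseteq>\<^sub>m \<sigma> \<and> T \<in> \<C> \<rho>' \<sigma>'}\<rbrakk>)"

definition l_op ::
  "('b::cstar_algebra, 'e::complex_banach) bimodule \<Rightarrow> 'e \<Rightarrow> ('b \<Rightarrow>\<^sub>L 'e)" where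
  "l_op E \<xi> = Blinfun (\<lambda>b. ract E \<xi> b)"

definition r_op ::
  "('b::cstar_algebra, 'e::complex_banach) bimodule \<Rightarrow> 'e \<Rightarrow> ('b \<Rightarrow>\<^sub>L 'e)" where
  "r_op E \<xi> = Blinfun (\<lambda>b. lact E b \<xi>)"

definition l_mult ::
  "('b::cstar_algebra, 'e::complex_banach) bimodule \<Rightarrow> 'b \<Rightarrow> ('e \<Rightarrow>\<^sub>L 'e)" where
  "l_mult E b = Blinfun (\<lambda>\<xi>. lact E b \<xi>)"

definition r_mult ::
  "('b::cstar_algebra, 'e::complex_banach) bimodule \<Rightarrow> 'b \<Rightarrow> ('e \<Rightarrow>\<^sub>L 'e)" where
  "r_mult E b = Blinfun (\<lambda>\<xi>. ract E \<xi> b)"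

definition l_fam ::
  "('b::cstar_algebra, 'e::complex_banach) bimodule \<Rightarrow> ('b, 'b, 'e) opfam" where
  "l_fam E \<rho> \<sigma> = (if \<sigma> = pid then l_op E ` hom_elts \<rho> E else {0})"

definition r_fam ::
  "('b::cstar_algebra, 'e::complex_banach) bimodule \<Rightarrow> ('b, 'b, 'e) opfam" where
  "r_fam E \<rho> \<sigma> = (if \<rho> = pid then r_op E ` hom_elts (pinv \<sigma>) E else {0})"

definition admissible_bimodule ::
  "('b::cstar_algebra \<rightharpoonup> 'b) set \<Rightarrow> ('b, 'e::complex_banach) bimodule \<Rightarrow> bool" where
  "admissible_bimodule \<Theta> E \<longleftrightarrow> decomposable_wrt \<Theta> E \<and>
     fam_eq (fam_prod (fam_adj self_bimodule E (l_fam E)) (l_fam E)) (l_fam self_bimodule) \<and>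
     fam_eq (fam_prod (fam_adj self_bimodule E (r_fam E)) (r_fam E)) (r_fam self_bimodule)"


section \<open>C*-families\<close>

definition cstar_family ::
  "('b::cstar_algebra, 'e::complex_banach) bimodule \<Rightarrow> ('b, 'e, 'e) opfam \<Rightarrow> bool" where
  "cstar_family E \<C> \<longleftrightarrow> op_family E E \<C> \<and> fam_eq (fam_prod (fam_adj E E \<C>) \<C>) \<C>"

definition \<O> ::
  "('b::cstar_algebra, 'e::complex_banach) bimodule \<Rightarrow> ('b, 'e, 'e) opfam" where
  "\<O> E \<rho> \<sigma> = \<lbrakk>{l_mult E b o\<^sub>L r_mult E b' | b b'.
     b \<in> hom_elts \<rho> self_bimodule \<and> b' \<in> hom_elts (pinv \<sigma>) self_bimodule}\<rbrakk>"

definition admissible_family ::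
  "('b::cstar_algebra \<rightharpoonup> 'b) set \<Rightarrow> ('b, 'e::complex_banach) bimodule \<Rightarrow>
   ('b, 'e, 'e) opfam \<Rightarrow> bool" where
  "admissible_family \<Theta> E \<C> \<longleftrightarrow> cstar_family E \<C> \<and> admissible_bimodule \<Theta> E \<and>
     fam_nondegenerate \<C> \<and> fam_supported_by \<Theta> \<C> \<and> fam_le (fam_prod \<C> (\<O> E)) \<C> \<and>
     (\<forall>\<rho>\<in>\<Theta>. \<forall>\<sigma>\<in>\<Theta>.
        \<lbrakk>{c o\<^sub>L x | c x. c \<in> \<C> \<rho> \<sigma> \<and> x \<in> \<O> E (pinv \<rho> \<circ>\<^sub>m \<rho>) (pinv \<sigma> \<circ>\<^sub>m \<sigma>)}\<rbrakk> = \<C> \<rho> \<sigma>)"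

text \<open>The fiber product of families, on the internal tensor product with tensor map \<open>t\<close>.\<close>

definition fam_fiber_product ::
  "('e::complex_banach \<Rightarrow> 'f::complex_banach \<Rightarrow> 'x::complex_banach) \<Rightarrow>
   ('b::cstar_algebra, 'e, 'e) opfam \<Rightarrow> ('b, 'f, 'f) opfam \<Rightarrow> ('b, 'x, 'x) opfam" where
  "fam_fiber_product t \<C> \<D> \<rho> \<sigma> = \<lbrakk>{tensor_op t t c d | c d. \<exists>\<sigma>'\<in>PAut. \<exists>\<rho>'\<in>PAut.
     c \<in> \<C> \<rho> \<sigma>' \<and> d \<in> \<D> \<rho>' \<sigma> \<and> compatible \<sigma>' \<rho>'}\<rbrakk>"


section \<open>Covariant representations and the induced spaces of operators\<close>

definition covariant_rep ::
  "('b::cstar_algebra \<rightharpoonup> 'b) set \<Rightarrow> ('b \<Rightarrow> 'k::chilbert_space \<Rightarrow>\<^sub>L 'k) \<Rightarrow>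
   (('b \<rightharpoonup> 'b) \<Rightarrow> 'k \<Rightarrow>\<^sub>L 'k) \<Rightarrow> bool" where
  "covariant_rep \<Theta> \<pi> \<upsilon> \<longleftrightarrow>
     (\<forall>b. clinear_op (\<pi> b)) \<and>
     (\<forall>a b. \<pi> (a + b) = \<pi> a + \<pi> b) \<and> (\<forall>c b. \<pi> (c *\<^sub>C b) = c *\<^sub>C \<pi> b) \<and>
     (\<forall>a b. \<pi> (a * b) = \<pi> a o\<^sub>L \<pi> b) \<and> (\<forall>b. \<pi> (star b) = adj (\<pi> b)) \<and>
     (\<forall>\<theta>\<in>\<Theta>. clinear_op (\<upsilon> \<theta>)) \<and>
     (\<forall>\<theta>\<in>\<Theta>. \<forall>\<theta>'\<in>\<Theta>. \<upsilon> \<theta> o\<^sub>L \<upsilon> \<theta>' = \<upsilon> (\<theta> \<circ>\<^sub>m \<theta>')) \<and>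
     (\<forall>\<theta>\<in>\<Theta>. adj (\<upsilon> \<theta>) = \<upsilon> (pinv \<theta>)) \<and>
     (\<forall>\<theta>\<in>\<Theta>. range (\<upsilon> \<theta>) = \<lbrakk>{\<pi> b \<zeta> | b \<zeta>. b \<in> ran \<theta>}\<rbrakk>) \<and>
     (\<forall>\<theta>\<in>\<Theta>. \<forall>b b'. \<theta> b = Some b' \<longrightarrow> \<upsilon> \<theta> o\<^sub>L \<pi> b o\<^sub>L adj (\<upsilon> \<theta>) = \<pi> b')"

text \<open>
  \<open>induced_space E \<pi> tE\<close> says that the Hilbert space \<open>'ie\<close>, with tensor map \<open>tE\<close>, is
  \<open>\<^bold>IE = E \<otimes>\<^sub>\<pi> \<KK>\<close>.
\<close>

definition induced_space ::
  "('b::cstar_algebra, 'e::complex_banach) bimodule \<Rightarrow> ('b \<Rightarrow> 'k::chilbert_space \<Rightarrow>\<^sub>L 'k) \<Rightarrow>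
   ('e \<Rightarrow> 'k \<Rightarrow> 'ie::chilbert_space) \<Rightarrow> bool" where
  "induced_space E \<pi> tE \<longleftrightarrow>
     internal_tensor (ip E) (\<lambda>b. blinfun_apply (\<pi> b)) cinner cinner tE"

text \<open>\<open>\<^bold>J\<C>\<close> for a family \<open>\<C>\<close> of operators from \<open>E\<close> to \<open>F\<close>; the operator \<open>\<^bold>Ic\<close> is
  \<open>c \<otimes> \<upsilon>(\<sigma>)\<close>.\<close>

definition J ::
  "('b::cstar_algebra \<rightharpoonup> 'b) set \<Rightarrow> (('b \<rightharpoonup> 'b) \<Rightarrow> 'k::chilbert_space \<Rightarrow>\<^sub>L 'k) \<Rightarrow>
   ('e::complex_banach \<Rightarrow> 'k \<Rightarrow> 'ie::chilbert_space) \<Rightarrow>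
   ('f::complex_banach \<Rightarrow> 'k \<Rightarrow> 'jf::chilbert_space) \<Rightarrow>
   ('b, 'e, 'f) opfam \<Rightarrow> ('ie \<Rightarrow>\<^sub>L 'jf) set" where
  "J \<Theta> \<upsilon> tE tF \<C> =
     \<lbrakk>{tensor_op tE tF c (\<upsilon> \<sigma>) | c \<rho> \<sigma>. \<rho> \<in> \<Theta> \<and> \<sigma> \<in> \<Theta> \<and> c \<in> \<C> \<rho> \<sigma>}\<rbrakk>"

definition \<alpha> ::
  "('b::cstar_algebra \<rightharpoonup> 'b) set \<Rightarrow> (('b \<rightharpoonup> 'b) \<Rightarrow> 'k::chilbert_space \<Rightarrow>\<^sub>L 'k) \<Rightarrow>
   ('b \<Rightarrow> 'k \<Rightarrow> 'h::chilbert_space) \<Rightarrow> ('e::complex_banach \<Rightarrow> 'k \<Rightarrow> 'ie::chilbert_space) \<Rightarrow>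
   ('b, 'e) bimodule \<Rightarrow> ('h \<Rightarrow>\<^sub>L 'ie) set" where
  "\<alpha> \<Theta> \<upsilon> tB tE E = J \<Theta> \<upsilon> tB tE (l_fam E)"

definition \<beta> ::
  "('b::cstar_algebra \<rightharpoonup> 'b) set \<Rightarrow> (('b \<rightharpoonup> 'b) \<Rightarrow> 'k::chilbert_space \<Rightarrow>\<^sub>L 'k) \<Rightarrow>
   ('b \<Rightarrow> 'k \<Rightarrow> 'h::chilbert_space) \<Rightarrow> ('e::complex_banach \<Rightarrow> 'k \<Rightarrow> 'ie::chilbert_space) \<Rightarrow>
   ('b, 'e) bimodule \<Rightarrow> ('h \<Rightarrow>\<^sub>L 'ie) set" where
  "\<beta> \<Theta> \<upsilon> tB tE E = J \<Theta> \<upsilon> tB tE (r_fam E)"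


section \<open>Relative tensor products and fiber products\<close>

text \<open>As for internal tensor products, \<open>r \<xi> \<zeta> \<eta>\<close> is the elementary tensor
  \<open>\<xi> \<otimes> \<zeta> \<otimes> \<eta>\<close>; only its values for \<open>\<xi> \<in> A\<close> and \<open>\<eta> \<in> D\<close> are relevant.\<close>

definition relative_tensor ::
  "('h::chilbert_space \<Rightarrow>\<^sub>L 'm::chilbert_space) set \<Rightarrow> ('h \<Rightarrow>\<^sub>L 'n::chilbert_space) set \<Rightarrow>
   (('h \<Rightarrow>\<^sub>L 'm) \<Rightarrow> 'h \<Rightarrow> ('h \<Rightarrow>\<^sub>L 'n) \<Rightarrow> 'r::chilbert_space) \<Rightarrow> bool" where
  "relative_tensor A D r \<longleftrightarrow>
     (\<forall>\<xi>\<in>A. \<forall>\<xi>'\<in>A. \<forall>\<eta>\<in>D. \<forall>\<eta>'\<in>D. \<forall>\<zeta> \<zeta>'.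
        cinner (r \<xi> \<zeta> \<eta>) (r \<xi>' \<zeta>' \<eta>') = cinner \<zeta> ((adj \<xi> o\<^sub>L \<xi>' o\<^sub>L adj \<eta> o\<^sub>L \<eta>') \<zeta>')) \<and>
     \<lbrakk>{r \<xi> \<zeta> \<eta> | \<xi> \<zeta> \<eta>. \<xi> \<in> A \<and> \<eta> \<in> D}\<rbrakk> = UNIV"

definition ket1 ::
  "(('h::chilbert_space \<Rightarrow>\<^sub>L 'm::chilbert_space) \<Rightarrow> 'h \<Rightarrow> ('h \<Rightarrow>\<^sub>L 'n::chilbert_space) \<Rightarrow>
     'r::chilbert_space) \<Rightarrow> ('h \<Rightarrow>\<^sub>L 'n) set \<Rightarrow> ('h \<Rightarrow>\<^sub>L 'm) \<Rightarrow> ('n \<Rightarrow>\<^sub>L 'r)" where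
  "ket1 r D \<xi> = (THE X :: 'n \<Rightarrow>\<^sub>L 'r. \<forall>\<eta>\<in>D. \<forall>\<zeta>. X (blinfun_apply \<eta> \<zeta>) = r \<xi> \<zeta> \<eta>)"

definition ket2 ::
  "(('h::chilbert_space \<Rightarrow>\<^sub>L 'm::chilbert_space) \<Rightarrow> 'h \<Rightarrow> ('h \<Rightarrow>\<^sub>L 'n::chilbert_space) \<Rightarrow>
     'r::chilbert_space) \<Rightarrow> ('h \<Rightarrow>\<^sub>L 'm) set \<Rightarrow> ('h \<Rightarrow>\<^sub>L 'n) \<Rightarrow> ('m \<Rightarrow>\<^sub>L 'r)" where
  "ket2 r A \<eta> = (THE X :: 'm \<Rightarrow>\<^sub>L 'r. \<forall>\<xi>\<in>A. \<forall>\<zeta>. X (blinfun_apply \<xi> \<zeta>) = r \<xi> \<zeta> \<eta>)"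

definition fiber_product ::
  "(('h::chilbert_space \<Rightarrow>\<^sub>L 'm::chilbert_space) \<Rightarrow> 'h \<Rightarrow> ('h \<Rightarrow>\<^sub>L 'n::chilbert_space) \<Rightarrow>
     'r::chilbert_space) \<Rightarrow> ('h \<Rightarrow>\<^sub>L 'm) set \<Rightarrow> ('h \<Rightarrow>\<^sub>L 'n) set \<Rightarrow>
   ('m \<Rightarrow>\<^sub>L 'm) set \<Rightarrow> ('n \<Rightarrow>\<^sub>L 'n) set \<Rightarrow> ('r \<Rightarrow>\<^sub>L 'r) set" where
  "fiber_product r A D M N = {T. clinear_op T \<and>
     (\<forall>\<xi>\<in>A. T o\<^sub>L ket1 r D \<xi> \<in> \<lbrakk>{ket1 r D \<xi>' o\<^sub>L y | \<xi>' y. \<xi>' \<in> A \<and> y \<in> N}\<rbrakk> \<and>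
             adj T o\<^sub>L ket1 r D \<xi> \<in> \<lbrakk>{ket1 r D \<xi>' o\<^sub>L y | \<xi>' y. \<xi>' \<in> A \<and> y \<in> N}\<rbrakk>) \<and>
     (\<forall>\<eta>\<in>D. T o\<^sub>L ket2 r A \<eta> \<in> \<lbrakk>{ket2 r A \<eta>' o\<^sub>L x | \<eta>' x. \<eta>' \<in> D \<and> x \<in> M}\<rbrakk> \<and>
             adj T o\<^sub>L ket2 r A \<eta> \<in> \<lbrakk>{ket2 r A \<eta>' o\<^sub>L x | \<eta>' x. \<eta>' \<in> D \<and> x \<in> M}\<rbrakk>)}"

text \<open>
  The unitary \<open>\<tau>\<^bsub>E,F\<^esub>\<close>.  Here \<open>D = \<beta>(F)\<close>, \<open>t\<close> is the tensor map of \<open>E \<otimes> F\<close>, and \<open>tB\<close>, \<open>tE\<close>,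
  \<open>tF\<close>, \<open>tX\<close> are those of \<open>\<^bold>IB\<close>, \<open>\<^bold>IE\<close>, \<open>\<^bold>IF\<close>, \<open>\<^bold>I(E \<otimes> F)\<close>.  The identification
  \<open>E \<otimes> (F \<otimes>\<^sub>\<pi> \<KK>) = (E \<otimes> F) \<otimes>\<^sub>\<pi> \<KK>\<close> is explicit in the operator
  \<open>\<eta> \<otimes> k \<mapsto> (\<xi> \<otimes> \<eta>) \<otimes> k\<close>, which sends \<open>y \<in> \<^bold>IF\<close> to \<open>\<xi> \<otimes> y\<close>.
\<close>

definition \<tau> ::
  "('b::cstar_algebra, 'e::complex_banach) bimodule \<Rightarrow>
   ('e \<Rightarrow> 'f::complex_banach \<Rightarrow> 'x::complex_banach) \<Rightarrow>
   ('b \<Rightarrow> 'k::chilbert_space \<Rightarrow> 'h::chilbert_space) \<Rightarrow> ('e \<Rightarrow> 'k \<Rightarrow> 'ie::chilbert_space) \<Rightarrow>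
   ('f \<Rightarrow> 'k \<Rightarrow> 'jf::chilbert_space) \<Rightarrow> ('x \<Rightarrow> 'k \<Rightarrow> 'ix::chilbert_space) \<Rightarrow>
   (('h \<Rightarrow>\<^sub>L 'ie) \<Rightarrow> 'h \<Rightarrow> ('h \<Rightarrow>\<^sub>L 'jf) \<Rightarrow> 'r::chilbert_space) \<Rightarrow> ('h \<Rightarrow>\<^sub>L 'jf) set \<Rightarrow>
   ('r \<Rightarrow>\<^sub>L 'ix)" where
  "\<tau> E t tB tE tF tX r D = (THE U :: 'r \<Rightarrow>\<^sub>L 'ix. unitary_op U \<and>
     (\<forall>\<xi> \<zeta>. \<forall>\<omega>\<in>D. U (r (tensor_op tB tE (l_op E \<xi>) id_blinfun) \<zeta> \<omega>) =
        tensor_op tF tX (Blinfun (t \<xi>)) id_blinfun (blinfun_apply \<omega> \<zeta>)))"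

end

theory Submission
  imports Defs
begin

text \<open>
  By linearity, continuity and \<open>\<C>\<^sup>* = \<C>\<close>, \<open>\<D>\<^sup>* = \<D>\<close> (a consequence of \<open>[\<C>\<^sup>*\<C>] = \<C>\<close>), it suffices to
  treat \<open>T = \<tau>\<^sup>* \<^bold>I(c \<otimes> d) \<tau>\<close> with \<open>c \<in> \<C>\<^sup>\<rho>\<^sub>\<mu>\<close>, \<open>d \<in> \<D>\<^sup>\<rho>\<^sup>'\<^sub>\<sigma>\<close> and all indices in \<open>\<Theta>\<close>.  Evaluating both sides on
  elementary tensors gives \<open>T |l(\<xi>)\<rangle>\<^sub>1 = |l(c \<xi>)\<rangle>\<^sub>1 \<^bold>I d\<close>.  For \<open>\<eta>\<close> of degree \<open>\<theta>\<^sup>*\<close>, the element \<open>d \<eta>\<close> has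
  degree \<open>(\<sigma> \<theta> \<rho>'\<^sup>*)\<^sup>*\<close>, and \<open>T |\<^bold>I r(\<eta>)\<rangle>\<^sub>2\<close> differs from \<open>|\<^bold>I r(d \<eta>)\<rangle>\<^sub>2 \<^bold>I c\<close> only by \<open>\<upsilon>(\<sigma> \<theta>)\<close> versus
  \<open>\<upsilon>(\<sigma> \<theta> \<rho>'\<^sup>* \<mu>)\<close>.  These agree on \<open>c \<xi> \<otimes> d \<eta>\<close>, whose inner square lies in the image of \<open>\<sigma> \<theta> \<rho>'\<^sup>* \<mu>\<close>
  by compatibility of \<open>\<mu>\<close> and \<open>\<rho>'\<close>.

  Positivity in C*-algebras is avoided: a self-adjoint contraction is the average of two unitaries,
  and this bounds *-homomorphisms, left multiplications and operators on tensor products.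
\<close>

section \<open>Complex Banach spaces and closed spans\<close>

text \<open>\<open>adj\<close>, \<open>tensor_op\<close>, \<open>ket1\<close>, \<open>ket2\<close>
  and \<open>\<tau>\<close> are definite descriptions, so each must first be shown to exist and to
  be unique. For the tensor constructions uniqueness is density of elementary tensors, and existence
  comes down to one kind of estimate: a map prescribed on elementary tensors has to be bounded on
  finite sums. The Gram matrix of the images is that of the tensors, in general with an operator
  such as \<open>T* T\<close> inserted in one factor, and \<open>operator_list_bound\<close>
  controls such insertions. For \<open>c \<otimes> d\<close> the factors cannot be treated one at a
  time: \<open>c\<close> twists the right action and \<open>d\<close> the left one, so neither
  \<open>c \<otimes> 1\<close> nor \<open>1 \<otimes> d\<close> need make sense; but
  \<open>c* c\<close> and \<open>d* d\<close> are untwisted. Without positivity, Cauchy-Schwarz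
  holds with the constant 4 (\<open>ip_bound\<close>), the source of the constants 4, 8 and 32
  below; their size is irrelevant. Two devices reduce homogeneity to ideals: approximate units
  replace factorization of elements, and partial automorphisms are isometric, so that their graphs
  are closed and identities pass to closed spans.\<close>

lemma scaleC_one [simp]: "1 *\<^sub>C x = (x :: 'a::complex_banach)"
  using scaleR_scaleC[of 1 x] by simp

interpretation cplx: vector_space "scaleC :: complex \<Rightarrow> 'a::complex_banach \<Rightarrow> 'a"
  by unfold_locales (simp_all add: scaleC_add_right scaleC_add_left scaleC_scaleC)

lemma scaleC_minus_one [simp]: "(-1) *\<^sub>C x = - (x :: 'a::complex_banach)"
  by simp

lemma bounded_linear_scaleC: "bounded_linear (\<lambda>x :: 'a::complex_banach. c *\<^sub>C x)"
  by (rule bounded_linear_intro[where K = "cmod c"])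
     (simp_all add: scaleC_add_right scaleR_scaleC scaleC_scaleC norm_scaleC mult.commute)

lemmas continuous_on_scaleC [continuous_intros] = bounded_linear.continuous_on[OF bounded_linear_scaleC]
lemmas tendsto_scaleC [tendsto_intros] = bounded_linear.tendsto[OF bounded_linear_scaleC]

lemma csubspaceI:
  assumes "0 \<in> S" "\<And>x y. x \<in> S \<Longrightarrow> y \<in> S \<Longrightarrow> x + y \<in> S" "\<And>c x. x \<in> S \<Longrightarrow> c *\<^sub>C x \<in> S"
  shows "csubspace S"
  using assms by (auto simp: cplx.subspace_def)

lemma csubspace_closure:
  assumes "csubspace S" shows "csubspace (closure S)"
proof (rule csubspaceI)
  show "0 \<in> closure S"
    using assms closure_subset cplx.subspace_0 by blast
  show "x + y \<in> closure S" if xy: "x \<in> closure S" "y \<in> closure S" for x y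
  proof -
    obtain X Y where "\<And>n. X n \<in> S" "X \<longlonglongrightarrow> x" "\<And>n. Y n \<in> S" "Y \<longlonglongrightarrow> y"
      using xy unfolding closure_sequential by blast
    then have "\<And>n. X n + Y n \<in> S" "(\<lambda>n. X n + Y n) \<longlonglongrightarrow> x + y"
      using assms by (auto intro: cplx.subspace_add tendsto_add)
    then show ?thesis
      unfolding closure_sequential by (intro exI[of _ "\<lambda>n. X n + Y n"]) simp
  qed
  show "c *\<^sub>C x \<in> closure S" if "x \<in> closure S" for c x
  proof -
    have "(\<lambda>x. c *\<^sub>C x) ` closure S \<subseteq> closure ((\<lambda>x. c *\<^sub>C x) ` S)"
      by (rule closure_bounded_linear_image_subset[OF bounded_linear_scaleC])
    also have "\<dots> \<subseteq> closure S"
      by (rule closure_mono) (use assms cplx.subspace_scale in auto)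
    finally show ?thesis using that by blast
  qed
qed

lemma closed_closed_span [simp]: "closed \<lbrakk>S\<rbrakk>"
  by (simp add: closed_span_def)

lemma csubspace_closed_span [simp]: "csubspace \<lbrakk>S\<rbrakk>"
  by (simp add: closed_span_def csubspace_closure)

lemma closed_span_superset: "S \<subseteq> \<lbrakk>S\<rbrakk>"
  unfolding closed_span_def using cplx.span_superset closure_subset by blast

lemma closed_span_base: "x \<in> S \<Longrightarrow> x \<in> \<lbrakk>S\<rbrakk>"
  using closed_span_superset by blast

lemma closed_span_minimal: "S \<subseteq> V \<Longrightarrow> csubspace V \<Longrightarrow> closed V \<Longrightarrow> \<lbrakk>S\<rbrakk> \<subseteq> V"
  unfolding closed_span_def by (meson closure_minimal cplx.span_minimal)

lemma closed_span_mono: "S \<subseteq> T \<Longrightarrow> \<lbrakk>S\<rbrakk> \<subseteq> \<lbrakk>T\<rbrakk>"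
  by (meson closed_closed_span closed_span_minimal closed_span_superset csubspace_closed_span order_trans)

text \<open>Meant for maps such as \<open>\<lambda>d. fiber_op c d \<sigma>\<close>: being built
  from definite descriptions, they are known to be linear and bounded only on a subspace
  \<open>A\<close>. Approximating from the span of \<open>S\<close>, which lies in \<open>A\<close>,
  keeps all arguments inside \<open>A\<close>.\<close>

lemma closed_span_bounded_map:
  fixes f :: "'u::complex_banach \<Rightarrow> 'v::complex_banach"
  assumes "csubspace A" "S \<subseteq> A"
    and add: "\<And>x y. x \<in> A \<Longrightarrow> y \<in> A \<Longrightarrow> f (x + y) = f x + f y"
    and scale: "\<And>c x. x \<in> A \<Longrightarrow> f (c *\<^sub>C x) = c *\<^sub>C f x"
    and bdd: "\<And>x. x \<in> A \<Longrightarrow> norm (f x) \<le> K * norm x"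
    and V: "csubspace V" "closed V" "\<And>s. s \<in> S \<Longrightarrow> f s \<in> V"
    and x: "x \<in> \<lbrakk>S\<rbrakk>" "x \<in> A"
  shows "f x \<in> V"
proof -
  have "cplx.span S \<subseteq> {y \<in> A. f y \<in> V}"
  proof (rule cplx.span_minimal)
    show "csubspace {y \<in> A. f y \<in> V}"
    proof (rule csubspaceI)
      have "f 0 = 0" using scale[of 0 0] assms(1) by (simp add: cplx.subspace_0)
      then show "0 \<in> {y \<in> A. f y \<in> V}" using assms(1) V(1) by (simp add: cplx.subspace_0)
      show "x + y \<in> {y \<in> A. f y \<in> V}" if "x \<in> {y \<in> A. f y \<in> V}" "y \<in> {y \<in> A. f y \<in> V}" for x y
        using that add[of x y] cplx.subspace_add[OF assms(1)] cplx.subspace_add[OF V(1)] by simp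
      show "c *\<^sub>C x \<in> {y \<in> A. f y \<in> V}" if "x \<in> {y \<in> A. f y \<in> V}" for c x
        using that scale[of x c] cplx.subspace_scale[OF assms(1)] cplx.subspace_scale[OF V(1)] by simp
    qed
    show "S \<subseteq> {y \<in> A. f y \<in> V}" using assms(2) V(3) by blast
  qed
  moreover obtain X where X: "\<And>n. X n \<in> cplx.span S" "X \<longlonglongrightarrow> x"
    using x(1) unfolding closed_span_def closure_sequential by blast
  ultimately have A: "X n \<in> A" "f (X n) \<in> V" for n by auto
  have diff: "f (X n) - f x = f (X n - x)" for n
  proof -
    have "X n - x \<in> A" using A x(2) assms(1) by (simp add: cplx.subspace_diff)
    from add[OF this x(2)] show ?thesis by simp
  qed
  have null: "(\<lambda>n. K * norm (X n - x)) \<longlonglongrightarrow> 0"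
    by (intro tendsto_mult_right_zero tendsto_norm_zero LIM_zero X(2))
  have le: "norm (f (X n) - f x) \<le> K * norm (X n - x)" for n
    unfolding diff by (rule bdd) (rule cplx.subspace_diff[OF assms(1) A(1) x(2)])
  have "(\<lambda>n. f (X n)) \<longlonglongrightarrow> f x"
    by (rule LIM_zero_cancel[OF Lim_null_comparison[OF always_eventually null]]) (simp add: le)
  with V(2) A(2) show ?thesis
    by (intro Lim_in_closed_set[OF V(2), where f = "\<lambda>n. f (X n)" and F = sequentially]) simp_all
qed

lemma scaleR_scaleC_commute: "r *\<^sub>R c *\<^sub>C x = c *\<^sub>C r *\<^sub>R (x :: 'a::complex_banach)"
  by (simp add: scaleR_scaleC mult.commute)

section \<open>Complex-linear operators among the bounded linear maps\<close>

lemma clinear_opD: "clinear_op T \<Longrightarrow> T (c *\<^sub>C x) = c *\<^sub>C T x"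
  by (simp add: clinear_op_def)

lemma clinear_op_zero [simp]: "clinear_op 0"
  by (simp add: clinear_op_def)

lemma clinear_op_id [simp]: "clinear_op id_blinfun"
  by (simp add: clinear_op_def)

lemma clinear_op_add: "clinear_op S \<Longrightarrow> clinear_op T \<Longrightarrow> clinear_op (S + T)"
  by (simp add: clinear_op_def blinfun.add_left scaleC_add_right)

lemma clinear_op_diff: "clinear_op S \<Longrightarrow> clinear_op T \<Longrightarrow> clinear_op (S - T)"
  by (simp add: clinear_op_def blinfun.diff_left cplx.scale_right_diff_distrib)

lemma clinear_op_scaleR: "clinear_op T \<Longrightarrow> clinear_op (r *\<^sub>R T)"
  by (simp add: clinear_op_def blinfun.scaleR_left scaleR_scaleC_commute)

lemma clinear_op_scaleC: "clinear_op T \<Longrightarrow> clinear_op (c *\<^sub>C T)"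
  by (simp add: clinear_op_def blinfun_apply_scaleC mult.commute)

lemma clinear_op_compose: "clinear_op S \<Longrightarrow> clinear_op T \<Longrightarrow> clinear_op (S o\<^sub>L T)"
  by (simp add: clinear_op_def)

lemma csubspace_clinear: "csubspace {T. clinear_op T}"
  by (intro csubspaceI) (simp_all add: clinear_op_add clinear_op_scaleC)

lemma closed_clinear: "closed {T. clinear_op T}"
  unfolding clinear_op_def
  by (intro closed_Collect_all closed_Collect_eq continuous_intros)

lemma clinear_closed_span:
  assumes "\<And>T. T \<in> S \<Longrightarrow> clinear_op T" "T \<in> \<lbrakk>S\<rbrakk>" shows "clinear_op T"
  using closed_span_minimal[OF _ csubspace_clinear closed_clinear, of S] assms by auto

text \<open>Where two real-linear maps agree need not be a complex subspace; where they agree on all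
  complex multiples is one. This is what closure of \<open>S\<close> under scalars buys. Uniqueness
  in definite descriptions depends on it, because the competing operators are only
  real-linear.\<close>

lemma blinfun_eqI_span:
  assumes "\<lbrakk>S\<rbrakk> = UNIV" and "\<And>c x. x \<in> S \<Longrightarrow> c *\<^sub>C x \<in> S"
    and "\<And>x. x \<in> S \<Longrightarrow> blinfun_apply X x = blinfun_apply Y x"
  shows "X = Y"
proof (rule blinfun_eqI)
  fix x
  have "closed {x. \<forall>c. X (c *\<^sub>C x) = Y (c *\<^sub>C x)}"
    by (intro closed_Collect_all closed_Collect_eq continuous_intros)
  moreover have "csubspace {x. \<forall>c. X (c *\<^sub>C x) = Y (c *\<^sub>C x)}"
    by (intro csubspaceI) (simp_all add: scaleC_add_right blinfun.add_right)
  moreover have "S \<subseteq> {x. \<forall>c. X (c *\<^sub>C x) = Y (c *\<^sub>C x)}"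
    using assms by auto
  ultimately have "\<lbrakk>S\<rbrakk> \<subseteq> {x. \<forall>c. X (c *\<^sub>C x) = Y (c *\<^sub>C x)}"
    by (intro closed_span_minimal)
  then have "X (1 *\<^sub>C x) = Y (1 *\<^sub>C x)" using assms(1) by blast
  then show "X x = Y x" by simp
qed

lemma closed_csubspace_vimage:
  assumes "bounded_linear f" "\<And>c x. f (c *\<^sub>C x) = c *\<^sub>C f x" "csubspace V" "closed V"
  shows "csubspace {x. f x \<in> V}" "closed {x. f x \<in> V}"
proof -
  show "csubspace {x. f x \<in> V}"
    using assms
    by (intro csubspaceI)
       (auto simp: linear_simps cplx.subspace_0 cplx.subspace_add cplx.subspace_scale)
  show "closed {x. f x \<in> V}"
    using continuous_closed_vimage[OF assms(4), of f] assms(1)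
    by (simp add: vimage_def linear_continuous_at)
qed

lemma closed_span_vimage:
  assumes "bounded_linear f" "\<And>c x. f (c *\<^sub>C x) = c *\<^sub>C f x" "csubspace V" "closed V"
    and "\<And>s. s \<in> S \<Longrightarrow> f s \<in> V" "x \<in> \<lbrakk>S\<rbrakk>"
  shows "f x \<in> V"
proof -
  have "S \<subseteq> {x. f x \<in> V}" using assms(5) by auto
  then have "\<lbrakk>S\<rbrakk> \<subseteq> {x. f x \<in> V}"
    by (rule closed_span_minimal) (use closed_csubspace_vimage[OF assms(1-4)] in auto)
  then show ?thesis using assms(6) by auto
qed

lemma bounded_clinear_eqI_span:
  assumes "bounded_linear f" "\<And>c x. f (c *\<^sub>C x) = c *\<^sub>C f x"
    and "bounded_linear g" "\<And>c x. g (c *\<^sub>C x) = c *\<^sub>C g x"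
    and "\<And>s. s \<in> S \<Longrightarrow> f s = g s" "x \<in> \<lbrakk>S\<rbrakk>"
  shows "f x = g x"
proof -
  have "f x - g x \<in> {0}"
  proof (rule closed_span_vimage[where f = "\<lambda>x. f x - g x" and S = S])
    show "bounded_linear (\<lambda>x. f x - g x)" by (intro bounded_linear_sub assms)
    show "csubspace {0}" by (intro csubspaceI) auto
    show "f (c *\<^sub>C x) - g (c *\<^sub>C x) = c *\<^sub>C (f x - g x)" for c x
      by (simp only: assms(2,4) cplx.scale_right_diff_distrib)
    show "f s - g s \<in> {0}" if "s \<in> S" for s using assms(5)[OF that] by simp
  qed (use assms(6) in auto)
  then show ?thesis by simp
qed

lemma le_of_power2_le_mult:
  fixes x :: real assumes "x\<^sup>2 \<le> c * x" "0 \<le> x" "0 \<le> c" shows "x \<le> c"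
  using assms by (cases "x = 0") (simp_all add: power2_eq_square)

text \<open>Square roots are available only for norm strictly below 1. Bounds are therefore proved
  after division by an arbitrary \<open>r > a\<close> and brought down to \<open>a\<close> by this
  limit.\<close>

lemma le_mult_of_gt:
  fixes x y a :: real
  assumes "\<And>r. r > a \<Longrightarrow> x \<le> r * y" shows "x \<le> a * y"
proof (rule tendsto_lowerbound)
  show "((\<lambda>r. r * y) \<longlongrightarrow> a * y) (at_right a)" by (intro tendsto_intros)
  show "\<forall>\<^sub>F r in at_right a. x \<le> r * y"
    using assms by (auto intro: eventually_at_rightI[of _ "a + 1"])
qed simp

section \<open>Hilbert modules\<close>

instantiation complex :: complex_banach
begin
definition scaleC_complex :: "complex \<Rightarrow> complex \<Rightarrow> complex" where
  "scaleC_complex = (*)"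
instance
  by standard (simp_all add: scaleC_complex_def algebra_simps scaleR_conv_of_real norm_mult)
end

text \<open>Hilbert spaces thereby become Hilbert modules over the complex numbers and share all of
  \<open>hilbert_ip\<close> with the modules over \<open>B\<close>.\<close>

instantiation complex :: cstar_algebra
begin
definition star_complex :: "complex \<Rightarrow> complex" where
  "star_complex = cnj"
instance
  by standard (simp_all add: scaleC_complex_def star_complex_def norm_mult power2_eq_square)
end

lemma star_minus: "star (- a) = - star (a :: 'a::cstar_algebra)"
  using star_scaleC[of "-1" a] by simp

lemma star_diff: "star (a - b) = star a - star (b :: 'a::cstar_algebra)"
  using star_add[of a "- b"] by (simp add: star_minus)

lemma star_zero [simp]: "star 0 = (0 :: 'a::cstar_algebra)"
  using star_diff[of 0 0] by simp

lemma norm_star [simp]: "norm (star a) = norm (a :: 'a::cstar_algebra)"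
proof -
  have le: "norm a \<le> norm (star a)" for a :: 'a
    using cstar_identity[of a] norm_mult_ineq[of "star a" a] by - (rule le_of_power2_le_mult, simp_all)
  show ?thesis using le[of a] le[of "star a"] by (simp add: star_star)
qed

lemma bounded_linear_star: "bounded_linear (star :: 'a::cstar_algebra \<Rightarrow> 'a)"
  by (rule bounded_linear_intro[where K = 1]) (simp_all add: star_add scaleR_scaleC star_scaleC)

lemma star_scaleR: "star (r *\<^sub>R a) = r *\<^sub>R star (a :: 'a::cstar_algebra)"
  by (simp add: scaleR_scaleC star_scaleC)

lemma cstar_eq_0I: "star x * x = 0 \<Longrightarrow> x = (0 :: 'a::cstar_algebra)"
  using cstar_identity[of x] by simp

text \<open>The common core of Hilbert spaces, Hilbert modules and the algebra itself with
  \<open>star a * b\<close>. The norm identity \<open>ip_norm\<close> is the only link between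
  \<open>ip\<close> and the norm.\<close>

locale hilbert_ip =
  fixes ip :: "'e::complex_banach \<Rightarrow> 'e \<Rightarrow> 'b::cstar_algebra"
  assumes ip_add_right: "ip x (y + z) = ip x y + ip x z"
    and ip_scale_right: "ip x (c *\<^sub>C y) = c *\<^sub>C ip x y"
    and ip_star: "star (ip x y) = ip y x"
    and ip_norm: "(norm x)\<^sup>2 = norm (ip x x)"
begin

lemma ip_add_left: "ip (x + y) z = ip x z + ip y z"
  by (simp only: ip_star[of z, symmetric] ip_add_right star_add)

lemma ip_scale_left: "ip (c *\<^sub>C x) y = cnj c *\<^sub>C ip x y"
  by (simp only: ip_star[of y, symmetric] ip_scale_right star_scaleC)

lemma ip_zero_right [simp]: "ip x 0 = 0"
  using ip_add_right[of x 0 0] by simp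

lemma ip_zero_left [simp]: "ip 0 x = 0"
  using ip_add_left[of 0 0 x] by simp

lemma ip_diff_right: "ip x (y - z) = ip x y - ip x z"
  using ip_add_right[of x "y - z" z] by simp

lemma ip_diff_left: "ip (x - y) z = ip x z - ip y z"
  using ip_add_left[of "x - y" y z] by simp

lemma ip_self_0 [simp]: "ip x x = 0 \<longleftrightarrow> x = 0"
  by (metis ip_norm ip_zero_left norm_eq_zero zero_eq_power2)

lemma ip_eqI:
  assumes "\<And>z. ip z x = ip z y" shows "x = y"
proof -
  have "ip (x - y) (x - y) = 0" unfolding ip_diff_right[of "x - y" x y] assms by simp
  then show ?thesis by simp
qed

lemma ip_polarization:
  "4 *\<^sub>C ip x y = ip (x + y) (x + y) - ip (x - y) (x - y)
     - \<i> *\<^sub>C ip (x + \<i> *\<^sub>C y) (x + \<i> *\<^sub>C y) + \<i> *\<^sub>C ip (x - \<i> *\<^sub>C y) (x - \<i> *\<^sub>C y)"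
proof -
  have "(1 + 1 + 1 + 1) *\<^sub>C z = z + z + z + z" for z :: 'b
    by (simp only: scaleC_add_left scaleC_one)
  then have four: "4 *\<^sub>C z = z + z + z + z" for z :: 'b
    by simp
  show ?thesis
    unfolding four
    by (simp add: ip_add_right ip_add_left ip_diff_right ip_diff_left ip_scale_right ip_scale_left
        scaleC_add_right cplx.scale_right_diff_distrib)
qed

text \<open>Cauchy-Schwarz with a worse constant, obtained by polarization: for unit vectors each of
  the four inner squares has norm at most 4, and division by the 4 of the polarization identity
  leaves 4.\<close>

lemma ip_bound: "norm (ip x y) \<le> 4 * norm x * norm y"
proof -
  have 1: "norm (ip x y) \<le> 4" if "norm x = 1" "norm y = 1" for x y
  proof -
    have le: "norm (ip z z) \<le> 4" if "norm z \<le> 2" for z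
      using that ip_norm[of z] power_mono[OF that, of 2] by simp
    let ?a = "x + y" and ?b = "x - y" and ?c = "x + \<i> *\<^sub>C y" and ?d = "x - \<i> *\<^sub>C y"
    have "norm ?a \<le> 2" "norm ?b \<le> 2" "norm ?c \<le> 2" "norm ?d \<le> 2"
      using norm_triangle_ineq[of x y] norm_triangle_ineq4[of x y]
        norm_triangle_ineq[of x "\<i> *\<^sub>C y"] norm_triangle_ineq4[of x "\<i> *\<^sub>C y"] that
      by (simp_all add: norm_scaleC)
    note n = this[THEN le]
    have "norm (4 *\<^sub>C ip x y) \<le> norm (ip ?a ?a) + norm (ip ?b ?b) + norm (ip ?c ?c) + norm (ip ?d ?d)"
      unfolding ip_polarization
      by (rule order_trans[OF norm_triangle_ineq] add_mono order_trans[OF norm_triangle_ineq4])+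
         (simp_all add: norm_scaleC)
    then show ?thesis using n by (simp add: norm_scaleC)
  qed
  show ?thesis
  proof (cases "x = 0 \<or> y = 0")
    case False
    let ?u = "complex_of_real (1 / norm x) *\<^sub>C x" and ?v = "complex_of_real (1 / norm y) *\<^sub>C y"
    have "norm (ip ?u ?v) \<le> 4" by (rule 1) (use False in \<open>simp_all add: norm_scaleC norm_divide\<close>)
    moreover have "norm (ip ?u ?v) = norm (ip x y) / (norm x * norm y)"
      by (simp add: ip_scale_left ip_scale_right norm_scaleC norm_divide norm_mult)
    ultimately have "norm (ip x y) / (norm x * norm y) \<le> 4" by simp
    then show ?thesis using False by (simp add: divide_simps mult_ac)
  qed auto
qed

lemma bounded_bilinear_ip: "bounded_bilinear ip"
proof
  show "\<exists>K. \<forall>x y. norm (ip x y) \<le> norm x * norm y * K"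
    using ip_bound by (intro exI[of _ 4]) (simp add: mult_ac)
qed (simp_all add: ip_add_left ip_add_right scaleR_scaleC ip_scale_left ip_scale_right)

lemmas ip_scaleR_right = bounded_bilinear.scaleR_right[OF bounded_bilinear_ip]
lemmas ip_scaleR_left = bounded_bilinear.scaleR_left[OF bounded_bilinear_ip]
lemmas bounded_linear_ip_right = bounded_bilinear.bounded_linear_right[OF bounded_bilinear_ip]
lemmas bounded_linear_ip_left = bounded_bilinear.bounded_linear_left[OF bounded_bilinear_ip]

text \<open>The substitute for positivity: \<open>v\<close> is the average of \<open>v + \<i> w\<close> and \<open>v - \<i> w\<close>, which have
  the same inner square as \<open>z\<close>.\<close>

lemma norm_le_of_sum_squares:
  assumes "ip v v + ip w w = ip z z" "ip v w = ip w v"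
  shows "norm v \<le> norm z"
proof -
  have "ip (v + \<i> *\<^sub>C w) (v + \<i> *\<^sub>C w) = ip z z" "ip (v - \<i> *\<^sub>C w) (v - \<i> *\<^sub>C w) = ip z z"
    using assms
    by (simp_all add: ip_add_left ip_add_right ip_diff_left ip_diff_right ip_scale_left ip_scale_right
        algebra_simps)
  then have "norm (v + \<i> *\<^sub>C w) = norm z" "norm (v - \<i> *\<^sub>C w) = norm z"
    using ip_norm by (metis norm_ge_zero power2_eq_iff_nonneg)+
  then have "norm ((v + \<i> *\<^sub>C w) + (v - \<i> *\<^sub>C w)) \<le> 2 * norm z"
    using norm_triangle_ineq[of "v + \<i> *\<^sub>C w" "v - \<i> *\<^sub>C w"] by simp
  moreover have "(v + \<i> *\<^sub>C w) + (v - \<i> *\<^sub>C w) = 2 *\<^sub>R v" by (simp add: scaleR_2)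
  ultimately show ?thesis by simp
qed

lemma ip_zero_on_closed_span:
  assumes "\<And>s. s \<in> S \<Longrightarrow> ip x s = 0" "y \<in> \<lbrakk>S\<rbrakk>"
  shows "ip x y = 0"
  using bounded_clinear_eqI_span[of "ip x" "\<lambda>_. 0" S y] assms
  by (simp add: bounded_linear_ip_right ip_scale_right)

lemma ip_eqI_span:
  assumes "\<lbrakk>S\<rbrakk> = UNIV" "\<And>s. s \<in> S \<Longrightarrow> ip s x = ip s y"
  shows "x = y"
proof (rule ip_eqI)
  fix z
  have "ip (x - y) z = 0"
  proof (rule ip_zero_on_closed_span[of S])
    show "ip (x - y) s = 0" if "s \<in> S" for s
      using assms(2)[OF that] by (metis ip_diff_right ip_star right_minus_eq star_zero)
  qed (use assms in auto)
  then show "ip z x = ip z y" by (metis ip_diff_right ip_star right_minus_eq star_zero)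
qed

end

lemma hilbert_ip_cinner: "hilbert_ip (cinner :: 'a::chilbert_space \<Rightarrow> 'a \<Rightarrow> complex)"
proof
  show "(norm x)\<^sup>2 = norm (cinner x x)" for x :: 'a
    by (simp only: cinner_self norm_of_real) simp
  show "star (cinner x y) = cinner y x" for x y :: 'a
    by (metis cinner_commute star_complex_def)
qed (simp_all add: cinner_add_right cinner_scaleC_right scaleC_complex_def)

interpretation cinner: hilbert_ip cinner by (rule hilbert_ip_cinner)

lemma hilbert_ip_algebra: "hilbert_ip (\<lambda>a b :: 'b::cstar_algebra. star a * b)"
  by standard (simp_all add: algebra_simps mult_scaleC_right star_mult star_star cstar_identity)

section \<open>Square roots\<close>

text \<open>A solution \<open>q\<close> of \<open>2 q = x + q\<^sup>2\<close> encodes the square root \<open>1 - q\<close> of \<open>1 - x\<close> in an algebra that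
  need not have a unit.\<close>

lemma sqrt_fixed_point:
  fixes m :: "'a::banach \<Rightarrow> 'a \<Rightarrow> 'a"
  assumes m: "bounded_bilinear m" "\<And>x y. norm (m x y) \<le> norm x * norm y"
    and x: "norm x < 1" and S: "closed S" "0 \<in> S"
    and step: "\<And>q. q \<in> S \<Longrightarrow> (1/2) *\<^sub>R (x + m q q) \<in> S"
  shows "\<exists>q\<in>S. q + q = x + m q q"
proof -
  interpret bounded_bilinear m by fact
  \<comment> \<open>The ball of radius \<open>\<rho>\<close> is invariant because
    \<open>\<rho> < 1\<close> gives \<open>norm (m q q) \<le> \<rho>\<close> on it, and there the
    iteration contracts by the factor \<open>\<rho>\<close>. The closed set \<open>S\<close> carries
    algebraic side conditions along.\<close>
  define \<rho> where "\<rho> = norm x"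
  have \<rho>: "0 \<le> \<rho>" "\<rho> < 1" using x by (auto simp: \<rho>_def)
  let ?f = "\<lambda>q. (1/2) *\<^sub>R (x + m q q)"
  let ?S = "S \<inter> cball 0 \<rho>"
  have "\<exists>!q\<in>?S. ?f q = q"
  proof (rule Banach_fix)
    show "complete ?S" using S by (simp add: closed_Int complete_eq_closed)
    show "?S \<noteq> {}" using S \<rho> by (auto intro!: exI[of _ 0])
    show "0 \<le> \<rho>" "\<rho> < 1" by fact+
    show "?f ` ?S \<subseteq> ?S"
    proof safe
      fix q assume q: "q \<in> S" "q \<in> cball 0 \<rho>"
      then show "?f q \<in> S" by (simp add: step)
      have "norm (m q q) \<le> \<rho> * 1"
        using m(2)[of q q] q \<rho> mult_mono[of "norm q" \<rho> "norm q" 1] by auto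
      then have "norm (x + m q q) \<le> 2 * \<rho>"
        using norm_triangle_ineq[of x "m q q"] by (simp add: \<rho>_def)
      then show "?f q \<in> cball 0 \<rho>" by simp
    qed
    show "dist (?f p) (?f q) \<le> \<rho> * dist p q" if pq: "p \<in> ?S" "q \<in> ?S" for p q
    proof -
      have "m p p - m q q = m (p - q) p + m q (p - q)"
        by (simp add: diff_left diff_right)
      then have "norm (m p p - m q q) \<le> norm (p - q) * norm p + norm q * norm (p - q)"
        by (metis m(2) add_mono norm_triangle_le)
      also have "\<dots> \<le> norm (p - q) * \<rho> + \<rho> * norm (p - q)"
        using pq by (intro add_mono mult_left_mono mult_right_mono) auto
      finally have "norm (m p p - m q q) \<le> 2 * \<rho> * norm (p - q)" by (simp add: mult_ac)
      moreover have "?f p - ?f q = (1/2) *\<^sub>R (m p p - m q q)" by (simp add: algebra_simps)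
      ultimately show "dist (?f p) (?f q) \<le> \<rho> * dist p q" by (simp add: dist_norm)
    qed
  qed
  then obtain q where q: "q \<in> S" "?f q = q" by blast
  have "x + m q q = 2 *\<^sub>R ?f q" by simp
  also have "\<dots> = q + q" by (simp only: q(2) scaleR_2)
  finally show ?thesis using q(1) by metis
qed

text \<open>The fixed point is taken for \<open>x * x\<close>, so \<open>1 - q\<close> is a square
  root of \<open>1 - x * x\<close>, and \<open>x\<close> and \<open>1 - q\<close> play the roles of
  sine and cosine. That \<open>q\<close> lies in \<open>I\<close> is what later allows a partial
  automorphism with domain \<open>I\<close> to be applied to it.\<close>

lemma cstar_sqrt:
  fixes x :: "'b::cstar_algebra"
  assumes "closed_ideal I" "x \<in> I" "star x = x" "norm x < 1"
  shows "\<exists>q\<in>I. star q = q \<and> q * x = x * q \<and> q + q = x * x + q * q"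
proof -
  have I: "csubspace I" "closed I" "\<And>a b. a \<in> I \<Longrightarrow> a * b \<in> I"
    using assms(1) by (auto simp: closed_ideal_def)
  let ?S = "I \<inter> {q. star q = q \<and> q * x = x * q}"
  have "\<exists>q\<in>?S. q + q = x * x + q * q"
  proof (rule sqrt_fixed_point[where m = "(*)" and x = "x * x"])
    show "bounded_bilinear ((*) :: 'b \<Rightarrow> 'b \<Rightarrow> 'b)" by (rule bounded_bilinear_mult)
    show "norm (a * b) \<le> norm a * norm b" for a b :: 'b by (rule norm_mult_ineq)
    have "norm (x * x) \<le> norm x * norm x" by (rule norm_mult_ineq)
    also have "\<dots> < 1" using assms(4) by (simp add: power_less_one_iff flip: power2_eq_square)
    finally show "norm (x * x) < 1" .
    have "closed {q. star q = q \<and> q * x = x * q}"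
      by (intro closed_Collect_conj closed_Collect_eq continuous_intros
          linear_continuous_on bounded_linear_star)
    then show "closed ?S" using I by blast
    show "0 \<in> ?S" using I by (simp add: cplx.subspace_0)
    fix q assume q: "q \<in> ?S"
    then have "(1/2) *\<^sub>R (x * x + q * q) \<in> I"
      using I(1,3) assms(2) by (simp add: scaleR_scaleC cplx.subspace_scale cplx.subspace_add)
    moreover have "q * q * x = x * (q * q)"
    proof -
      have qx: "q * x = x * q" using q by simp
      show ?thesis by (simp only: mult.assoc qx) (simp only: mult.assoc[symmetric] qx)
    qed
    moreover have "star ((1/2) *\<^sub>R (x * x + q * q)) = (1/2) *\<^sub>R (x * x + q * q)"
      using q assms(3) by (simp add: star_scaleR star_add star_mult)
    ultimately show "(1/2) *\<^sub>R (x * x + q * q) \<in> ?S"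
      by (simp add: distrib_left distrib_right mult.assoc)
  qed
  then show ?thesis by auto
qed

lemma closed_Collect_commute:
  "closed {Q :: 'a::real_normed_vector \<Rightarrow>\<^sub>L 'a. Z o\<^sub>L Q = Q o\<^sub>L Z}"
  by (intro closed_Collect_eq linear_continuous_on
      bounded_bilinear.bounded_linear_left[OF bounded_bilinear_blinfun_compose]
      bounded_bilinear.bounded_linear_right[OF bounded_bilinear_blinfun_compose])

context hilbert_ip
begin

lemma closed_selfadjoint: "closed {Q :: 'e \<Rightarrow>\<^sub>L 'e. \<forall>x y. ip (Q x) y = ip x (Q y)}"
  by (intro closed_Collect_all closed_Collect_eq
      bounded_linear.continuous_on[OF bounded_linear_ip_left]
      bounded_linear.continuous_on[OF bounded_linear_ip_right] continuous_intros)

text \<open>The same iteration for operators, with one more property passed through it: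
  \<open>Q\<close> commutes with every complex-linear operator that commutes with \<open>P\<close>.
  An operator on one factor of a balanced tensor product may have to commute with the action in the
  middle; the square root inherits this.\<close>

lemma operator_sqrt:
  fixes P :: "'e \<Rightarrow>\<^sub>L 'e"
  assumes "clinear_op P" "\<And>x y. ip (P x) y = ip x (P y)" "norm P < 1"
  shows "\<exists>Q. clinear_op Q \<and> (\<forall>x y. ip (Q x) y = ip x (Q y)) \<and> Q + Q = (P o\<^sub>L P) + (Q o\<^sub>L Q) \<and>
    (\<forall>Z. clinear_op Z \<longrightarrow> Z o\<^sub>L P = P o\<^sub>L Z \<longrightarrow> Z o\<^sub>L Q = Q o\<^sub>L Z)"
proof -
  let ?S = "{Q. clinear_op Q} \<inter> {Q :: 'e \<Rightarrow>\<^sub>L 'e. \<forall>x y. ip (Q x) y = ip x (Q y)} \<inter>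
    (\<Inter>Z\<in>{Z. clinear_op Z \<and> Z o\<^sub>L P = P o\<^sub>L Z}. {Q. Z o\<^sub>L Q = Q o\<^sub>L Z})"
  have "\<exists>Q\<in>?S. Q + Q = (P o\<^sub>L P) + (Q o\<^sub>L Q)"
  proof (rule sqrt_fixed_point[where m = "(o\<^sub>L)" and x = "P o\<^sub>L P"])
    show "bounded_bilinear (o\<^sub>L)" by (rule bounded_bilinear_blinfun_compose)
    show "norm (a o\<^sub>L b) \<le> norm a * norm b" for a b :: "'e \<Rightarrow>\<^sub>L 'e" by (rule norm_blinfun_compose)
    have "norm (P o\<^sub>L P) \<le> norm P * norm P" by (rule norm_blinfun_compose)
    also have "\<dots> < 1" using assms(3) by (simp add: power_less_one_iff flip: power2_eq_square)
    finally show "norm (P o\<^sub>L P) < 1" .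
    show "closed ?S"
      by (intro closed_Int closed_INT ballI closed_clinear closed_selfadjoint closed_Collect_commute)
    show "0 \<in> ?S" by (auto intro!: blinfun_eqI simp: blinfun.zero_right)
    fix Q assume Q: "Q \<in> ?S"
    have "Z o\<^sub>L (1/2) *\<^sub>R ((P o\<^sub>L P) + (Q o\<^sub>L Q)) = (1/2) *\<^sub>R ((P o\<^sub>L P) + (Q o\<^sub>L Q)) o\<^sub>L Z"
      if Z: "clinear_op Z" "Z o\<^sub>L P = P o\<^sub>L Z" for Z
    proof (rule blinfun_eqI)
      fix x
      have *: "Z (P x) = P (Z x)" "Z (Q x) = Q (Z x)" for x
        using Z Q by (auto dest!: spec[of _ Z] dest: arg_cong[of _ _ "\<lambda>T. blinfun_apply T x"])
      then show "blinfun_apply (Z o\<^sub>L (1/2) *\<^sub>R ((P o\<^sub>L P) + (Q o\<^sub>L Q))) x =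
        blinfun_apply ((1/2) *\<^sub>R ((P o\<^sub>L P) + (Q o\<^sub>L Q)) o\<^sub>L Z) x"
        by (simp add: blinfun.add_left blinfun.add_right blinfun.scaleR_left blinfun.scaleR_right)
    qed
    moreover have "clinear_op ((1/2) *\<^sub>R ((P o\<^sub>L P) + (Q o\<^sub>L Q)))"
      using Q assms(1) by (intro clinear_op_scaleR clinear_op_add clinear_op_compose) auto
    moreover have "ip (blinfun_apply ((1/2) *\<^sub>R ((P o\<^sub>L P) + (Q o\<^sub>L Q))) x) y = ip x (blinfun_apply ((1/2) *\<^sub>R ((P o\<^sub>L P) + (Q o\<^sub>L Q))) y)"
      for x y
      using Q assms(2)
      by (simp add: blinfun.add_left blinfun.scaleR_left ip_scaleR_left ip_scaleR_right
          ip_add_left ip_add_right)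
    ultimately show "(1/2) *\<^sub>R ((P o\<^sub>L P) + (Q o\<^sub>L Q)) \<in> ?S" by auto
  qed
  then show ?thesis by auto
qed

end

section \<open>Partial automorphisms\<close>

lemma closed_ideal_UNIV: "closed_ideal UNIV"
  by (simp add: closed_ideal_def cplx.subspace_UNIV)

lemma PAut_inj: "\<theta> \<in> PAut \<Longrightarrow> \<theta> x = Some z \<Longrightarrow> \<theta> y = Some z \<Longrightarrow> x = y"
  by (auto simp: PAut_def inj_on_def dom_def)

lemma pinv_eq_Some_iff:
  assumes "\<theta> \<in> PAut" shows "pinv \<theta> y = Some x \<longleftrightarrow> \<theta> x = Some y"
proof (cases "y \<in> ran \<theta>")
  case True
  then obtain z where z: "\<theta> z = Some y" by (auto simp: ran_def)
  then have "(THE x. \<theta> x = Some y) = z" using PAut_inj[OF assms] by blast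
  then have "pinv \<theta> y = Some z" using True by (simp add: pinv_def)
  then show ?thesis using z PAut_inj[OF assms z, of x] by auto
next
  case False
  then show ?thesis by (auto simp: pinv_def ran_def)
qed

lemma map_le_iff: "f \<subseteq>\<^sub>m g \<longleftrightarrow> (\<forall>x y. f x = Some y \<longrightarrow> g x = Some y)"
  by (force simp: map_le_def dom_def)

lemma dom_pinv [simp]: "dom (pinv \<theta>) = ran \<theta>"
  by (auto simp: pinv_def dom_def)

lemma pinv_pinv:
  assumes "\<theta> \<in> PAut" shows "pinv (pinv \<theta>) = \<theta>"
proof
  fix x
  have ran: "ran (pinv \<theta>) = dom \<theta>"
    by (auto simp: ran_def pinv_eq_Some_iff[OF assms])
  show "pinv (pinv \<theta>) x = \<theta> x"
  proof (cases "\<theta> x")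
    case None
    then have "x \<notin> ran (pinv \<theta>)" unfolding ran by auto
    then show ?thesis using None by (simp add: pinv_def[of "pinv \<theta>"])
  next
    case (Some y)
    then have "x \<in> ran (pinv \<theta>)" unfolding ran by auto
    moreover have "(THE z. pinv \<theta> z = Some x) = y"
      using Some by (auto simp: pinv_eq_Some_iff[OF assms])
    ultimately show ?thesis using Some by (simp add: pinv_def[of "pinv \<theta>"])
  qed
qed

lemma ran_pinv: "\<theta> \<in> PAut \<Longrightarrow> ran (pinv \<theta>) = dom \<theta>"
  by (metis dom_pinv pinv_pinv)

lemma PAut_hom:
  assumes "\<theta> \<in> PAut" "\<theta> a = Some a'"
  shows PAut_star: "\<theta> (star a) = Some (star a')"
    and PAut_scaleC: "\<theta> (c *\<^sub>C a) = Some (c *\<^sub>C a')"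
    and PAut_add: "\<theta> b = Some b' \<Longrightarrow> \<theta> (a + b) = Some (a' + b')"
    and PAut_mult: "\<theta> b = Some b' \<Longrightarrow> \<theta> (a * b) = Some (a' * b')"
  using assms by (auto simp: PAut_def)

lemma PAut_ideal:
  assumes "\<theta> \<in> PAut" shows "closed_ideal (dom \<theta>)" "closed_ideal (ran \<theta>)"
  using assms by (auto simp: PAut_def)

lemma closed_idealD:
  assumes "closed_ideal I"
  shows "csubspace I" "closed I" "a \<in> I \<Longrightarrow> a * b \<in> I" "a \<in> I \<Longrightarrow> b * a \<in> I"
  using assms by (auto simp: closed_ideal_def)

lemma PAut_diff:
  assumes "\<theta> \<in> PAut" "\<theta> a = Some a'" "\<theta> b = Some b'"
  shows "\<theta> (a - b) = Some (a' - b')"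
  using PAut_add[OF assms(1,2) PAut_scaleC[OF assms(1,3), of "-1"]] by simp

lemma PAut_zero: assumes "\<theta> \<in> PAut" shows "\<theta> 0 = Some 0"
proof -
  have "0 \<in> dom \<theta>"
    using closed_idealD(1)[OF PAut_ideal(1)[OF assms]] by (simp add: cplx.subspace_0)
  then obtain z where "\<theta> 0 = Some z" by auto
  then show ?thesis using PAut_diff[OF assms, of 0 z 0 z] by simp
qed

lemma pinv_PAut: assumes "\<theta> \<in> PAut" shows "pinv \<theta> \<in> PAut"
proof -
  have "inj_on (pinv \<theta>) (dom (pinv \<theta>))"
  proof (rule inj_onI)
    fix x y assume "x \<in> dom (pinv \<theta>)" "pinv \<theta> x = pinv \<theta> y"
    then obtain z where "pinv \<theta> x = Some z" "pinv \<theta> y = Some z" by fastforce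
    then show "x = y" by (simp add: pinv_eq_Some_iff[OF assms])
  qed
  then show ?thesis
    using PAut_ideal[OF assms] ran_pinv[OF assms] PAut_hom[OF assms]
    by (simp add: PAut_def pinv_eq_Some_iff[OF assms])
qed

lemma pid_PAut: "pid \<in> (PAut :: ('b::cstar_algebra \<rightharpoonup> 'b) set)"
proof -
  have "dom (pid :: 'b \<rightharpoonup> 'b) = UNIV" "ran (pid :: 'b \<rightharpoonup> 'b) = UNIV"
    by (auto simp: dom_def ran_def)
  then show ?thesis by (auto simp: PAut_def inj_on_def closed_ideal_UNIV)
qed

lemma pinv_pid [simp]: "pinv (pid :: 'b::cstar_algebra \<rightharpoonup> 'b) = pid"
  by (rule ext) (simp add: pinv_eq_Some_iff[OF pid_PAut])

lemma pid_comp [simp]: "pid \<circ>\<^sub>m \<theta> = \<theta>" "\<theta> \<circ>\<^sub>m pid = \<theta>"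
  by (auto simp: map_comp_def split: option.splits)

lemma PAut_comp_pinv_le:
  assumes "\<rho>1 \<in> PAut" "\<rho>2 \<in> PAut" "\<rho> \<in> PAut" "\<rho>1 \<circ>\<^sub>m \<rho>2 \<subseteq>\<^sub>m \<rho>"
  shows "pinv \<rho>2 \<circ>\<^sub>m pinv \<rho>1 \<subseteq>\<^sub>m pinv \<rho>"
  using assms(4) unfolding map_le_iff
  by (auto simp: map_comp_Some_iff pinv_eq_Some_iff assms)

lemma compatible_pinv:
  "\<rho> \<in> PAut \<Longrightarrow> \<sigma> \<in> PAut \<Longrightarrow> compatible \<rho> \<sigma> \<Longrightarrow> compatible (pinv \<rho>) (pinv \<sigma>)"
  by (simp add: compatible_def pinv_pinv)

text \<open>\<open>\<rho> \<circ>\<^sub>m pinv \<sigma>\<close> below the identity gives the first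
  conjunct, \<open>pinv \<rho> \<circ>\<^sub>m \<sigma>\<close> below it the second: the union of
  the two graphs is a partial bijection.\<close>

lemma compatible_iff:
  assumes "\<rho> \<in> PAut" "\<sigma> \<in> PAut"
  shows "compatible \<rho> \<sigma> \<longleftrightarrow>
    (\<forall>x y z. \<rho> x = Some y \<longrightarrow> \<sigma> x = Some z \<longrightarrow> y = z) \<and>
    (\<forall>x y z. \<rho> x = Some z \<longrightarrow> \<sigma> y = Some z \<longrightarrow> x = y)"
proof -
  have "\<rho> \<circ>\<^sub>m pinv \<sigma> \<subseteq>\<^sub>m pid \<longleftrightarrow> (\<forall>x y z. \<rho> x = Some y \<longrightarrow> \<sigma> x = Some z \<longrightarrow> y = z)"
    by (auto simp: map_le_iff map_comp_Some_iff pinv_eq_Some_iff assms)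
  moreover have "pinv \<rho> \<circ>\<^sub>m \<sigma> \<subseteq>\<^sub>m pid \<longleftrightarrow> (\<forall>x y z. \<rho> x = Some z \<longrightarrow> \<sigma> y = Some z \<longrightarrow> x = y)"
    by (auto simp: map_le_iff map_comp_Some_iff pinv_eq_Some_iff assms)
  ultimately show ?thesis by (simp add: compatible_def)
qed

lemma compatible_mono:
  assumes PAut: "\<rho> \<in> PAut" "\<rho>' \<in> PAut" "\<sigma> \<in> PAut" "\<sigma>' \<in> PAut"
    and le: "\<rho>' \<subseteq>\<^sub>m \<rho>" "\<sigma>' \<subseteq>\<^sub>m \<sigma>" and comp: "compatible \<rho> \<sigma>"
  shows "compatible \<rho>' \<sigma>'"
proof -
  have \<rho>: "\<rho> x = Some y" if "\<rho>' x = Some y" for x y using le(1) that by (simp add: map_le_iff)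
  have \<sigma>: "\<sigma> x = Some y" if "\<sigma>' x = Some y" for x y using le(2) that by (simp add: map_le_iff)
  show ?thesis
    using comp unfolding compatible_iff[OF PAut(1,3)] compatible_iff[OF PAut(2,4)]
    by (meson \<rho> \<sigma>)
qed

section \<open>Norm estimates from square roots; partial automorphisms are isometric\<close>

context hilbert_ip
begin

text \<open>The last hypothesis says that the square of \<open>X\<close> plus the square of
  \<open>1 - Q\<close> fixes \<open>z\<close>. Hence the inner squares of \<open>X z\<close> and
  \<open>z - Q z\<close> add up to that of \<open>z\<close>.\<close>

lemma norm_le_of_selfadjoint:
  assumes "\<And>x y. ip (X x) y = ip x (X y)" "\<And>x y. ip (Q x) y = ip x (Q y)"
    and "X (Q z) = Q (X z)" "Q z + Q z = X (X z) + Q (Q z)"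
  shows "norm (X z) \<le> norm z"
proof (rule norm_le_of_sum_squares[where w = "z - Q z"])
  have "ip z (Q z) + ip z (Q z) = ip z (X (X z)) + ip z (Q (Q z))"
    by (simp only: ip_add_right[symmetric] assms(4))
  then show "ip (X z) (X z) + ip (z - Q z) (z - Q z) = ip z z"
    by (simp add: ip_diff_left ip_diff_right assms(1,2) algebra_simps)
  show "ip (X z) (z - Q z) = ip (z - Q z) (X z)"
    by (simp add: ip_diff_left ip_diff_right assms)
qed

end

interpretation cstar: hilbert_ip "\<lambda>a b :: 'b::cstar_algebra. star a * b"
  by (rule hilbert_ip_algebra)

lemma norm_normalize: "r > norm x \<Longrightarrow> norm ((1 / r) *\<^sub>R x) < 1"
  for x :: "'a::real_normed_vector"
  using norm_ge_zero[of x] by (auto simp: divide_simps split: if_splits)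

text \<open>For self-adjoint \<open>x\<close> of norm below 1 the element \<open>q\<close> of
  \<open>cstar_sqrt\<close> again lies in the domain, an ideal, and \<open>\<theta>\<close> carries
  the relations between \<open>x\<close> and \<open>q\<close> to their images. So left
  multiplication by \<open>x'\<close> is a contraction. The general case is reduced to
  \<open>star a * a\<close> by the C*-identity.\<close>

lemma PAut_norm_le:
  fixes \<theta> :: "'b::cstar_algebra \<rightharpoonup> 'b"
  assumes "\<theta> \<in> PAut" "\<theta> a = Some a'"
  shows "norm a' \<le> norm a"
proof -
  have sa: "norm x' \<le> 1" if x: "star x = x" "norm x < 1" "\<theta> x = Some x'" for x x'
  proof -
    obtain q where q: "q \<in> dom \<theta>" "star q = q" "q * x = x * q" "q + q = x * x + q * q"
      using cstar_sqrt[OF PAut_ideal(1)[OF assms(1)] _ x(1,2)] x(3) by blast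
    then obtain q' where q': "\<theta> q = Some q'" by blast
    note h = PAut_star[OF assms(1) x(3)] PAut_star[OF assms(1) q']
      PAut_mult[OF assms(1) q' x(3)] PAut_mult[OF assms(1) x(3) q'] PAut_add[OF assms(1) q' q']
      PAut_add[OF assms(1) PAut_mult[OF assms(1) x(3) x(3)] PAut_mult[OF assms(1) q' q']]
    have s: "star x' = x'" "star q' = q'" using h(1,2) q(2) x(1,3) q' by simp_all
    have c: "x' * q' = q' * x'" using h q by auto
    have e: "q' + q' = x' * x' + q' * q'" using h q by auto
    \<comment> \<open>The contraction is applied to the vector \<open>x'\<close> itself, which is
      self-adjoint, so the left side is the square of \<open>norm x'\<close>.\<close>
    have "norm (x' * x') \<le> norm x'"
    proof (rule cstar.norm_le_of_selfadjoint[where X = "(*) x'" and Q = "(*) q'"])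
      show "q' * x' + q' * x' = x' * (x' * x') + q' * (q' * x')"
        by (simp only: mult.assoc[symmetric] distrib_right[symmetric] e)
      show "x' * (q' * x') = q' * (x' * x')" by (simp only: mult.assoc[symmetric] c)
    qed (simp_all add: star_mult s mult.assoc)
    then have "(norm x')\<^sup>2 \<le> norm x'" using cstar_identity[of x'] s by simp
    then show ?thesis
      by (cases "norm x' = 0") (simp_all add: power2_eq_square)
  qed
  let ?h = "star a * a" and ?h' = "star a' * a'"
  have h: "\<theta> ?h = Some ?h'" by (intro PAut_mult PAut_star assms)
  have "norm ?h' \<le> r" if r: "r > norm ?h" for r
  proof -
    have r0: "r > 0" using r norm_ge_zero[of ?h] by linarith
    have "norm ((1/r) *\<^sub>R ?h') \<le> 1"
    proof (rule sa)
      show "\<theta> ((1/r) *\<^sub>R ?h) = Some ((1/r) *\<^sub>R ?h')"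
        unfolding scaleR_scaleC by (rule PAut_scaleC[OF assms(1) h])
      show "norm ((1/r) *\<^sub>R ?h) < 1" by (rule norm_normalize[OF r])
    qed (simp add: star_scaleR star_mult star_star)
    then show ?thesis using r0 by (simp add: divide_simps)
  qed
  then have "norm ?h' \<le> norm ?h" by (rule dense_ge)
  then have "(norm a')\<^sup>2 \<le> (norm a)\<^sup>2" by (simp add: cstar_identity)
  then show ?thesis by (rule power2_le_imp_le) simp
qed

lemma PAut_norm:
  "\<theta> \<in> PAut \<Longrightarrow> \<theta> a = Some a' \<Longrightarrow> norm a' = norm a"
  using PAut_norm_le[of \<theta> a a'] PAut_norm_le[OF pinv_PAut, of \<theta> a' a]
  by (simp add: pinv_eq_Some_iff)

text \<open>The domain is closed and \<open>\<theta>\<close> is isometric, hence the graph is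
  closed. All passages of homogeneity relations to closed spans rest on this.\<close>

lemma PAut_limit:
  assumes "\<theta> \<in> PAut" "\<And>n::nat. \<theta> (a n) = Some (a' n)" "a \<longlonglongrightarrow> x" "a' \<longlonglongrightarrow> y"
  shows "\<theta> x = Some y"
proof -
  have "x \<in> dom \<theta>"
    using closed_sequentially[OF closed_idealD(2)[OF PAut_ideal(1)[OF assms(1)]] _ assms(3)] assms(2)
    by auto
  then obtain z where z: "\<theta> x = Some z" by auto
  have n: "norm (a' n - z) = norm (a n - x)" for n
    by (rule PAut_norm[OF assms(1) PAut_diff[OF assms(1,2) z]])
  have "a' \<longlonglongrightarrow> z"
    by (rule LIM_zero_cancel, rule tendsto_norm_zero_cancel)
       (simp only: n, intro tendsto_norm_zero LIM_zero assms(3))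
  then show ?thesis using z LIMSEQ_unique[OF assms(4)] by simp
qed

section \<open>Approximate units\<close>

text \<open>Writing \<open>g\<close> as a sine, this is the formula sin 3s = 3 sin s - 4 sin^3 s,
  and the left side is (exp(3is) - exp(-3is)) / 2i, half a difference of two unitaries up to a
  unimodular factor.\<close>

lemma chebyshev_norm_le:
  fixes g :: "'b::cstar_algebra"
  assumes "star g = g" "norm g \<le> 1"
  shows "norm (3 *\<^sub>R g - 4 *\<^sub>R (g * g * g)) \<le> 1"
proof -
  have strict: "norm (3 *\<^sub>R g - 4 *\<^sub>R (g * g * g)) \<le> 1" if g: "star g = g" "norm g < 1" for g :: 'b
  proof -
    obtain q where q: "star q = q" "q * g = g * q" "q + q = g * g + q * q"
      using cstar_sqrt[OF closed_ideal_UNIV _ g] by auto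
    \<comment> \<open>\<open>S\<close> is multiplication by the cosine \<open>1 - q\<close>, and
      \<open>U\<close> and \<open>W\<close> are multiplication by the unitary exp(is) and its
      inverse. They act as maps because the algebra may lack a unit; that they are isometric is the
      relation \<open>sq\<close>.\<close>
    define S where "S x = x - q * x" for x
    define U where "U x = S x + \<i> *\<^sub>C (g * x)" for x
    define W where "W x = S x - \<i> *\<^sub>C (g * x)" for x
    have SS: "S (S x) = x - g * (g * x)" for x
    proof -
      have "q * x + q * x = g * g * x + q * q * x" by (metis distrib_right q(3))
      then show ?thesis by (simp add: S_def algebra_simps)
    qed
    have SG: "S (g * x) = g * S x" for x
      unfolding S_def by (simp add: right_diff_distrib mult.assoc[symmetric] q(2))
    have Slin: "S (x + y) = S x + S y" "S (x - y) = S x - S y" "S (c *\<^sub>C x) = c *\<^sub>C S x" for x y c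
      by (simp_all add: S_def algebra_simps mult_scaleC_right cplx.scale_right_diff_distrib)
    have ipS: "star (S x) * y = star x * S y" for x y
      by (simp add: S_def star_diff star_mult q(1) algebra_simps)
    have ipG: "star (g * x) * y = star x * (g * y)" for x y
      by (simp add: star_mult g(1) mult.assoc)
    have sq: "star (S x) * S x + star (g * x) * (g * x) = star x * x" for x
      unfolding ipS ipG SS by (simp add: algebra_simps)
    have comm: "star (S x) * (g * x) = star (g * x) * S x" for x
      unfolding ipS ipG SG ..
    have "star (U x) * U x = star x * x" for x
      unfolding U_def star_add star_scaleC distrib_left distrib_right
        mult_scaleC_left mult_scaleC_right comm
        using sq[of x] by (simp add: cplx.scale_right_diff_distrib scaleC_add_right)
    then have U: "norm (U x) = norm x" for x
      using cstar_identity[of x] cstar_identity[of "U x"] by simp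
    have "star (W x) * W x = star x * x" for x
      unfolding W_def star_diff star_scaleC left_diff_distrib right_diff_distrib
        mult_scaleC_left mult_scaleC_right comm
        using sq[of x] by (simp add: cplx.scale_right_diff_distrib scaleC_add_right)
    then have W: "norm (W x) = norm x" for x
      using cstar_identity[of x] cstar_identity[of "W x"] by simp
    let ?t = "3 *\<^sub>R g - 4 *\<^sub>R (g * g * g)"
    have UU: "U (U x) = (x - 2 *\<^sub>R (g * (g * x))) + (2 * \<i>) *\<^sub>C S (g * x)" for x
      unfolding U_def Slin distrib_left mult_scaleC_right SS SG
      by (simp add: scaleR_2 scaleC_add_right algebra_simps)
         (simp add: scaleC_add_left[symmetric])
    have WW: "W (W x) = (x - 2 *\<^sub>R (g * (g * x))) - (2 * \<i>) *\<^sub>C S (g * x)" for x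
      unfolding W_def Slin right_diff_distrib mult_scaleC_right SS SG
      by (simp add: scaleR_2 cplx.scale_right_diff_distrib algebra_simps)
         (simp add: scaleC_add_left[symmetric])
    \<comment> \<open>\<open>D\<close> is the cosine of the double angle. With it the next identity
      is the addition formula for the sine of 2s + s.\<close>
    define D where "D x = x - 2 *\<^sub>R (g * (g * x))" for x
    have "U (U (U x)) - W (W (W x)) = (2 * \<i>) *\<^sub>C (g * D x + 2 *\<^sub>R S (S (g * x)))" for x
      unfolding UU[of x] WW[of x] D_def[symmetric]
      unfolding U_def W_def Slin distrib_left right_diff_distrib mult_scaleC_right
      by (simp add: scaleC_add_right scaleR_2 algebra_simps cplx.scale_right_diff_distrib)
         (simp add: scaleC_add_left[symmetric] scaleC_add_right[symmetric] add.assoc[symmetric])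
    also have "g * D x + 2 *\<^sub>R S (S (g * x)) = ?t * x" for x
    proof -
      have r: "3 *\<^sub>R y = y + 2 *\<^sub>R y" "4 *\<^sub>R y = 2 *\<^sub>R y + 2 *\<^sub>R y" for y :: 'b
        using scaleR_add_left[of 1 2 y] scaleR_add_left[of 2 2 y] by simp_all
      show ?thesis by (simp add: D_def SS algebra_simps r)
    qed
    finally have "(2 * \<i>) *\<^sub>C (?t * x) = U (U (U x)) - W (W (W x))" for x ..
    then have "norm ((2 * \<i>) *\<^sub>C (?t * x)) \<le> 2 * norm x" for x
      using norm_triangle_ineq4[of "U (U (U x))" "W (W (W x))"] by (simp add: U W)
    \<comment> \<open>The estimate is taken at \<open>x = ?t\<close>; as \<open>?t\<close> is
      self-adjoint, it bounds the square of the norm of \<open>?t\<close> by that norm.\<close>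
    then have "norm (?t * ?t) \<le> norm ?t" by (simp add: norm_scaleC norm_mult)
    moreover have "star ?t = ?t"
      by (simp add: star_diff star_scaleR star_mult g(1) mult.assoc)
    ultimately have "(norm ?t)\<^sup>2 \<le> norm ?t" using cstar_identity[of ?t] by simp
    then show ?thesis
      by (cases "norm ?t = 0") (simp_all add: power2_eq_square)
  qed
  \<comment> \<open>Norm exactly 1 is out of reach of \<open>cstar_sqrt\<close> and is attained by
    letting \<open>r\<close> tend to 1 from below.\<close>
  define f where "f r = norm (3 *\<^sub>R (r *\<^sub>R g) - 4 *\<^sub>R ((r *\<^sub>R g) * (r *\<^sub>R g) * (r *\<^sub>R g)))" for r :: real
  have "(f \<longlongrightarrow> f 1) (at_left 1)"
    unfolding f_def by (intro tendsto_intros)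
  moreover have "\<forall>\<^sub>F r in at_left 1. f r \<le> 1"
  proof -
    have "\<forall>\<^sub>F r in at_left (1::real). r \<in> {0<..<1}" by (rule eventually_at_leftI[of 0]) auto
    then show ?thesis
    proof eventually_elim
      case (elim r)
      then have "r * norm g \<le> r" using assms(2) elim by (simp add: mult_left_le)
      moreover have "norm (r *\<^sub>R g) = r * norm g" "r < 1" using elim by simp_all
      ultimately have "norm (r *\<^sub>R g) < 1" by linarith
      then show ?case unfolding f_def by (intro strict) (simp_all add: star_scaleR assms)
    qed
  qed
  ultimately have "f 1 \<le> 1" by (rule tendsto_upperbound) simp
  then show ?thesis by (simp add: f_def)
qed

text \<open>Iterating the Chebyshev polynomial \<open>3 k - 4 k\<^sup>3\<close>, whose coefficient \<open>3\<close> exceeds its norm, yields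
  \<open>h (1 - p\<^sub>n) = 3\<^bsup>-n\<^esup> k\<^sub>n\<close> with \<open>k\<^sub>n\<close> of norm at most \<open>1\<close>, while \<open>1 - p\<^sub>n\<close> grows like \<open>(7/3)\<^bsup>n\<^esup>\<close> at most.\<close>

lemma approximate_unit:
  fixes h :: "'b::cstar_algebra"
  assumes I: "closed_ideal I" and h: "h \<in> I" "star h = h"
  shows "\<exists>p::nat \<Rightarrow> 'b. (\<forall>n. p n \<in> I) \<and> (\<lambda>n. norm (h - h * p n) * (1 + norm (p n))) \<longlonglongrightarrow> 0"
proof -
  note I' = closed_idealD[OF I]
  have one: "\<exists>p::nat \<Rightarrow> 'b. (\<forall>n. p n \<in> I) \<and> (\<lambda>n. norm (h - h * p n) * (1 + norm (p n))) \<longlonglongrightarrow> 0"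
    if h: "h \<in> I" "star h = h" "norm h \<le> 1" for h
  proof -
    define k where "k = rec_nat h (\<lambda>_ k. 3 *\<^sub>R k - 4 *\<^sub>R (k * k * k))"
    have k: "k 0 = h" "k (Suc n) = 3 *\<^sub>R k n - 4 *\<^sub>R (k n * k n * k n)" for n
      by (simp_all add: k_def)
    \<comment> \<open>Chosen so that formally \<open>1 - p (Suc n)\<close> is
      \<open>(1 - p n) * (1 - (4/3) *\<^sub>R (k n * k n))\<close>, while \<open>k n\<close> times
      the last factor is one third of \<open>k (Suc n)\<close>. Multiplied out, no unit is
      mentioned.\<close>
    define p where "p = rec_nat 0 (\<lambda>n p. p + (4/3) *\<^sub>R (k n * k n) - (4/3) *\<^sub>R (p * (k n * k n)))"
    have p: "p 0 = 0" "p (Suc n) = p n + (4/3) *\<^sub>R (k n * k n) - (4/3) *\<^sub>R (p n * (k n * k n))" for n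
      by (simp_all add: p_def)
    have kk: "star (k n) = k n \<and> norm (k n) \<le> 1 \<and> k n \<in> I" for n
    proof (induction n)
      case (Suc n)
      then have "star (k (Suc n)) = k (Suc n)"
        by (simp add: k star_diff star_scaleR star_mult mult.assoc)
      moreover have "norm (k (Suc n)) \<le> 1"
        unfolding k using Suc by (intro chebyshev_norm_le) auto
      moreover have "k (Suc n) \<in> I"
        unfolding k scaleR_scaleC using Suc I'
        by (intro cplx.subspace_diff cplx.subspace_scale) auto
      ultimately show ?case by blast
    qed (use h k in auto)
    have "p n \<in> I \<and> h * p n = h - (1/3)^n *\<^sub>R k n \<and> 1 + norm (p n) \<le> (7/3)^n" for n
    proof (induction n)
      case 0
      then show ?case using I'(1) by (simp add: p k cplx.subspace_0)
    next
      case (Suc n)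
      have "p (Suc n) \<in> I"
        unfolding p scaleR_scaleC using Suc I' kk[of n]
        by (intro cplx.subspace_diff cplx.subspace_add cplx.subspace_scale) auto
      moreover have "h * p (Suc n) = h - (1/3)^Suc n *\<^sub>R k (Suc n)"
      proof -
        have hp: "h * p n = h - (1/3)^n *\<^sub>R k n" using Suc by blast
        have "h * p (Suc n) = h * p n + (4/3) *\<^sub>R (h * (k n * k n)) - (4/3) *\<^sub>R (h * p n * (k n * k n))"
          by (simp add: p algebra_simps)
        also have "\<dots> = h - (1/3)^n *\<^sub>R k n + (4/3 * (1/3)^n) *\<^sub>R (k n * (k n * k n))"
          unfolding hp by (simp add: algebra_simps)
        also have "\<dots> = h - (1/3)^Suc n *\<^sub>R k (Suc n)"
          by (simp add: k algebra_simps)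
        finally show ?thesis .
      qed
      moreover have "1 + norm (p (Suc n)) \<le> (7/3)^Suc n"
      proof -
        have w: "norm ((4/3) *\<^sub>R (k n * k n)) \<le> 4/3"
          using norm_mult_ineq[of "k n" "k n"] kk[of n] mult_mono[of "norm (k n)" 1 "norm (k n)" 1]
          by simp
        have "norm ((4/3) *\<^sub>R (p n * (k n * k n))) = norm (p n * ((4/3) *\<^sub>R (k n * k n)))" by simp
        also have "\<dots> \<le> norm (p n) * norm ((4/3) *\<^sub>R (k n * k n))" by (rule norm_mult_ineq)
        also have "\<dots> \<le> norm (p n) * (4/3)" using w by (intro mult_left_mono) auto
        finally have "norm (p (Suc n)) \<le> norm (p n) + 4/3 + norm (p n) * (4/3)"
          unfolding p using w
          by (intro order_trans[OF norm_triangle_ineq4] add_mono order_trans[OF norm_triangle_ineq]) auto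
        then have "1 + norm (p (Suc n)) \<le> (7/3) * (1 + norm (p n))" by simp
        also have "\<dots> \<le> (7/3) * (7/3)^n" using Suc by (intro mult_left_mono) auto
        finally show ?thesis by simp
      qed
      ultimately show ?case by blast
    qed
    note pp = this
    \<comment> \<open>The decay \<open>1/3\<close> beats the growth \<open>7/3 = 1 + 4/3\<close>,
      with \<open>7/9\<close> as product. The weight \<open>1 + norm (p n)\<close> is needed because
      \<open>p\<close> is not shown to be bounded; it absorbs the factor \<open>p n\<close> that
      appears when a module element is approximated.\<close>
    have le: "norm (h - h * p n) * (1 + norm (p n)) \<le> (7/9)^n" for n
    proof -
      have "h - h * p n = (1/3)^n *\<^sub>R k n" using pp[of n] by simp
      then have "norm (h - h * p n) \<le> (1/3)^n" using kk[of n] by (simp add: mult_left_le)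
      then have "norm (h - h * p n) * (1 + norm (p n)) \<le> (1/3)^n * (7/3)^n"
        using pp[of n] by (intro mult_mono) auto
      then show ?thesis by (simp add: power_mult_distrib[symmetric])
    qed
    have "(\<lambda>n. (7/9 :: real)^n) \<longlonglongrightarrow> 0" by (rule LIMSEQ_power_zero) simp
    then have "(\<lambda>n. norm (h - h * p n) * (1 + norm (p n))) \<longlonglongrightarrow> 0"
      by (rule Lim_null_comparison[rotated]) (intro always_eventually allI, simp add: le abs_mult)
    then show ?thesis using pp by (intro exI[of _ p] conjI allI) auto
  qed
  \<comment> \<open>Division by \<open>norm h + 1\<close> brings \<open>h\<close> into the unit
    ball. The same \<open>p\<close> serves for \<open>h\<close>, since the error is homogeneous in
    \<open>h\<close>.\<close>
  define c where "c = norm h + 1"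
  have c: "c > 0" by (simp add: c_def add_nonneg_pos)
  have "norm ((1/c) *\<^sub>R h) \<le> 1" using norm_normalize[of h c] by (simp add: c_def)
  then obtain p where p: "\<And>n. p n \<in> I"
      "(\<lambda>n. norm ((1/c) *\<^sub>R h - (1/c) *\<^sub>R h * p n) * (1 + norm (p n))) \<longlonglongrightarrow> 0"
    using one[of "(1/c) *\<^sub>R h"] h cplx.subspace_scale[OF I'(1) h(1), of "complex_of_real (1/c)"]
    unfolding scaleR_scaleC[symmetric] by (auto simp: star_scaleR)
  have "(1/c) *\<^sub>R h - (1/c) *\<^sub>R h * p n = (1/c) *\<^sub>R (h - h * p n)" for n
    by (simp add: scaleR_diff_right)
  then have "c * (norm ((1/c) *\<^sub>R h - (1/c) *\<^sub>R h * p n) * (1 + norm (p n)))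
      = norm (h - h * p n) * (1 + norm (p n))" for n
    using c by simp
  then have "(\<lambda>n. norm (h - h * p n) * (1 + norm (p n))) \<longlonglongrightarrow> 0"
    using tendsto_mult_right_zero[OF p(2), of c] by (simp only:)
  then show ?thesis using p(1) by (intro exI[of _ p] conjI allI)
qed

section \<open>Adjoints of operators on Hilbert spaces\<close>

lemma parallelogram:
  "(norm (x + y))\<^sup>2 + (norm (x - y))\<^sup>2 = 2 * (norm x)\<^sup>2 + 2 * (norm (y :: 'a::chilbert_space))\<^sup>2"
proof -
  have "complex_of_real ((norm (x + y))\<^sup>2 + (norm (x - y))\<^sup>2)
      = cinner (x + y) (x + y) + cinner (x - y) (x - y)"
    by (simp add: cinner_self)
  also have "\<dots> = 2 * cinner x x + 2 * cinner y y"
    by (simp add: cinner.ip_add_left cinner.ip_add_right cinner.ip_diff_left cinner.ip_diff_right)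
  also have "\<dots> = complex_of_real (2 * (norm x)\<^sup>2 + 2 * (norm y)\<^sup>2)"
    by (simp add: cinner_self)
  finally show ?thesis by (simp only: of_real_eq_iff)
qed

text \<open>Midpoints stay in \<open>S\<close> and so have norm at least the infimum
  \<open>d\<close>; by the parallelogram law a minimizing sequence is then Cauchy.\<close>

lemma minimal_norm_element:
  fixes S :: "'a::chilbert_space set"
  assumes "closed S" "S \<noteq> {}" "\<And>x y. x \<in> S \<Longrightarrow> y \<in> S \<Longrightarrow> (1/2) *\<^sub>R (x + y) \<in> S"
  shows "\<exists>z\<in>S. \<forall>x\<in>S. norm z \<le> norm x"
proof -
  define d where "d = Inf (norm ` S)"
  have bdd: "bdd_below (norm ` S)" by (rule bdd_belowI[of _ 0]) auto
  have d: "d \<le> norm x" if "x \<in> S" for x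
    unfolding d_def using bdd that by (intro cInf_lower) auto
  have d0: "0 \<le> d" unfolding d_def using assms(2) by (intro cInf_greatest) auto
  have "\<exists>x\<in>S. norm x < d + 1 / real (Suc n)" for n
  proof -
    have "Inf (norm ` S) < d + 1 / real (Suc n)" by (simp add: d_def)
    then show ?thesis using cInf_lessD[of "norm ` S"] assms(2) by blast
  qed
  then obtain x where x: "\<And>n. x n \<in> S" "\<And>n. norm (x n) < d + 1 / real (Suc n)" by metis
  have "(\<lambda>n. 1 / real (Suc n)) \<longlonglongrightarrow> 0"
    using LIMSEQ_inverse_real_of_nat by (simp add: inverse_eq_divide)
  then have up: "(\<lambda>n. d + 1 / real (Suc n)) \<longlonglongrightarrow> d"
    using tendsto_add[OF tendsto_const[of d]] by fastforce
  have nx: "(\<lambda>n. norm (x n)) \<longlonglongrightarrow> d"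
    by (rule tendsto_sandwich[OF _ _ tendsto_const up])
       (intro always_eventually allI d x(1) less_imp_le[OF x(2)])+
  have s: "(\<lambda>n. 2 * ((norm (x n))\<^sup>2 - d\<^sup>2)) \<longlonglongrightarrow> 0"
  proof -
    have "(\<lambda>n. 2 * ((norm (x n))\<^sup>2 - d\<^sup>2)) \<longlonglongrightarrow> 2 * (d\<^sup>2 - d\<^sup>2)"
      by (intro tendsto_intros nx)
    then show ?thesis by simp
  qed
  have le: "(norm (x n - x m))\<^sup>2 \<le> 2 * ((norm (x n))\<^sup>2 - d\<^sup>2) + 2 * ((norm (x m))\<^sup>2 - d\<^sup>2)" for n m
  proof -
    have "d \<le> norm ((1/2) *\<^sub>R (x n + x m))" by (intro d assms(3) x)
    then have "2 * d \<le> norm (x n + x m)" by simp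
    then have "(2 * d)\<^sup>2 \<le> (norm (x n + x m))\<^sup>2" using d0 by (intro power_mono) auto
    then show ?thesis using parallelogram[of "x n" "x m"] by (simp add: power_mult_distrib)
  qed
  have "Cauchy x"
  proof (rule CauchyI)
    fix e :: real assume e: "0 < e"
    then have "\<forall>\<^sub>F n in sequentially. 2 * ((norm (x n))\<^sup>2 - d\<^sup>2) < e\<^sup>2 / 2"
      by (intro order_tendstoD(2)[OF s]) simp
    then obtain M where M: "\<And>n. n \<ge> M \<Longrightarrow> 2 * ((norm (x n))\<^sup>2 - d\<^sup>2) < e\<^sup>2 / 2"
      unfolding eventually_sequentially by blast
    have "norm (x m - x n) < e" if "m \<ge> M" "n \<ge> M" for m n
    proof (rule power2_less_imp_less)
      show "(norm (x m - x n))\<^sup>2 < e\<^sup>2" using le[of m n] M[OF that(1)] M[OF that(2)] by linarith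
    qed (use e in simp)
    then show "\<exists>M. \<forall>m\<ge>M. \<forall>n\<ge>M. norm (x m - x n) < e" by blast
  qed
  then obtain z where z: "x \<longlonglongrightarrow> z" using Cauchy_convergent convergent_def by blast
  have "z \<in> S" using closed_sequentially[OF assms(1) x(1) z] .
  moreover have "norm z = d" using LIMSEQ_unique[OF tendsto_norm[OF z] nx] .
  ultimately show ?thesis using d by metis
qed

text \<open>The element of least norm on the hyperplane where \<open>f\<close> equals 1 is
  orthogonal to the kernel of \<open>f\<close>, and a multiple of it represents
  \<open>f\<close>.\<close>

lemma riesz:
  fixes f :: "'a::chilbert_space \<Rightarrow>\<^sub>L complex"
  assumes f: "\<And>c x. f (c *\<^sub>C x) = c * f x"
  shows "\<exists>y. \<forall>x. f x = cinner y x"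
proof (cases "\<exists>x. f x \<noteq> 0")
  case False
  then show ?thesis by (intro exI[of _ 0]) simp
next
  case True
  then obtain x0 where x0: "f x0 \<noteq> 0" by blast
  let ?S = "{x. f x = 1}"
  have "\<exists>z\<in>?S. \<forall>x\<in>?S. norm z \<le> norm x"
  proof (rule minimal_norm_element)
    show "closed ?S" by (intro closed_Collect_eq continuous_intros)
    have "(1 / f x0) *\<^sub>C x0 \<in> ?S" using x0 f by simp
    then show "?S \<noteq> {}" by blast
    show "(1/2) *\<^sub>R (x + y) \<in> ?S" if "x \<in> ?S" "y \<in> ?S" for x y
      using that by (simp add: blinfun.scaleR_right blinfun.add_right scaleR_conv_of_real)
  qed
  then obtain z where z: "f z = 1" "\<And>x. f x = 1 \<Longrightarrow> norm z \<le> norm x" by auto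
  have z0: "z \<noteq> 0" using z(1) by auto
  have orth: "cinner z v = 0" if v: "f v = 0" for v
  proof (cases "v = 0")
    case False
    define n where "n = complex_of_real ((norm v)\<^sup>2)"
    have n: "n \<noteq> 0" "cnj n = n" "cinner v v = n" using False by (simp_all add: cinner_self n_def)
    \<comment> \<open>The coefficient of the projection of \<open>z\<close> onto \<open>v\<close>.
      Subtracting \<open>c *\<^sub>C v\<close> does not leave the hyperplane and lowers the squared
      norm by \<open>(cmod (cinner v z))\<^sup>2 / (norm v)\<^sup>2\<close>, which minimality forces
      to be 0.\<close>
    define c where "c = cinner v z / n"
    have cc: "cnj (cinner v z) = cinner z v" using cinner_commute by metis
    then have c: "cnj c = cinner z v / n" by (simp add: c_def n)
    have "f (z - c *\<^sub>C v) = 1" using z(1) v f by (simp add: blinfun.diff_right)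
    then have "norm z \<le> norm (z - c *\<^sub>C v)" by (rule z(2))
    then have "(norm z)\<^sup>2 \<le> (norm (z - c *\<^sub>C v))\<^sup>2" by (intro power_mono) auto
    moreover have "cinner (z - c *\<^sub>C v) (z - c *\<^sub>C v) = cinner z z - cinner v z * cnj (cinner v z) / n"
      unfolding cinner.ip_diff_left cinner.ip_diff_right cinner.ip_scale_left cinner.ip_scale_right
        scaleC_complex_def c n cc
      using n(1) by (simp add: c_def field_simps)
    then have "complex_of_real ((norm (z - c *\<^sub>C v))\<^sup>2) =
        complex_of_real ((norm z)\<^sup>2 - (cmod (cinner v z))\<^sup>2 / (norm v)\<^sup>2)"
      unfolding cinner_self complex_norm_square[symmetric] n_def by simp
    then have "(norm (z - c *\<^sub>C v))\<^sup>2 = (norm z)\<^sup>2 - (cmod (cinner v z))\<^sup>2 / (norm v)\<^sup>2"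
      by (simp only: of_real_eq_iff)
    ultimately have "(cmod (cinner v z))\<^sup>2 / (norm v)\<^sup>2 \<le> 0" by linarith
    then have "cinner v z = 0" using False by (simp add: divide_le_0_iff)
    then show ?thesis using cc by simp
  qed simp
  have "f x = cinner ((1 / complex_of_real ((norm z)\<^sup>2)) *\<^sub>C z) x" for x
  proof -
    have "f (x - f x *\<^sub>C z) = 0" using f z(1) by (simp add: blinfun.diff_right)
    from orth[OF this] have "cinner z x = f x * complex_of_real ((norm z)\<^sup>2)"
      by (simp add: cinner.ip_diff_right cinner.ip_scale_right scaleC_complex_def cinner_self)
    then show ?thesis using z0 by (simp add: cinner.ip_scale_left scaleC_complex_def)
  qed
  then show ?thesis by blast
qed

lemma adj_eqI:
  assumes "\<And>x y. cinner (blinfun_apply S y) x = cinner y (blinfun_apply T x)"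
  shows "adj T = S"
  unfolding adj_def
proof (rule the_equality)
  show "\<forall>x y. cinner (S y) x = cinner y (T x)" using assms by blast
  fix R :: "'b \<Rightarrow>\<^sub>L 'a" assume R: "\<forall>x y. cinner (R y) x = cinner y (T x)"
  show "R = S"
  proof (rule blinfun_eqI, rule cinner.ip_eqI)
    fix y z
    show "cinner z (R y) = cinner z (S y)"
      using R assms by (metis cinner_commute)
  qed
qed

text \<open>Riesz representation supplies the values of the adjoint, and the pairing forces
  linearity and boundedness. Complex linearity of \<open>T\<close> is essential, as
  \<open>cinner y (T x)\<close> has to be complex-linear in \<open>x\<close>.\<close>

lemma cinner_adj_left:
  fixes T :: "'a::chilbert_space \<Rightarrow>\<^sub>L 'b::chilbert_space"
  assumes "clinear_op T"
  shows "cinner (adj T y) x = cinner y (T x)"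
proof -
  have "\<exists>s. \<forall>x. cinner s x = cinner y (T x)" for y
  proof -
    have bl: "bounded_linear (\<lambda>x. cinner y (T x))"
      by (rule bounded_linear_compose[OF cinner.bounded_linear_ip_right blinfun.bounded_linear_right])
    have "\<exists>s. \<forall>x. Blinfun (\<lambda>x. cinner y (T x)) x = cinner s x"
      by (rule riesz)
         (simp add: bounded_linear_Blinfun_apply[OF bl] clinear_opD[OF assms] cinner_scaleC_right)
    then show ?thesis by (simp add: bounded_linear_Blinfun_apply[OF bl]) metis
  qed
  then obtain s where s: "\<And>x y. cinner (s y) x = cinner y (T x)" by metis
  have s': "cinner x (s y) = cinner (T x) y" for x y
    using s[of y x] cinner_commute by metis
  have "bounded_linear s"
  proof (rule bounded_linear_intro[where K = "4 * norm T"])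
    show "s (x + y) = s x + s y" for x y
      by (rule cinner.ip_eqI) (simp add: s' cinner.ip_add_right)
    show "s (r *\<^sub>R x) = r *\<^sub>R s x" for r x
      by (rule cinner.ip_eqI) (simp add: s' cinner.ip_scaleR_right)
    show "norm (s x) \<le> norm x * (4 * norm T)" for x
    proof (rule le_of_power2_le_mult)
      have "(norm (s x))\<^sup>2 = norm (cinner x (T (s x)))" using cinner.ip_norm[of "s x"] s by simp
      also have "\<dots> \<le> 4 * norm x * norm (T (s x))" by (rule cinner.ip_bound)
      also have "\<dots> \<le> 4 * norm x * (norm T * norm (s x))"
        by (intro mult_left_mono norm_blinfun) auto
      finally show "(norm (s x))\<^sup>2 \<le> (norm x * (4 * norm T)) * norm (s x)" by (simp add: mult_ac)
    qed simp_all
  qed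
  then have "cinner (Blinfun s y) x = cinner y (T x)" for x y
    by (simp add: bounded_linear_Blinfun_apply s)
  from adj_eqI[of "Blinfun s" T, OF this] this show ?thesis by metis
qed

lemma cinner_adj_right: "clinear_op T \<Longrightarrow> cinner x (adj T y) = cinner (T x) y"
  by (metis cinner_adj_left cinner_commute)

lemma clinear_adj: assumes "clinear_op T" shows "clinear_op (adj T)"
  unfolding clinear_op_def
  by (intro allI cinner.ip_eqI)
     (simp add: cinner_adj_right[OF assms] cinner.ip_scale_right)

lemma adj_adj: "clinear_op T \<Longrightarrow> adj (adj T) = T"
  by (rule adj_eqI) (simp add: cinner_adj_right)

lemma adj_compose: "clinear_op S \<Longrightarrow> clinear_op T \<Longrightarrow> adj (S o\<^sub>L T) = adj T o\<^sub>L adj S"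
  by (rule adj_eqI) (simp add: cinner_adj_left)

lemma adj_add: "clinear_op S \<Longrightarrow> clinear_op T \<Longrightarrow> adj (S + T) = adj S + adj T"
  by (rule adj_eqI) (simp add: cinner_adj_left blinfun.add_left cinner.ip_add_left cinner.ip_add_right)

lemma adj_diff: "clinear_op S \<Longrightarrow> clinear_op T \<Longrightarrow> adj (S - T) = adj S - adj T"
  by (rule adj_eqI) (simp add: cinner_adj_left blinfun.diff_left cinner.ip_diff_left cinner.ip_diff_right)

lemma adj_scaleC: "clinear_op T \<Longrightarrow> adj (c *\<^sub>C T) = cnj c *\<^sub>C adj T"
  by (rule adj_eqI) (simp add: cinner_adj_left blinfun_apply_scaleC cinner.ip_scale_left cinner.ip_scale_right)

lemma adj_zero [simp]: "adj 0 = 0"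
  by (rule adj_eqI) simp

lemma norm_adj_le:
  assumes "clinear_op T" shows "norm (adj T) \<le> 4 * norm T"
proof (rule norm_blinfun_bound)
  fix y
  show "norm (adj T y) \<le> 4 * norm T * norm y"
  proof (rule le_of_power2_le_mult)
    have "(norm (adj T y))\<^sup>2 = norm (cinner y (T (adj T y)))"
      using cinner.ip_norm[of "adj T y"] assms by (simp add: cinner_adj_left)
    also have "\<dots> \<le> 4 * norm y * norm (T (adj T y))" by (rule cinner.ip_bound)
    also have "\<dots> \<le> 4 * norm y * (norm T * norm (adj T y))"
      by (intro mult_left_mono norm_blinfun) auto
    finally show "(norm (adj T y))\<^sup>2 \<le> (4 * norm T * norm y) * norm (adj T y)" by (simp add: mult_ac)
  qed simp_all
qed simp

lemma tendsto_adj: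
  assumes "\<And>n. clinear_op (T n)" "clinear_op S" "T \<longlonglongrightarrow> S"
  shows "(\<lambda>n. adj (T n)) \<longlonglongrightarrow> adj S"
proof (rule LIM_zero_cancel, rule Lim_null_comparison)
  show "\<forall>\<^sub>F n in sequentially. norm (adj (T n) - adj S) \<le> 4 * norm (T n - S)"
    using norm_adj_le[OF clinear_op_diff[OF assms(1,2)]]
    by (simp add: adj_diff assms(1,2))
  show "(\<lambda>n. 4 * norm (T n - S)) \<longlonglongrightarrow> 0"
    by (intro tendsto_mult_right_zero tendsto_norm_zero LIM_zero assms(3))
qed

text \<open>\<open>adj\<close> is conjugate-linear and under control only on complex-linear
  operators. Therefore both properties are carried together: the operators having them form a closed
  complex subspace, since \<open>adj\<close> is continuous on complex-linear operators.\<close>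

lemma adj_closed_span:
  assumes V: "csubspace V" "closed V" and S: "\<And>T. T \<in> S \<Longrightarrow> clinear_op T \<and> adj T \<in> V"
    and T: "T \<in> \<lbrakk>S\<rbrakk>"
  shows "clinear_op T" "adj T \<in> V"
proof -
  have "S \<subseteq> {T. clinear_op T \<and> adj T \<in> V}" using S by blast
  then have "\<lbrakk>S\<rbrakk> \<subseteq> {T. clinear_op T \<and> adj T \<in> V}"
  proof (rule closed_span_minimal)
    show "csubspace {T. clinear_op T \<and> adj T \<in> V}"
      using V(1)
      by (intro csubspaceI) (auto simp: clinear_op_add clinear_op_scaleC adj_add adj_scaleC
          cplx.subspace_0 cplx.subspace_add cplx.subspace_scale)
    show "closed {T. clinear_op T \<and> adj T \<in> V}"
      unfolding closed_sequential_limits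
    proof (intro allI impI, elim conjE)
      fix X l assume X: "\<forall>n. X n \<in> {T. clinear_op T \<and> adj T \<in> V}" "X \<longlonglongrightarrow> l"
      have l: "clinear_op l"
        using closed_sequentially[OF closed_clinear, of X l] X by auto
      then have "(\<lambda>n. adj (X n)) \<longlonglongrightarrow> adj l" using X by (intro tendsto_adj) auto
      then have "adj l \<in> V" using X closed_sequentially[OF V(2), of "\<lambda>n. adj (X n)"] by auto
      then show "l \<in> {T. clinear_op T \<and> adj T \<in> V}" using l by simp
    qed
  qed
  then show "clinear_op T" "adj T \<in> V" using T by auto
qed

section \<open>Bimodules\<close>

context hilbert_ip
begin

text \<open>For self-adjoint \<open>a\<close> of norm below 1 the operators \<open>R a\<close> and
  \<open>R q\<close> satisfy the hypotheses of \<open>norm_le_of_selfadjoint\<close>. In general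
  \<open>R a\<close> is compared with \<open>R (star a * a)\<close>, and the 2 is the square root of
  the 4 in \<open>ip_bound\<close>. The lemma serves both left multiplication and
  \<open>\<pi>\<close>.\<close>

lemma star_rep_norm_le:
  assumes R: "\<And>a b x. R (a + b) x = R a x + R b x" "\<And>c a x. R (c *\<^sub>C a) x = c *\<^sub>C R a x"
    "\<And>a b x. R (a * b) x = R a (R b x)" "\<And>a x y. ip (R (star a) x) y = ip x (R a y)"
  shows "norm (R a x) \<le> 2 * norm (a :: 'c::cstar_algebra) * norm x"
proof -
  have sa1: "norm (R a x) \<le> norm x" if a: "star a = a" "norm a < 1" for a x
  proof -
    obtain q where q: "star q = q" "q * a = a * q" "q + q = a * a + q * q"
      using cstar_sqrt[OF closed_ideal_UNIV _ a] by auto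
    show ?thesis
    proof (rule norm_le_of_selfadjoint[where Q = "R q"])
      show "R a (R q x) = R q (R a x)" by (simp only: R(3)[symmetric] q(2))
      show "R q x + R q x = R a (R a x) + R q (R q x)"
        by (simp only: R(3)[symmetric] R(1)[symmetric] q(3))
      show "ip (R a x) y = ip x (R a y)" "ip (R q x) y = ip x (R q y)" for x y
        using R(4)[of a x y] R(4)[of q x y] a q by simp_all
    qed
  qed
  have sa: "norm (R a x) \<le> norm a * norm x" if a: "star a = a" for a x
  proof -
    have "norm (R a x) \<le> r * norm x" if r: "r > norm a" for r
    proof -
      have r0: "r > 0" using r norm_ge_zero[of a] by linarith
      have "norm (R ((1/r) *\<^sub>R a) x) \<le> norm x"
        by (rule sa1) (simp_all add: star_scaleR a norm_normalize[OF r] del: norm_scaleR)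
      then show ?thesis
        unfolding scaleR_scaleC R(2) norm_scaleC using r0
        by (simp add: norm_divide divide_simps mult.commute)
    qed
    then show ?thesis by (rule le_mult_of_gt)
  qed
  have "(norm (R a x))\<^sup>2 = norm (ip x (R (star a * a) x))"
    by (simp add: ip_norm R(3) flip: R(4)) (simp add: R(4) star_star)
  also have "\<dots> \<le> 4 * norm x * norm (R (star a * a) x)" by (rule ip_bound)
  also have "\<dots> \<le> 4 * norm x * (norm (star a * a) * norm x)"
    by (intro mult_left_mono sa) (simp_all add: star_mult star_star)
  also have "\<dots> = (2 * norm a * norm x)\<^sup>2"
    by (simp add: cstar_identity power2_eq_square)
  finally show ?thesis by (rule power2_le_imp_le) simp
qed

text \<open>With \<open>h = ip \<xi> \<xi>\<close>, the inner square of
  \<open>act \<xi> p - \<xi>\<close> is \<open>(h - h * p) - star p * (h - h * p)\<close>, so an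
  approximate unit for the single element \<open>h\<close> suffices. This takes the place of
  factorization in the module.\<close>

lemma module_approximate_unit:
  assumes ip_act: "\<And>x y b. ip x (act y b) = ip x y * b" and I: "closed_ideal I" and h: "ip \<xi> \<xi> \<in> I"
  shows "\<exists>p::nat \<Rightarrow> 'b. (\<forall>n. p n \<in> I) \<and> (\<lambda>n. act \<xi> (p n)) \<longlonglongrightarrow> \<xi>"
proof -
  let ?h = "ip \<xi> \<xi>"
  have ip_act_left: "ip (act x b) y = star b * ip x y" for x y b
    by (metis ip_act ip_star star_mult)
  obtain p :: "nat \<Rightarrow> 'b" where p: "\<And>n. p n \<in> I" "(\<lambda>n. norm (?h - ?h * p n) * (1 + norm (p n))) \<longlonglongrightarrow> 0"
    using approximate_unit[OF I h ip_star] by blast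
  have "(norm (act \<xi> (p n) - \<xi>))\<^sup>2 \<le> norm (?h - ?h * p n) * (1 + norm (p n))" for n
  proof -
    have "ip (act \<xi> (p n) - \<xi>) (act \<xi> (p n) - \<xi>) = (?h - ?h * p n) - star (p n) * (?h - ?h * p n)"
      by (simp add: ip_diff_left ip_diff_right ip_act ip_act_left algebra_simps)
    then have "(norm (act \<xi> (p n) - \<xi>))\<^sup>2 \<le> norm (?h - ?h * p n) + norm (star (p n) * (?h - ?h * p n))"
      unfolding ip_norm by (simp only: norm_triangle_ineq4)
    also have "\<dots> \<le> norm (?h - ?h * p n) + norm (p n) * norm (?h - ?h * p n)"
      using norm_mult_ineq[of "star (p n)" "?h - ?h * p n"] by simp
    finally show ?thesis by (simp add: algebra_simps)
  qed
  then have "(\<lambda>n. (norm (act \<xi> (p n) - \<xi>))\<^sup>2) \<longlonglongrightarrow> 0"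
    by (intro Lim_null_comparison[OF always_eventually p(2)]) simp
  then have "(\<lambda>n. sqrt ((norm (act \<xi> (p n) - \<xi>))\<^sup>2)) \<longlonglongrightarrow> sqrt 0"
    by (rule tendsto_real_sqrt)
  then have "(\<lambda>n. act \<xi> (p n)) \<longlonglongrightarrow> \<xi>"
    by - (rule LIM_zero_cancel, rule tendsto_norm_zero_cancel, simp)
  then show ?thesis using p(1) by (intro exI[of _ p] conjI allI)
qed

end

text \<open>Covers \<open>self_bimodule\<close> as well as the given bimodules. Further module laws,
  such as additivity in the module variable, are derived by testing against the inner
  product.\<close>

locale bimod = hilbert_ip "ip E" for E :: "('b::cstar_algebra, 'e::complex_banach) bimodule" +
  assumes ip_ract: "ip E \<xi> (ract E \<eta> b) = ip E \<xi> \<eta> * b"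
    and lact_star: "ip E (lact E (star b) \<xi>) \<eta> = ip E \<xi> (lact E b \<eta>)"
    and lact_add_left: "lact E (a + b) \<xi> = lact E a \<xi> + lact E b \<xi>"
    and lact_scale_left: "lact E (c *\<^sub>C b) \<xi> = c *\<^sub>C lact E b \<xi>"
    and lact_mult: "lact E (a * b) \<xi> = lact E a (lact E b \<xi>)"
    and lact_nondegenerate: "\<lbrakk>{lact E b \<xi> | b \<xi>. True}\<rbrakk> = UNIV"
begin

lemma ip_ract_left: "ip E (ract E \<xi> b) \<eta> = star b * ip E \<xi> \<eta>"
  by (metis ip_ract ip_star star_mult)

lemma ip_lact: "ip E \<xi> (lact E b \<eta>) = ip E (lact E (star b) \<xi>) \<eta>"
  by (simp add: lact_star)

lemma ip_lact_left: "ip E (lact E b \<xi>) \<eta> = ip E \<xi> (lact E (star b) \<eta>)"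
  using lact_star[of "star b"] by (simp add: star_star)

lemma lact_add_right: "lact E b (\<xi> + \<eta>) = lact E b \<xi> + lact E b \<eta>"
  by (rule ip_eqI) (simp add: ip_lact ip_add_right)

lemma lact_scale_right: "lact E b (c *\<^sub>C \<xi>) = c *\<^sub>C lact E b \<xi>"
  by (rule ip_eqI) (simp add: ip_lact ip_scale_right)

lemma ract_add_left: "ract E (\<xi> + \<eta>) b = ract E \<xi> b + ract E \<eta> b"
  by (rule ip_eqI) (simp add: ip_ract ip_add_right algebra_simps)

lemma ract_add_right: "ract E \<xi> (a + b) = ract E \<xi> a + ract E \<xi> b"
  by (rule ip_eqI) (simp add: ip_ract ip_add_right algebra_simps)

lemma ract_scale_left: "ract E (c *\<^sub>C \<xi>) b = c *\<^sub>C ract E \<xi> b"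
  by (rule ip_eqI) (simp add: ip_ract ip_scale_right mult_scaleC_left)

lemma ract_scale_right: "ract E \<xi> (c *\<^sub>C b) = c *\<^sub>C ract E \<xi> b"
  by (rule ip_eqI) (simp add: ip_ract ip_scale_right mult_scaleC_right)

lemma lact_ract: "lact E a (ract E \<xi> b) = ract E (lact E a \<xi>) b"
  by (rule ip_eqI) (simp add: ip_ract ip_lact)

lemma lact_norm: "norm (lact E b \<xi>) \<le> 2 * norm b * norm \<xi>"
  by (rule star_rep_norm_le) (simp_all add: lact_add_left lact_scale_left lact_mult lact_star)

lemma ract_norm: "norm (ract E \<xi> b) \<le> norm \<xi> * norm b"
proof -
  have "(norm (ract E \<xi> b))\<^sup>2 = norm (star b * ip E \<xi> \<xi> * b)"
    by (simp add: ip_norm ip_ract ip_ract_left)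
  also have "\<dots> \<le> norm b * norm (ip E \<xi> \<xi>) * norm b"
    using norm_mult_ineq[of "star b" "ip E \<xi> \<xi>"]
    by (intro order_trans[OF norm_mult_ineq] mult_right_mono) simp_all
  also have "\<dots> = (norm \<xi> * norm b)\<^sup>2"
    by (simp add: ip_norm[symmetric] power2_eq_square mult_ac)
  finally show ?thesis by (rule power2_le_imp_le) simp
qed

lemma bounded_bilinear_lact: "bounded_bilinear (lact E)"
proof
  show "\<exists>K. \<forall>a b. norm (lact E a b) \<le> norm a * norm b * K"
    using lact_norm by (intro exI[of _ 2]) (simp add: mult_ac)
qed (simp_all add: lact_add_left lact_add_right scaleR_scaleC lact_scale_left lact_scale_right)

lemma bounded_bilinear_ract: "bounded_bilinear (ract E)"
proof
  show "\<exists>K. \<forall>a b. norm (ract E a b) \<le> norm a * norm b * K"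
    using ract_norm by (intro exI[of _ 1]) simp
qed (simp_all add: ract_add_left ract_add_right scaleR_scaleC ract_scale_left ract_scale_right)

lemma l_op_apply: "l_op E \<xi> b = ract E \<xi> b"
  unfolding l_op_def
  by (rule bounded_linear_Blinfun_apply[OF bounded_bilinear.bounded_linear_right[OF bounded_bilinear_ract], THEN fun_cong])

lemma r_op_apply: "r_op E \<xi> b = lact E b \<xi>"
  unfolding r_op_def
  by (rule bounded_linear_Blinfun_apply[OF bounded_bilinear.bounded_linear_left[OF bounded_bilinear_lact], THEN fun_cong])

lemma l_mult_apply: "l_mult E b \<xi> = lact E b \<xi>"
  unfolding l_mult_def
  by (rule bounded_linear_Blinfun_apply[OF bounded_bilinear.bounded_linear_right[OF bounded_bilinear_lact], THEN fun_cong])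

lemma ract_approximate_unit:
  assumes "closed_ideal I" "ip E \<xi> \<xi> \<in> I"
  shows "\<exists>p::nat \<Rightarrow> 'b. (\<forall>n. p n \<in> I) \<and> (\<lambda>n. ract E \<xi> (p n)) \<longlonglongrightarrow> \<xi>"
  by (rule module_approximate_unit[OF ip_ract assms])

lemma ip_in_ideal:
  assumes I: "closed_ideal I" and \<xi>: "\<xi> \<in> \<lbrakk>{ract E \<eta> b | \<eta> b. b \<in> I}\<rbrakk>"
  shows "ip E \<zeta> \<xi> \<in> I"
proof (rule closed_span_vimage[OF bounded_linear_ip_right _ _ _ _ \<xi>])
  show "ip E \<zeta> s \<in> I" if "s \<in> {ract E \<eta> b |\<eta> b. b \<in> I}" for s
    using that closed_idealD[OF I] by (auto simp: ip_ract)
qed (use closed_idealD[OF I] in \<open>auto simp: ip_scale_right\<close>)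

lemma ract_span_UNIV: "\<lbrakk>{ract E \<eta> b | \<eta> b. True}\<rbrakk> = UNIV"
proof -
  have "\<xi> \<in> \<lbrakk>{ract E \<eta> b | \<eta> b. True}\<rbrakk>" for \<xi>
  proof -
    obtain p :: "nat \<Rightarrow> 'b" where "(\<lambda>n. ract E \<xi> (p n)) \<longlonglongrightarrow> \<xi>"
      using ract_approximate_unit[OF closed_ideal_UNIV, of \<xi>] by auto
    then show ?thesis
      by (rule closed_sequentially[OF closed_closed_span, rotated]) (auto intro: closed_span_base)
  qed
  then show ?thesis by auto
qed

end

lemma bimod_self: "bimod (self_bimodule :: ('b::cstar_algebra, 'b) bimodule)"
proof -
  let ?B = "self_bimodule :: ('b, 'b) bimodule"
  have ip: "hilbert_ip (ip ?B)" using hilbert_ip_algebra by (simp add: self_bimodule_def)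
  have "x \<in> \<lbrakk>{lact ?B b \<xi> | b \<xi>. True}\<rbrakk>" for x
  proof -
    obtain p :: "nat \<Rightarrow> 'b" where "(\<lambda>n. x * p n) \<longlonglongrightarrow> x"
      using cstar.module_approximate_unit[of "(*)" UNIV x] by (auto simp: mult.assoc closed_ideal_UNIV)
    then show ?thesis
      by (rule closed_sequentially[OF closed_closed_span, rotated])
         (auto intro!: closed_span_base simp: self_bimodule_def)
  qed
  then have "\<lbrakk>{lact ?B b \<xi> | b \<xi>. True}\<rbrakk> = UNIV" by auto
  then show ?thesis
    using ip by (simp add: bimod_def bimod_axioms_def self_bimodule_def mult.assoc star_mult star_star
        algebra_simps mult_scaleC_left)
qed

lemma bimod_cstar_bimodule: assumes "cstar_bimodule E" shows "bimod E"
proof -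
  have "hilbert_ip (ip E)"
    using assms unfolding cstar_bimodule_def by (unfold_locales; elim conjE; simp)
  then show ?thesis
    unfolding bimod_def bimod_axioms_def
    using assms unfolding cstar_bimodule_def by (elim conjE; intro conjI; simp)
qed

section \<open>Homogeneous operators\<close>

text \<open>The graph of \<open>\<sigma>\<close> is a closed complex subspace, and so is its
  preimage under the pair of \<open>f\<close> and \<open>g\<close>. Identities that hold up to a
  partial automorphism are extended from elementary tensors in this way.\<close>

lemma PAut_closed_span:
  fixes f g :: "'u::complex_banach \<Rightarrow> 'b::cstar_algebra"
  assumes \<sigma>: "\<sigma> \<in> PAut"
    and f: "bounded_linear f" "\<And>c x. f (c *\<^sub>C x) = c *\<^sub>C f x"
    and g: "bounded_linear g" "\<And>c x. g (c *\<^sub>C x) = c *\<^sub>C g x"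
    and S: "\<And>s. s \<in> S \<Longrightarrow> \<sigma> (f s) = Some (g s)" and x: "x \<in> \<lbrakk>S\<rbrakk>"
  shows "\<sigma> (f x) = Some (g x)"
proof -
  let ?V = "{x. \<sigma> (f x) = Some (g x)}"
  have "\<lbrakk>S\<rbrakk> \<subseteq> ?V"
  proof (rule closed_span_minimal)
    show "S \<subseteq> ?V" using S by blast
    show "csubspace ?V"
      by (intro csubspaceI)
         (simp_all add: linear_simps[OF f(1)] linear_simps[OF g(1)] f(2) g(2)
           PAut_zero[OF \<sigma>] PAut_add[OF \<sigma>] PAut_scaleC[OF \<sigma>])
    show "closed ?V"
      unfolding closed_sequential_limits
    proof (intro allI impI, elim conjE)
      fix X l assume X: "\<forall>n. X n \<in> ?V" "X \<longlonglongrightarrow> l"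
      have "\<sigma> (f l) = Some (g l)"
        by (rule PAut_limit[OF \<sigma>, where a = "\<lambda>n. f (X n)" and a' = "\<lambda>n. g (X n)"])
           (use X in \<open>auto intro: bounded_linear.tendsto[OF f(1)] bounded_linear.tendsto[OF g(1)]\<close>)
      then show "l \<in> ?V" by simp
    qed
  qed
  then show ?thesis using x by blast
qed

lemma hom_adjointD: "hom_adjoint \<sigma> E F T S \<Longrightarrow> \<sigma> (ip E (S \<eta>) \<xi>) = Some (ip F \<eta> (T \<xi>))"
  by (simp add: hom_adjoint_def)

lemma hom_adjoint_mono: "hom_adjoint \<sigma> E F T S \<Longrightarrow> \<sigma> \<subseteq>\<^sub>m \<sigma>' \<Longrightarrow> hom_adjoint \<sigma>' E F T S"
  by (simp add: hom_adjoint_def map_le_iff)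

lemma hom_adjoint_compose:
  "hom_adjoint \<sigma> E F T S \<Longrightarrow> hom_adjoint \<sigma>' F G T' S' \<Longrightarrow>
    hom_adjoint (\<sigma>' \<circ>\<^sub>m \<sigma>) E G (\<lambda>x. T' (T x)) (\<lambda>x. S (S' x))"
  by (simp add: hom_adjoint_def map_comp_Some_iff)

locale bimod_pair = E: bimod E + F: bimod F
  for E :: "('b::cstar_algebra, 'e::complex_banach) bimodule"
    and F :: "('b, 'f::complex_banach) bimodule"
begin

lemma hom_adjoint_sym:
  assumes "\<sigma> \<in> PAut" "hom_adjoint \<sigma> E F T S"
  shows "hom_adjoint (pinv \<sigma>) F E S T"
  unfolding hom_adjoint_def pinv_eq_Some_iff[OF assms(1)]
  using PAut_star[OF assms(1) hom_adjointD[OF assms(2)]] by (simp add: E.ip_star F.ip_star)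

lemma hom_adjointD':
  assumes "\<sigma> \<in> PAut" "hom_adjoint \<sigma> E F T S"
  shows "\<sigma> (ip E \<xi> (S \<eta>)) = Some (ip F (T \<xi>) \<eta>)"
  using PAut_star[OF assms(1) hom_adjointD[OF assms(2)], of \<eta> \<xi>] by (simp add: E.ip_star F.ip_star)

text \<open>\<open>S\<close> is an arbitrary function; injectivity of \<open>\<sigma>\<close> pulls
  additivity of the inner product of \<open>F\<close> back to \<open>E\<close>.\<close>

lemma hom_adjoint_add:
  assumes \<sigma>: "\<sigma> \<in> PAut" and h: "hom_adjoint \<sigma> E F T S"
  shows "S (x + y) = S x + S y"
proof (rule E.ip_eqI)
  fix z
  have "\<sigma> (ip E z (S x + S y)) = Some (ip F (T z) (x + y))"
    unfolding E.ip_add_right F.ip_add_right by (intro PAut_add \<sigma> hom_adjointD'[OF \<sigma> h])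
  then show "ip E z (S (x + y)) = ip E z (S x + S y)"
    by (rule PAut_inj[OF \<sigma> hom_adjointD'[OF \<sigma> h]])
qed

lemma hom_adjoint_scaleC:
  assumes \<sigma>: "\<sigma> \<in> PAut" and h: "hom_adjoint \<sigma> E F T S"
  shows "S (c *\<^sub>C x) = c *\<^sub>C S x"
proof (rule E.ip_eqI)
  fix z
  have "\<sigma> (ip E z (c *\<^sub>C S x)) = Some (ip F (T z) (c *\<^sub>C x))"
    unfolding E.ip_scale_right F.ip_scale_right by (intro PAut_scaleC \<sigma> hom_adjointD'[OF \<sigma> h])
  then show "ip E z (S (c *\<^sub>C x)) = ip E z (c *\<^sub>C S x)"
    by (rule PAut_inj[OF \<sigma> hom_adjointD'[OF \<sigma> h]])
qed

lemma hom_adjoint_norm: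
  fixes T :: "'e \<Rightarrow>\<^sub>L 'f"
  assumes \<sigma>: "\<sigma> \<in> PAut" and h: "hom_adjoint \<sigma> E F T S"
  shows "norm (S \<eta>) \<le> 4 * norm T * norm \<eta>"
proof (rule le_of_power2_le_mult)
  have "(norm (S \<eta>))\<^sup>2 = norm (ip F \<eta> (T (S \<eta>)))"
    using PAut_norm[OF \<sigma> hom_adjointD[OF h], of \<eta> "S \<eta>"] by (simp add: E.ip_norm)
  also have "\<dots> \<le> 4 * norm \<eta> * norm (T (S \<eta>))" by (rule F.ip_bound)
  also have "\<dots> \<le> 4 * norm \<eta> * (norm T * norm (S \<eta>))"
    by (intro mult_left_mono norm_blinfun) auto
  finally show "(norm (S \<eta>))\<^sup>2 \<le> (4 * norm T * norm \<eta>) * norm (S \<eta>)" by (simp add: mult_ac)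
qed simp_all

text \<open>\<open>hom_ops\<close> asks for a mere function as adjoint, while \<open>fam_adj\<close>
  deals in bounded operators. Linearity and boundedness are automatic: \<open>\<sigma>\<close> is
  isometric, so \<open>ip E (S \<eta>) (S \<eta>)\<close> has the norm of
  \<open>ip F \<eta> (T (S \<eta>))\<close>.\<close>

lemma hom_adjoint_blinfun:
  fixes T :: "'e \<Rightarrow>\<^sub>L 'f"
  assumes \<sigma>: "\<sigma> \<in> PAut" and h: "hom_adjoint \<sigma> E F T S"
  shows "\<exists>S'. S = blinfun_apply S' \<and> clinear_op S' \<and> norm S' \<le> 4 * norm T"
proof -
  have bl: "bounded_linear S"
    by (rule bounded_linear_intro[where K = "4 * norm T"])
       (simp_all add: hom_adjoint_add[OF \<sigma> h] scaleR_scaleC hom_adjoint_scaleC[OF \<sigma> h]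
         hom_adjoint_norm[OF \<sigma> h] mult.commute[of "norm _"])
  note S = bounded_linear_Blinfun_apply[OF bl]
  have "clinear_op (Blinfun S)" by (simp add: clinear_op_def S hom_adjoint_scaleC[OF \<sigma> h])
  moreover have "norm (Blinfun S) \<le> 4 * norm T"
    by (rule norm_blinfun_bound) (simp_all add: S hom_adjoint_norm[OF \<sigma> h])
  ultimately show ?thesis using S by metis
qed

text \<open>The twist of the right action comes from the adjoint relation alone, by testing against
  all inner products.\<close>

lemma hom_adjoint_ract:
  assumes \<sigma>: "\<sigma> \<in> PAut" and h: "hom_adjoint \<sigma> E F T S" and b: "\<sigma> b = Some b'"
  shows "T (ract E \<xi> b) = ract F (T \<xi>) b'"
proof (rule F.ip_eqI)
  fix z
  have "\<sigma> (ip E (S z) (ract E \<xi> b)) = Some (ip F z (ract F (T \<xi>) b'))"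
    unfolding E.ip_ract F.ip_ract by (intro PAut_mult \<sigma> b hom_adjointD[OF h])
  then show "ip F z (T (ract E \<xi> b)) = ip F z (ract F (T \<xi>) b')"
    by (simp add: hom_adjointD[OF h])
qed

text \<open>Adjoints depend conjugate-linearly on \<open>T\<close> with norm at most
  \<open>4 * norm T\<close>, so the adjoints of a convergent sequence form a Cauchy sequence; the
  relation survives in the limit because the graph of \<open>\<sigma>\<close> is closed.\<close>

lemma hom_adjoint_set:
  assumes \<sigma>: "\<sigma> \<in> PAut" and V: "csubspace V" "closed V"
  shows "csubspace {T :: 'e \<Rightarrow>\<^sub>L 'f. \<exists>S\<in>V. hom_adjoint \<sigma> E F T (blinfun_apply S)}"
    and "closed {T :: 'e \<Rightarrow>\<^sub>L 'f. \<exists>S\<in>V. hom_adjoint \<sigma> E F T (blinfun_apply S)}"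
proof -
  let ?A = "{T :: 'e \<Rightarrow>\<^sub>L 'f. \<exists>S\<in>V. hom_adjoint \<sigma> E F T (blinfun_apply S)}"
  have add: "hom_adjoint \<sigma> E F (blinfun_apply (T + T')) (blinfun_apply (S + S'))"
    if "hom_adjoint \<sigma> E F (blinfun_apply T) (blinfun_apply S)"
      "hom_adjoint \<sigma> E F (blinfun_apply T') (blinfun_apply S')" for T T' :: "'e \<Rightarrow>\<^sub>L 'f" and S S'
    using that by (simp add: hom_adjoint_def blinfun.add_left E.ip_add_left F.ip_add_right PAut_add[OF \<sigma>])
  have scale: "hom_adjoint \<sigma> E F (blinfun_apply (c *\<^sub>C T)) (blinfun_apply (cnj c *\<^sub>C S))"
    if "hom_adjoint \<sigma> E F (blinfun_apply T) (blinfun_apply S)" for T :: "'e \<Rightarrow>\<^sub>L 'f" and S c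
    using that by (simp add: hom_adjoint_def blinfun_apply_scaleC E.ip_scale_left F.ip_scale_right
        PAut_scaleC[OF \<sigma>])
  show "csubspace ?A"
  proof (rule csubspaceI)
    show "0 \<in> ?A" using V(1) PAut_zero[OF \<sigma>]
      by (auto intro!: bexI[of _ 0] simp: hom_adjoint_def cplx.subspace_0)
    show "x + y \<in> ?A" if "x \<in> ?A" "y \<in> ?A" for x y
      using that add cplx.subspace_add[OF V(1)] by blast
    show "c *\<^sub>C x \<in> ?A" if "x \<in> ?A" for c x
      using that scale cplx.subspace_scale[OF V(1)] by blast
  qed
  show "closed ?A"
    unfolding closed_sequential_limits
  proof (intro allI impI, elim conjE)
    fix X l assume "\<forall>n. X n \<in> ?A" and X: "X \<longlonglongrightarrow> l"
    then obtain S where S: "\<And>n. S n \<in> V" "\<And>n. hom_adjoint \<sigma> E F (blinfun_apply (X n)) (blinfun_apply (S n))"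
      by simp metis
    have norm_S: "norm (S m - S n) \<le> 4 * norm (X m - X n)" for m n
    proof -
      have "hom_adjoint \<sigma> E F (blinfun_apply (X m + (-1) *\<^sub>C X n)) (blinfun_apply (S m + cnj (-1) *\<^sub>C S n))"
        by (intro add scale S)
      then have h: "hom_adjoint \<sigma> E F (blinfun_apply (X m - X n)) (blinfun_apply (S m - S n))" by simp
      show ?thesis by (rule norm_blinfun_bound) (simp_all add: hom_adjoint_norm[OF \<sigma> h])
    qed
    have "Cauchy S"
    proof (rule CauchyI)
      fix e :: real assume "0 < e"
      then obtain M where M: "\<And>m n. m \<ge> M \<Longrightarrow> n \<ge> M \<Longrightarrow> norm (X m - X n) < e / 4"
        using CauchyD[OF LIMSEQ_imp_Cauchy[OF X], of "e / 4"] by auto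
      have "norm (S m - S n) < e" if "m \<ge> M" "n \<ge> M" for m n
        using norm_S[of m n] M[OF that] by simp
      then show "\<exists>M. \<forall>m\<ge>M. \<forall>n\<ge>M. norm (S m - S n) < e" by blast
    qed
    then obtain R where R: "S \<longlonglongrightarrow> R" using Cauchy_convergent convergent_def by blast
    have "R \<in> V" using closed_sequentially[OF V(2) S(1) R] .
    moreover have "hom_adjoint \<sigma> E F (blinfun_apply l) (blinfun_apply R)"
      unfolding hom_adjoint_def
    proof (intro allI)
      fix \<xi> \<eta>
      show "\<sigma> (ip E (R \<eta>) \<xi>) = Some (ip F \<eta> (l \<xi>))"
      proof (rule PAut_limit[OF \<sigma> hom_adjointD[OF S(2)]])
        show "(\<lambda>n. ip E (S n \<eta>) \<xi>) \<longlonglongrightarrow> ip E (R \<eta>) \<xi>"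
          by (intro bounded_linear.tendsto[OF E.bounded_linear_ip_left]
              bounded_linear.tendsto[OF blinfun.bounded_linear_left] R)
        show "(\<lambda>n. ip F \<eta> (X n \<xi>)) \<longlonglongrightarrow> ip F \<eta> (l \<xi>)"
          by (intro bounded_linear.tendsto[OF F.bounded_linear_ip_right]
              bounded_linear.tendsto[OF blinfun.bounded_linear_left] X)
      qed
    qed
    ultimately show "l \<in> ?A" by blast
  qed
qed

end

lemma bimod_pair_sym: "bimod_pair E F \<Longrightarrow> bimod_pair F E"
  by (simp add: bimod_pair_def)

text \<open>\<open>T\<close> is in turn an adjoint of \<open>S\<close> for the inverse of
  \<open>\<sigma>\<close>, and adjoints are complex-linear.\<close>

lemma (in bimod_pair) hom_adjoint_clinear:
  fixes T :: "'e \<Rightarrow>\<^sub>L 'f"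
  assumes "\<sigma> \<in> PAut" "hom_adjoint \<sigma> E F T S"
  shows "clinear_op T"
proof -
  interpret FE: bimod_pair F E by (rule bimod_pair_sym) unfold_locales
  show ?thesis
    unfolding clinear_op_def
    using FE.hom_adjoint_scaleC[OF pinv_PAut[OF assms(1)] hom_adjoint_sym[OF assms]] by blast
qed

section \<open>Adjoints in C*-families, and left actions under compatibility\<close>

context bimod
begin

lemma cstar_family_hom_ops:
  "cstar_family E \<C> \<Longrightarrow> \<rho> \<in> PAut \<Longrightarrow> \<sigma> \<in> PAut \<Longrightarrow> c \<in> \<C> \<rho> \<sigma> \<Longrightarrow> c \<in> hom_ops E E \<rho> \<sigma>"
  by (auto simp: cstar_family_def op_family_def)

text \<open>An entry is a limit of sums of products \<open>T' T\<close> with \<open>T'\<close> the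
  adjoint of some \<open>T1\<close> of the family. The adjoint of such a product is the adjoint of
  \<open>T\<close> times \<open>T1\<close>, a product of the same kind at the inverse indices, and
  \<open>hom_adjoint_set\<close> covers the closed span.\<close>

lemma cstar_family_adjoint:
  assumes fam: "cstar_family E \<C>" and \<rho>: "\<rho> \<in> PAut" and \<sigma>: "\<sigma> \<in> PAut" and c: "c \<in> \<C> \<rho> \<sigma>"
  shows "\<exists>S\<in>\<C> (pinv \<rho>) (pinv \<sigma>). hom_adjoint \<sigma> E E (blinfun_apply c) (blinfun_apply S)"
proof -
  interpret EE: bimod_pair E E by unfold_locales
  let ?V = "\<C> (pinv \<rho>) (pinv \<sigma>)"
  let ?A = "{T. \<exists>S\<in>?V. hom_adjoint \<sigma> E E (blinfun_apply T) (blinfun_apply S)}"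
  note inv = pinv_PAut[OF \<rho>] pinv_PAut[OF \<sigma>]
  have V: "csubspace ?V" "closed ?V" using fam inv by (auto simp: cstar_family_def op_family_def)
  have eq: "fam_prod (fam_adj E E \<C>) \<C> \<rho>' \<sigma>' = \<C> \<rho>' \<sigma>'" if "\<rho>' \<in> PAut" "\<sigma>' \<in> PAut" for \<rho>' \<sigma>'
    using fam that by (simp add: cstar_family_def fam_eq_def)
  have "fam_prod (fam_adj E E \<C>) \<C> \<rho> \<sigma> \<subseteq> ?A"
    unfolding fam_prod_def
  proof (rule closed_span_minimal[OF _ EE.hom_adjoint_set[OF \<sigma> V]], safe)
    fix T' T \<rho>1 \<sigma>1 \<rho>2 \<sigma>2
    assume P: "\<rho>1 \<in> PAut" "\<sigma>1 \<in> PAut" "\<rho>2 \<in> PAut" "\<sigma>2 \<in> PAut"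
      and T': "T' \<in> fam_adj E E \<C> \<rho>1 \<sigma>1" and T: "T \<in> \<C> \<rho>2 \<sigma>2"
      and le: "\<rho>1 \<circ>\<^sub>m \<rho>2 \<subseteq>\<^sub>m \<rho>" "\<sigma>1 \<circ>\<^sub>m \<sigma>2 \<subseteq>\<^sub>m \<sigma>"
    note P' = P[THEN pinv_PAut]
    obtain T1 where T1: "T1 \<in> \<C> (pinv \<rho>1) (pinv \<sigma>1)"
      "hom_adjoint (pinv \<sigma>1) E E (blinfun_apply T1) (blinfun_apply T')"
      using T' by (auto simp: fam_adj_def)
    have T1': "hom_adjoint \<sigma>1 E E (blinfun_apply T') (blinfun_apply T1)"
      using EE.hom_adjoint_sym[OF P'(2) T1(2)] by (simp add: pinv_pinv P)
    obtain S0 where "hom_adjoint \<sigma>2 E E (blinfun_apply T) S0"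
      using cstar_family_hom_ops[OF fam P(3,4) T] by (auto simp: hom_ops_def)
    then obtain S where S: "hom_adjoint \<sigma>2 E E (blinfun_apply T) (blinfun_apply S)"
      using EE.hom_adjoint_blinfun[OF P(4)] by blast
    have "S \<in> fam_adj E E \<C> (pinv \<rho>2) (pinv \<sigma>2)"
      unfolding fam_adj_def using S T by (auto simp: pinv_pinv P)
    then have "S o\<^sub>L T1 \<in> fam_prod (fam_adj E E \<C>) \<C> (pinv \<rho>) (pinv \<sigma>)"
      unfolding fam_prod_def
      using P' T1(1) PAut_comp_pinv_le[OF P(1,3) \<rho> le(1)] PAut_comp_pinv_le[OF P(2,4) \<sigma> le(2)]
      by (intro closed_span_base CollectI exI[of _ S] exI[of _ T1] conjI refl
          bexI[of _ "pinv \<rho>2"] bexI[of _ "pinv \<sigma>2"] bexI[of _ "pinv \<rho>1"] bexI[of _ "pinv \<sigma>1"])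
    then have "S o\<^sub>L T1 \<in> ?V" by (simp add: eq inv)
    moreover have "hom_adjoint \<sigma> E E (blinfun_apply (T' o\<^sub>L T)) (blinfun_apply (S o\<^sub>L T1))"
      using hom_adjoint_mono[OF hom_adjoint_compose[OF S T1'] le(2)] by (simp add: hom_adjoint_def)
    ultimately show "\<exists>S\<in>?V. hom_adjoint \<sigma> E E (blinfun_apply (T' o\<^sub>L T)) (blinfun_apply S)" by blast
  qed
  then show ?thesis using c eq[OF \<rho> \<sigma>] by blast
qed

text \<open>The difference of \<open>x\<close> and \<open>y\<close> is orthogonal to every
  \<open>lact E b \<eta>\<close> with \<open>b\<close> in \<open>I\<close>, as \<open>b\<close> can
  be moved to the other side; but it lies in the closed span of these elements.\<close>

lemma lact_separates:
  assumes I: "\<And>b. b \<in> I \<Longrightarrow> star b \<in> I"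
    and x: "x \<in> \<lbrakk>{lact E b \<eta> | b \<eta>. b \<in> I}\<rbrakk>" and y: "y \<in> \<lbrakk>{lact E b \<eta> | b \<eta>. b \<in> I}\<rbrakk>"
    and eq: "\<And>w. w \<in> I \<Longrightarrow> lact E w x = lact E w y"
  shows "x = y"
proof -
  have "x - y \<in> \<lbrakk>{lact E b \<eta> | b \<eta>. b \<in> I}\<rbrakk>"
    by (intro cplx.subspace_diff csubspace_closed_span x y)
  then have "ip E (x - y) (x - y) = 0"
  proof (rule ip_zero_on_closed_span[rotated])
    show "ip E (x - y) s = 0" if "s \<in> {lact E b \<eta> |b \<eta>. b \<in> I}" for s
      using that eq[OF I] by (auto simp: ip_lact bounded_bilinear.diff_right[OF bounded_bilinear_lact])
  qed
  then show ?thesis by simp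
qed

lemma lact_closed_span_ideal:
  assumes "\<And>b. b \<in> I \<Longrightarrow> a * b \<in> I" "x \<in> \<lbrakk>{lact E b \<eta> | b \<eta>. b \<in> I}\<rbrakk>"
  shows "lact E a x \<in> \<lbrakk>{lact E b \<eta> | b \<eta>. b \<in> I}\<rbrakk>"
proof (rule closed_span_vimage[OF bounded_bilinear.bounded_linear_right[OF bounded_bilinear_lact]
      lact_scale_right csubspace_closed_span closed_closed_span _ assms(2)])
  fix s assume "s \<in> {lact E b \<eta> | b \<eta>. b \<in> I}"
  then obtain b \<eta> where "s = lact E b \<eta>" "b \<in> I" by blast
  then show "lact E a s \<in> \<lbrakk>{lact E b \<eta> | b \<eta>. b \<in> I}\<rbrakk>"
    using assms(1) by (intro closed_span_base) (auto simp flip: lact_mult)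
qed

end

text \<open>\<open>x' * a'\<close> lies in both ranges, and compatibility gives it one preimage
  \<open>z\<close> under both maps. It remains to identify \<open>z\<close> with
  \<open>x * a\<close>, though \<open>x\<close> need not lie in the domain of
  \<open>\<kappa>\<close> nor \<open>a\<close> in that of \<open>\<rho>\<close>.\<close>

lemma compatible_mult:
  assumes P: "\<kappa> \<in> PAut" "\<rho> \<in> PAut" and comp: "compatible \<kappa> \<rho>"
    and a: "\<kappa> a = Some a'" and x: "\<rho> x = Some x'"
  shows "\<rho> (x * a) = Some (x' * a')"
proof -
  note c = comp[unfolded compatible_iff[OF P]]
  note I = closed_idealD[OF PAut_ideal(1)[OF P(1)]] closed_idealD[OF PAut_ideal(1)[OF P(2)]]
  have "x' * a' \<in> ran \<rho>" "x' * a' \<in> ran \<kappa>"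
    using closed_idealD(3)[OF PAut_ideal(2)[OF P(2)] ranI[of \<rho>, OF x]]
      closed_idealD(4)[OF PAut_ideal(2)[OF P(1)] ranI[of \<kappa>, OF a]] by auto
  then obtain z z' where z: "\<rho> z = Some (x' * a')" "\<kappa> z' = Some (x' * a')" by (auto simp: ran_def)
  then have zz: "z' = z" using c by blast
  define w where "w = z - x * a"
  have xa: "x * a \<in> dom \<rho>" "x * a \<in> dom \<kappa>" using I x a by blast+
  have w: "w \<in> dom \<rho>" "w \<in> dom \<kappa>"
    unfolding w_def
    by (rule cplx.subspace_diff[OF I(5) _ xa(1)], use z in blast)
       (rule cplx.subspace_diff[OF I(1) _ xa(2)], use z zz in blast)
  obtain v where v: "\<rho> (star w) = Some v" using PAut_star[OF P(2)] w by blast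
  obtain v' where v': "\<kappa> (star w) = Some v'" using PAut_star[OF P(1)] w by blast
  have vv: "v' = v" using c v v' by blast
  \<comment> \<open>Multiplying by \<open>star w\<close> moves \<open>x\<close> into both domains.
    There \<open>\<kappa>\<close> agrees with \<open>\<rho>\<close>, and the factor \<open>a\<close>
    can be split off under \<open>\<kappa>\<close>.\<close>
  have "\<rho> (star w * x) = Some (v * x')" by (rule PAut_mult[OF P(2) v x])
  moreover have "star w * x \<in> dom \<kappa>" using I v' by blast
  ultimately have "\<kappa> (star w * x) = Some (v * x')" using c by fastforce
  then have "\<kappa> (star w * x * a) = Some (v * x' * a')" by (rule PAut_mult[OF P(1) _ a])
  moreover have "\<kappa> (star w * z) = Some (v * (x' * a'))"
    using PAut_mult[OF P(1) v' z(2)] by (simp add: vv zz)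
  ultimately have "star w * x * a = star w * z"
    using PAut_inj[OF P(1)] by (metis mult.assoc)
  then have "star w * w = 0" by (simp add: w_def algebra_simps)
  then have "w = 0" by (rule cstar_eq_0I)
  then show ?thesis using z by (simp add: w_def)
qed

lemma PAut_dom_star: "\<theta> \<in> PAut \<Longrightarrow> b \<in> dom \<theta> \<Longrightarrow> star b \<in> dom \<theta>"
  using PAut_star by blast

lemma PAut_ran_star: "\<theta> \<in> PAut \<Longrightarrow> b \<in> ran \<theta> \<Longrightarrow> star b \<in> ran \<theta>"
  using PAut_dom_star[OF pinv_PAut] by simp

context bimod_pair
begin

text \<open>The values of \<open>d\<close> lie in the closed span of \<open>ran \<rho>\<close>
  acting on \<open>F\<close>, so they are determined by the action of elements
  \<open>w = \<rho>(x)\<close>. For these, \<open>w\<close> times \<open>d (lact E a \<eta>)\<close>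
  is \<open>d\<close> at \<open>x * a\<close> acting on \<open>\<eta>\<close>, and
  \<open>compatible_mult\<close> evaluates \<open>\<rho>\<close> at \<open>x * a\<close>.\<close>

lemma hom_ops_compatible:
  assumes P: "\<kappa> \<in> PAut" "\<rho> \<in> PAut" and comp: "compatible \<kappa> \<rho>"
    and d: "d \<in> hom_ops E F \<rho> \<sigma>" and a: "\<kappa> a = Some a'"
  shows "d (lact E a \<eta>) = lact F a' (d \<eta>)"
proof (rule F.lact_separates[of "ran \<rho>"])
  have d1: "d x \<in> \<lbrakk>{lact F b \<eta> | b \<eta>. b \<in> ran \<rho>}\<rbrakk>" for x
    using d by (auto simp: hom_ops_def)
  have d2: "d (lact E x \<xi>) = lact F x' (d \<xi>)" if "\<rho> x = Some x'" for x x' \<xi>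
    using d that by (auto simp: hom_ops_def)
  show "d (lact E a \<eta>) \<in> \<lbrakk>{lact F b \<eta> | b \<eta>. b \<in> ran \<rho>}\<rbrakk>" by (rule d1)
  show "lact F a' (d \<eta>) \<in> \<lbrakk>{lact F b \<eta> | b \<eta>. b \<in> ran \<rho>}\<rbrakk>"
    by (rule F.lact_closed_span_ideal[OF _ d1])
       (use closed_idealD[OF PAut_ideal(2)[OF P(2)]] in blast)
  show "lact F w (d (lact E a \<eta>)) = lact F w (lact F a' (d \<eta>))" if w: "w \<in> ran \<rho>" for w
  proof -
    obtain x where x: "\<rho> x = Some w" using w by (auto simp: ran_def)
    show ?thesis
      using d2[OF compatible_mult[OF P comp a x]] d2[OF x] by (simp add: E.lact_mult F.lact_mult)
  qed
qed (rule PAut_ran_star[OF P(2)])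

end

section \<open>Tensor products\<close>

text \<open>The bound on finite sums, written as lists of indices so that repetitions are harmless,
  gives well-definedness and continuity at once.\<close>

lemma bounded_extension:
  fixes g :: "'i \<Rightarrow> 'x::complex_banach" and h :: "'i \<Rightarrow> 'y::complex_banach"
  assumes scale: "\<And>i c. i \<in> I \<Longrightarrow> \<exists>j\<in>I. g j = c *\<^sub>C g i \<and> h j = c *\<^sub>C h i"
    and dense: "\<lbrakk>g ` I\<rbrakk> = UNIV" and K: "0 \<le> K"
    and bound: "\<And>xs. set xs \<subseteq> I \<Longrightarrow> norm (\<Sum>i\<leftarrow>xs. h i) \<le> K * norm (\<Sum>i\<leftarrow>xs. g i)"
  shows "\<exists>L. clinear_op L \<and> (\<forall>i\<in>I. blinfun_apply L (g i) = h i) \<and> (\<forall>x. norm (L x) \<le> K * norm x)"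
proof -
  define G where "G xs = (\<Sum>i\<leftarrow>xs. g i)" for xs
  define H where "H xs = (\<Sum>i\<leftarrow>xs. h i)" for xs
  have GH: "G [] = 0" "H [] = 0" "G (xs @ ys) = G xs + G ys" "H (xs @ ys) = H xs + H ys" for xs ys
    by (simp_all add: G_def H_def)
  have scale_list: "\<exists>ys. set ys \<subseteq> I \<and> G ys = c *\<^sub>C G xs \<and> H ys = c *\<^sub>C H xs" if "set xs \<subseteq> I" for xs c
    using that
  proof (induction xs)
    case Nil
    then show ?case by (intro exI[of _ "[]"]) (simp add: GH)
  next
    case (Cons i xs)
    then obtain ys where ys: "set ys \<subseteq> I" "G ys = c *\<^sub>C G xs" "H ys = c *\<^sub>C H xs" by auto
    obtain j where j: "j \<in> I" "g j = c *\<^sub>C g i" "h j = c *\<^sub>C h i" using scale[of i c] Cons.prems by auto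
    show ?case
      using ys j by (intro exI[of _ "j # ys"]) (simp add: G_def H_def scaleC_add_right)
  qed
  have diff_list: "\<exists>zs. set zs \<subseteq> I \<and> G zs = G xs - G ys \<and> H zs = H xs - H ys"
    if xys: "set xs \<subseteq> I" "set ys \<subseteq> I" for xs ys
  proof -
    obtain zs where "set zs \<subseteq> I" "G zs = (-1) *\<^sub>C G ys" "H zs = (-1) *\<^sub>C H ys"
      using scale_list[OF xys(2)] by blast
    then show ?thesis using xys(1) by (intro exI[of _ "xs @ zs"]) (simp add: GH)
  qed
  \<comment> \<open>The graph of the operator to be built: limits of a sequence of sums of
    \<open>g\<close> paired with limits of the same sums of \<open>h\<close>. The bound makes it
    single-valued, and completeness of the target makes it total.\<close>
  define R where "R x y \<longleftrightarrow> (\<exists>X. (\<forall>n::nat. set (X n) \<subseteq> I) \<and> (\<lambda>n. G (X n)) \<longlonglongrightarrow> x \<and> (\<lambda>n. H (X n)) \<longlonglongrightarrow> y)"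
    for x y
  have R_add: "R (x + x') (y + y')" if "R x y" "R x' y'" for x x' y y'
  proof -
    obtain X X' where "\<forall>n. set (X n) \<subseteq> I" "(\<lambda>n. G (X n)) \<longlonglongrightarrow> x" "(\<lambda>n. H (X n)) \<longlonglongrightarrow> y"
      "\<forall>n. set (X' n) \<subseteq> I" "(\<lambda>n. G (X' n)) \<longlonglongrightarrow> x'" "(\<lambda>n. H (X' n)) \<longlonglongrightarrow> y'"
      using \<open>R x y\<close> \<open>R x' y'\<close> unfolding R_def by blast
    then show ?thesis
      unfolding R_def by (intro exI[of _ "\<lambda>n. X n @ X' n"]) (simp add: GH tendsto_add)
  qed
  have R_scale: "R (c *\<^sub>C x) (c *\<^sub>C y)" if "R x y" for c x y
  proof -
    obtain X where X: "\<And>n. set (X n) \<subseteq> I" "(\<lambda>n. G (X n)) \<longlonglongrightarrow> x" "(\<lambda>n. H (X n)) \<longlonglongrightarrow> y"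
      using \<open>R x y\<close> unfolding R_def by blast
    obtain Y where "\<And>n. set (Y n) \<subseteq> I" "\<And>n. G (Y n) = c *\<^sub>C G (X n)" "\<And>n. H (Y n) = c *\<^sub>C H (X n)"
      using scale_list[OF X(1), where c = c] by metis
    then show ?thesis
      unfolding R_def using X by (intro exI[of _ Y]) (simp add: tendsto_scaleC)
  qed
  have R_norm: "norm y \<le> K * norm x" if "R x y" for x y
  proof -
    obtain X where X: "\<And>n. set (X n) \<subseteq> I" "(\<lambda>n. G (X n)) \<longlonglongrightarrow> x" "(\<lambda>n. H (X n)) \<longlonglongrightarrow> y"
      using \<open>R x y\<close> unfolding R_def by blast
    show ?thesis
    proof (rule LIMSEQ_le)
      show "(\<lambda>n. norm (H (X n))) \<longlonglongrightarrow> norm y" by (intro tendsto_norm X)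
      show "(\<lambda>n. K * norm (G (X n))) \<longlonglongrightarrow> K * norm x" by (intro tendsto_intros X)
      show "\<exists>N. \<forall>n\<ge>N. norm (H (X n)) \<le> K * norm (G (X n))"
        using bound[OF X(1)] by (auto simp: G_def H_def)
    qed
  qed
  have R_unique: "y = y'" if "R x y" "R x y'" for x y y'
    using R_norm[OF R_add[OF that(1) R_scale[OF that(2), of "-1"]]] by simp
  have R_ex: "\<exists>y. R x y" for x
  proof -
    let ?D = "{G xs | xs. set xs \<subseteq> I}"
    have "csubspace ?D"
    proof (rule csubspaceI)
      show "0 \<in> ?D" by (auto intro!: exI[of _ "[]"] simp: GH)
      show "x + y \<in> ?D" if xy: "x \<in> ?D" "y \<in> ?D" for x y
      proof -
        obtain xs ys where "x = G xs" "set xs \<subseteq> I" "y = G ys" "set ys \<subseteq> I" using xy by blast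
        then show ?thesis by (intro CollectI exI[of _ "xs @ ys"]) (simp add: GH)
      qed
      show "c *\<^sub>C x \<in> ?D" if x: "x \<in> ?D" for c x
      proof -
        obtain xs where xs: "x = G xs" "set xs \<subseteq> I" using x by blast
        then obtain ys where "set ys \<subseteq> I" "G ys = c *\<^sub>C G xs" using scale_list by blast
        then show ?thesis using xs by (intro CollectI exI[of _ ys]) simp
      qed
    qed
    moreover have "g ` I \<subseteq> ?D"
    proof safe
      fix i assume "i \<in> I"
      then show "\<exists>xs. g i = G xs \<and> set xs \<subseteq> I" by (intro exI[of _ "[i]"]) (simp add: G_def)
    qed
    ultimately have "\<lbrakk>g ` I\<rbrakk> \<subseteq> closure ?D"
      unfolding closed_span_def by (intro closure_mono cplx.span_minimal)
    then have "x \<in> closure ?D" using dense by blast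
    then obtain u where u: "\<And>n. u n \<in> ?D" "u \<longlonglongrightarrow> x" unfolding closure_sequential by blast
    then have "\<forall>n. \<exists>xs. u n = G xs \<and> set xs \<subseteq> I" by blast
    then obtain X where X': "\<And>n. u n = G (X n) \<and> set (X n) \<subseteq> I" by metis
    have "u = (\<lambda>n. G (X n))" using X' by blast
    then have X: "\<And>n. set (X n) \<subseteq> I" "(\<lambda>n. G (X n)) \<longlonglongrightarrow> x"
      using u(2) X' by auto
    have le: "norm (H (X m) - H (X n)) \<le> K * norm (G (X m) - G (X n))" for m n
      using diff_list[OF X(1) X(1), of m n] bound by (metis G_def H_def)
    have "Cauchy (\<lambda>n. H (X n))"
    proof (rule CauchyI)
      fix e :: real assume e: "0 < e"
      then obtain M where M: "\<And>m n. m \<ge> M \<Longrightarrow> n \<ge> M \<Longrightarrow> norm (G (X m) - G (X n)) < e / (K + 1)"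
        using CauchyD[OF LIMSEQ_imp_Cauchy[OF X(2)], of "e / (K + 1)"] K by auto
      have "norm (H (X m) - H (X n)) < e" if "m \<ge> M" "n \<ge> M" for m n
      proof -
        have "K * norm (G (X m) - G (X n)) \<le> (K + 1) * norm (G (X m) - G (X n))"
          by (intro mult_right_mono) auto
        also have "\<dots> < e" using M[OF that] K by (simp add: field_simps)
        finally show ?thesis using le[of m n] by linarith
      qed
      then show "\<exists>M. \<forall>m\<ge>M. \<forall>n\<ge>M. norm (H (X m) - H (X n)) < e" by blast
    qed
    then obtain y where "(\<lambda>n. H (X n)) \<longlonglongrightarrow> y" using Cauchy_convergent convergent_def by blast
    then show ?thesis unfolding R_def using X by blast
  qed
  obtain f where f: "\<And>x. R x (f x)" using R_ex by metis
  have f_scale: "f (c *\<^sub>C x) = c *\<^sub>C f x" for c x by (rule R_unique[OF f R_scale[OF f]])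
  have bl: "bounded_linear f"
    by (rule bounded_linear_intro[where K = K])
       (auto intro: R_unique[OF f R_add[OF f f]] simp: scaleR_scaleC f_scale mult.commute[of "norm _"] R_norm[OF f])
  have "R (g i) (h i)" if "i \<in> I" for i
    unfolding R_def by (rule exI[of _ "\<lambda>_. [i]"]) (simp add: that G_def H_def)
  then have "f (g i) = h i" if "i \<in> I" for i using R_unique[OF f] that by blast
  then show ?thesis
    by (intro exI[of _ "Blinfun f"]) (simp add: clinear_op_def bounded_linear_Blinfun_apply[OF bl] f_scale R_norm[OF f])
qed

text \<open>\<open>R\<close> will be equality or the graph of a partial automorphism, both of which
  respect sums.\<close>

lemma ip_sum_list_pairing:
  assumes X: "hilbert_ip ipX" and Y: "hilbert_ip ipY"
    and R0: "R 0 0" and R_add: "\<And>a b a' b'. R a b \<Longrightarrow> R a' b' \<Longrightarrow> R (a + a') (b + b')"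
    and R: "\<And>i j. i \<in> set xs \<Longrightarrow> j \<in> set ys \<Longrightarrow> R (ipX (g i) (g' j)) (ipY (h i) (h' j))"
  shows "R (ipX (\<Sum>i\<leftarrow>xs. g i) (\<Sum>j\<leftarrow>ys. g' j)) (ipY (\<Sum>i\<leftarrow>xs. h i) (\<Sum>j\<leftarrow>ys. h' j))"
proof -
  interpret X: hilbert_ip ipX by fact
  interpret Y: hilbert_ip ipY by fact
  have single: "R (ipX x (\<Sum>j\<leftarrow>ys. g' j)) (ipY y (\<Sum>j\<leftarrow>ys. h' j))"
    if "\<And>j. j \<in> set ys \<Longrightarrow> R (ipX x (g' j)) (ipY y (h' j))" for x y ys
    using that by (induction ys) (simp_all add: R0 R_add X.ip_add_right Y.ip_add_right)
  show ?thesis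
    using R
  proof (induction xs)
    case (Cons i xs)
    have "R (ipX (g i) (\<Sum>j\<leftarrow>ys. g' j)) (ipY (h i) (\<Sum>j\<leftarrow>ys. h' j))"
      using Cons.prems by (intro single) simp
    then show ?case using Cons by (simp add: R_add X.ip_add_left Y.ip_add_left)
  qed (simp add: R0)
qed

text \<open>\<open>T Z j\<close> is the tensor with index \<open>j\<close> after \<open>Z\<close>
  has been inserted in one factor. The square root of \<open>1 - P^2\<close>, for a rescaled
  \<open>P\<close>, makes the totals satisfy the hypotheses of
  \<open>norm_le_of_sum_squares\<close>. \<open>T_adj\<close> is demanded only of operators that
  commute with whatever commutes with \<open>P\<close>: this can be checked on balanced tensors, and
  the rescaled \<open>P\<close> and the square root qualify.\<close>

lemma operator_list_bound:
  fixes P :: "'e::complex_banach \<Rightarrow>\<^sub>L 'e" and T :: "('e \<Rightarrow>\<^sub>L 'e) \<Rightarrow> 'j \<Rightarrow> 'x::complex_banach"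
  assumes E: "hilbert_ip ipE" and X: "hilbert_ip ipX"
    and P: "clinear_op P" "\<And>x y. ipE (P x) y = ipE x (P y)"
    and T_add: "\<And>Z Z' j. j \<in> I \<Longrightarrow> T (Z + Z') j = T Z j + T Z' j"
    and T_scale: "\<And>r Z j. j \<in> I \<Longrightarrow> T (r *\<^sub>R Z) j = r *\<^sub>R T Z j"
    and T_adj: "\<And>Z Z' i j. clinear_op Z \<Longrightarrow> clinear_op Z' \<Longrightarrow>
      (\<And>x y. ipE (Z x) y = ipE x (Z y)) \<Longrightarrow>
      (\<And>Y. clinear_op Y \<Longrightarrow> Y o\<^sub>L P = P o\<^sub>L Y \<Longrightarrow> Y o\<^sub>L Z = Z o\<^sub>L Y) \<Longrightarrow> i \<in> I \<Longrightarrow> j \<in> I \<Longrightarrow>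
      ipX (T Z i) (T Z' j) = ipX (T id_blinfun i) (T (Z o\<^sub>L Z') j)"
    and xs: "set xs \<subseteq> I"
  shows "norm (\<Sum>j\<leftarrow>xs. T P j) \<le> norm P * norm (\<Sum>j\<leftarrow>xs. T id_blinfun j)"
proof -
  interpret E: hilbert_ip ipE by fact
  interpret X: hilbert_ip ipX by fact
  define tot where "tot Z = (\<Sum>j\<leftarrow>xs. T Z j)" for Z
  have tot_add: "tot (Z + Z') = tot Z + tot Z'" for Z Z'
    unfolding tot_def using xs by (induction xs) (simp_all add: T_add)
  have tot_scale: "tot (r *\<^sub>R Z) = r *\<^sub>R tot Z" for r Z
    unfolding tot_def using xs by (induction xs) (simp_all add: T_scale scaleR_add_right)
  have tot_adj: "ipX (tot Z) (tot Z') = ipX (tot id_blinfun) (tot (Z o\<^sub>L Z'))"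
    if Z: "clinear_op Z" "clinear_op Z'" "\<And>x y. ipE (Z x) y = ipE x (Z y)"
      "\<And>Y. clinear_op Y \<Longrightarrow> Y o\<^sub>L P = P o\<^sub>L Y \<Longrightarrow> Y o\<^sub>L Z = Z o\<^sub>L Y" for Z Z'
  proof -
    have "ipX (T Z i) (T Z' j) = ipX (T id_blinfun i) (T (Z o\<^sub>L Z') j)"
      if ij: "i \<in> set xs" "j \<in> set xs" for i j
      using xs ij by (intro T_adj Z) auto
    then show ?thesis
      unfolding tot_def by (intro ip_sum_list_pairing[OF X X, where R = "(=)"]) auto
  qed
  have main: "norm (tot P') \<le> norm (tot id_blinfun)"
    if r: "P' = r *\<^sub>R P" and n: "norm P' < 1" for P' r
  proof -
    have P': "clinear_op P'" "\<And>x y. ipE (P' x) y = ipE x (P' y)"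
      by (simp_all add: r clinear_op_scaleR P blinfun.scaleR_left E.ip_scaleR_left E.ip_scaleR_right)
    have comm: "Y o\<^sub>L P' = P' o\<^sub>L Y" if "Y o\<^sub>L P = P o\<^sub>L Y" for Y
      using that by (simp add: r bounded_bilinear.scaleR_left[OF bounded_bilinear_blinfun_compose]
          bounded_bilinear.scaleR_right[OF bounded_bilinear_blinfun_compose])
    obtain Q where Q: "clinear_op Q" "\<And>x y. ipE (Q x) y = ipE x (Q y)" "Q + Q = (P' o\<^sub>L P') + (Q o\<^sub>L Q)"
      "\<And>Z. clinear_op Z \<Longrightarrow> Z o\<^sub>L P' = P' o\<^sub>L Z \<Longrightarrow> Z o\<^sub>L Q = Q o\<^sub>L Z"
      using E.operator_sqrt[OF P' n] by blast
    \<comment> \<open>The square root of the identity minus the square of \<open>P'\<close>.\<close>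
    define N where "N = id_blinfun - Q"
    have N: "clinear_op N" "\<And>x y. ipE (N x) y = ipE x (N y)"
      by (simp_all add: N_def clinear_op_diff Q blinfun.diff_left E.ip_diff_left E.ip_diff_right)
    have N_comm: "Y o\<^sub>L N = N o\<^sub>L Y" if "clinear_op Y" "Y o\<^sub>L P = P o\<^sub>L Y" for Y
    proof -
      have "Y (Q x) = Q (Y x)" for x
        using Q(4)[OF that(1) comm[OF that(2)]] by (metis blinfun_apply_blinfun_compose)
      then show ?thesis
        by (intro blinfun_eqI) (simp add: N_def blinfun.diff_left blinfun.diff_right)
    qed
    have PQ: "P' o\<^sub>L Q = Q o\<^sub>L P'" by (rule Q(4)[OF P'(1) refl])
    then have PN: "P' o\<^sub>L N = N o\<^sub>L P'"
      by (simp add: N_def bounded_bilinear.diff_left[OF bounded_bilinear_blinfun_compose]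
          bounded_bilinear.diff_right[OF bounded_bilinear_blinfun_compose])
         (auto intro: blinfun_eqI)
    have one: "(P' o\<^sub>L P') + (N o\<^sub>L N) = id_blinfun"
    proof (rule blinfun_eqI)
      fix x
      have "Q x + Q x = P' (P' x) + Q (Q x)"
        using arg_cong[OF Q(3), of "\<lambda>T. blinfun_apply T x"] by (simp add: blinfun.add_left)
      then show "blinfun_apply ((P' o\<^sub>L P') + (N o\<^sub>L N)) x = blinfun_apply id_blinfun x"
        by (simp add: N_def blinfun.add_left blinfun.diff_left blinfun.diff_right algebra_simps)
    qed
    show ?thesis
    proof (rule X.norm_le_of_sum_squares)
      have "ipX (tot P') (tot P') = ipX (tot id_blinfun) (tot (P' o\<^sub>L P'))"
        by (rule tot_adj[OF P'(1) P'(1) P'(2) comm])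
      moreover have "ipX (tot N) (tot N) = ipX (tot id_blinfun) (tot (N o\<^sub>L N))"
        by (rule tot_adj[OF N(1) N(1) N(2) N_comm])
      ultimately show "ipX (tot P') (tot P') + ipX (tot N) (tot N) = ipX (tot id_blinfun) (tot id_blinfun)"
        by (simp add: X.ip_add_right[symmetric] tot_add[symmetric] one)
      show "ipX (tot P') (tot N) = ipX (tot N) (tot P')"
        using tot_adj[OF P'(1) N(1) P'(2) comm] tot_adj[OF N(1) P'(1) N(2) N_comm] by (simp add: PN)
    qed
  qed
  have le: "norm (tot P) \<le> r * norm (tot id_blinfun)" if r: "r > norm P" for r
  proof -
    have r0: "r > 0" using r norm_ge_zero[of P] by linarith
    have "norm (tot ((1/r) *\<^sub>R P)) \<le> norm (tot id_blinfun)"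
      by (rule main[OF refl norm_normalize[OF r]])
    then show ?thesis using r0 by (simp add: tot_scale divide_simps mult.commute)
  qed
  have "norm (tot P) \<le> norm P * norm (tot id_blinfun)" by (rule le_mult_of_gt) (rule le)
  then show ?thesis by (simp add: tot_def)
qed

text \<open>One setting for three uses: \<open>E \<otimes> F\<close> with \<open>L\<close> the left
  action, the induced Hilbert spaces with \<open>L = \<pi>\<close>, and in particular
  \<open>\<HH>\<close> for \<open>E = B\<close>.\<close>

locale tensor = E: hilbert_ip ipE + F: hilbert_ip ipF + X: hilbert_ip ipX
  for ipE :: "'e::complex_banach \<Rightarrow> 'e \<Rightarrow> 'b::cstar_algebra"
    and ipF :: "'f::complex_banach \<Rightarrow> 'f \<Rightarrow> 'c::cstar_algebra"
    and ipX :: "'x::complex_banach \<Rightarrow> 'x \<Rightarrow> 'c" +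
  fixes L :: "'b \<Rightarrow> 'f \<Rightarrow> 'f" and t :: "'e \<Rightarrow> 'f \<Rightarrow> 'x"
  assumes internal: "internal_tensor ipE L ipF ipX t"
    and bounded_bilinear_L: "bounded_bilinear L"
    and L_scale_left: "L (c *\<^sub>C b) \<eta> = c *\<^sub>C L b \<eta>"
    and L_scale_right: "L b (c *\<^sub>C \<eta>) = c *\<^sub>C L b \<eta>"
begin

lemma ip_t: "ipX (t \<xi> \<eta>) (t \<xi>' \<eta>') = ipF \<eta> (L (ipE \<xi> \<xi>') \<eta>')"
  using internal by (simp add: internal_tensor_def)

lemma dense: "\<lbrakk>{t \<xi> \<eta> | \<xi> \<eta>. True}\<rbrakk> = UNIV"
  using internal by (simp add: internal_tensor_def)

lemma t_eqI_left: "(\<And>\<xi>0 \<eta>0. ipX (t \<xi>0 \<eta>0) x = ipX (t \<xi>0 \<eta>0) y) \<Longrightarrow> x = y"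
  by (rule X.ip_eqI_span[OF dense]) blast

lemma t_eqI_right:
  assumes "\<And>\<xi>0 \<eta>0. ipX x (t \<xi>0 \<eta>0) = ipX y (t \<xi>0 \<eta>0)" shows "x = y"
  by (rule t_eqI_left) (metis assms X.ip_star)

lemma t_add_left: "t (\<xi> + \<xi>') \<eta> = t \<xi> \<eta> + t \<xi>' \<eta>"
  by (rule t_eqI_left)
     (simp add: X.ip_add_right ip_t E.ip_add_right bounded_bilinear.add_left[OF bounded_bilinear_L] F.ip_add_right)

lemma t_scale_left: "t (c *\<^sub>C \<xi>) \<eta> = c *\<^sub>C t \<xi> \<eta>"
  by (rule t_eqI_left) (simp add: X.ip_scale_right ip_t E.ip_scale_right L_scale_left F.ip_scale_right)

lemma t_add_right: "t \<xi> (\<eta> + \<eta>') = t \<xi> \<eta> + t \<xi> \<eta>'"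
  by (rule t_eqI_right) (simp add: X.ip_add_left ip_t F.ip_add_left)

lemma t_scale_right: "t \<xi> (c *\<^sub>C \<eta>) = c *\<^sub>C t \<xi> \<eta>"
  by (rule t_eqI_right) (simp add: X.ip_scale_left ip_t F.ip_scale_left)

lemma bounded_bilinear_t: "bounded_bilinear t"
proof
  obtain K where K: "0 < K" "\<And>b \<eta>. norm (L b \<eta>) \<le> norm b * norm \<eta> * K"
    using bounded_bilinear.pos_bounded[OF bounded_bilinear_L] by blast
  have "norm (t \<xi> \<eta>) \<le> norm \<xi> * norm \<eta> * sqrt (4 * K)" for \<xi> \<eta>
  proof (rule power2_le_imp_le)
    have "(norm (t \<xi> \<eta>))\<^sup>2 \<le> 4 * norm \<eta> * norm (L (ipE \<xi> \<xi>) \<eta>)"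
      unfolding X.ip_norm ip_t by (rule F.ip_bound)
    also have "\<dots> \<le> 4 * norm \<eta> * (norm (ipE \<xi> \<xi>) * norm \<eta> * K)"
      by (intro mult_left_mono K) auto
    also have "\<dots> = (norm \<xi> * norm \<eta> * sqrt (4 * K))\<^sup>2"
      using K(1) by (simp add: E.ip_norm[symmetric] power_mult_distrib real_sqrt_mult power2_eq_square[of "norm \<eta>"])
    finally show "(norm (t \<xi> \<eta>))\<^sup>2 \<le> (norm \<xi> * norm \<eta> * sqrt (4 * K))\<^sup>2" .
  qed (use K in simp)
  then show "\<exists>K. \<forall>a b. norm (t a b) \<le> norm a * norm b * K" by blast
qed (simp_all add: t_add_left t_add_right scaleR_scaleC t_scale_left t_scale_right)

lemma blinfun_eqI_t:
  assumes "\<And>\<xi> \<eta>. blinfun_apply Y (t \<xi> \<eta>) = blinfun_apply Z (t \<xi> \<eta>)"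
  shows "Y = Z"
proof (rule blinfun_eqI_span[OF dense])
  fix c x assume "x \<in> {t \<xi> \<eta> |\<xi> \<eta>. True}"
  then obtain \<xi> \<eta> where "x = t \<xi> \<eta>" by blast
  then have "c *\<^sub>C x = t (c *\<^sub>C \<xi>) \<eta>" by (simp add: t_scale_left)
  then show "c *\<^sub>C x \<in> {t \<xi> \<eta> |\<xi> \<eta>. True}" by blast
qed (use assms in auto)

lemma tensor_op_eqI:
  assumes "\<And>\<xi> \<eta>. blinfun_apply Y (t \<xi> \<eta>) = t' (blinfun_apply S \<xi>) (blinfun_apply T \<eta>)"
  shows "tensor_op t t' S T = Y"
  unfolding tensor_op_def
  by (rule the_equality) (auto simp: assms intro: blinfun_eqI_t)

lemma left_factor_bound:
  assumes P: "clinear_op P" "\<And>x y. ipE (blinfun_apply P x) y = ipE x (blinfun_apply P y)"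
  shows "norm (\<Sum>p\<leftarrow>xs. t (P (fst p)) (snd p)) \<le> norm P * norm (\<Sum>p\<leftarrow>xs. t (fst p) (snd p))"
proof -
  have "norm (\<Sum>p\<leftarrow>xs. (\<lambda>Z p. t (blinfun_apply Z (fst p)) (snd p)) P p)
      \<le> norm P * norm (\<Sum>p\<leftarrow>xs. (\<lambda>Z p. t (blinfun_apply Z (fst p)) (snd p)) id_blinfun p)"
    by (rule operator_list_bound[OF E.hilbert_ip_axioms X.hilbert_ip_axioms P, where I = UNIV])
       (simp_all add: blinfun.add_left blinfun.scaleR_left t_add_left
         bounded_bilinear.scaleR_left[OF bounded_bilinear_t] ip_t)
  then show ?thesis by simp
qed

text \<open>Moving an operator across the right factor requires it to commute with
  \<open>L b\<close>. As \<open>L b\<close> commutes with \<open>R\<close>, the commutation clause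
  of \<open>operator_list_bound\<close> passes this on to the square root.\<close>

lemma right_factor_bound:
  assumes R: "clinear_op R" "\<And>x y. ipF (blinfun_apply R x) y = ipF x (blinfun_apply R y)"
    and comm: "\<And>b \<eta>. R (L b \<eta>) = L b (R \<eta>)"
  shows "norm (\<Sum>p\<leftarrow>xs. t (fst p) (R (snd p))) \<le> norm R * norm (\<Sum>p\<leftarrow>xs. t (fst p) (snd p))"
proof -
  have bl: "bounded_linear (L b)" for b by (rule bounded_bilinear.bounded_linear_right[OF bounded_bilinear_L])
  note LB = bounded_linear_Blinfun_apply[OF bl]
  have Lc: "clinear_op (Blinfun (L b))" for b by (simp add: clinear_op_def LB L_scale_right)
  have LR: "Blinfun (L b) o\<^sub>L R = R o\<^sub>L Blinfun (L b)" for b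
    by (rule blinfun_eqI) (simp add: LB comm)
  have "norm (\<Sum>p\<leftarrow>xs. (\<lambda>Z p. t (fst p) (blinfun_apply Z (snd p))) R p)
      \<le> norm R * norm (\<Sum>p\<leftarrow>xs. (\<lambda>Z p. t (fst p) (blinfun_apply Z (snd p))) id_blinfun p)"
  proof (rule operator_list_bound[OF F.hilbert_ip_axioms X.hilbert_ip_axioms R, where I = UNIV])
    fix Z Z' i j
    assume Z: "\<And>x y. ipF (blinfun_apply Z x) y = ipF x (blinfun_apply Z y)"
      and Y: "\<And>Y. clinear_op Y \<Longrightarrow> Y o\<^sub>L R = R o\<^sub>L Y \<Longrightarrow> Y o\<^sub>L Z = Z o\<^sub>L Y"
    have "Z (L b \<eta>) = L b (Z \<eta>)" for b \<eta>
      using arg_cong[OF Y[OF Lc LR], of "\<lambda>T. blinfun_apply T \<eta>" b] by (simp add: LB)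
    then show "ipX (t (fst i) (blinfun_apply Z (snd i))) (t (fst j) (blinfun_apply Z' (snd j))) =
        ipX (t (fst i) (blinfun_apply id_blinfun (snd i))) (t (fst j) (blinfun_apply (Z o\<^sub>L Z') (snd j)))"
      by (simp add: ip_t Z)
  qed (simp_all add: blinfun.add_left blinfun.scaleR_left t_add_right
        bounded_bilinear.scaleR_right[OF bounded_bilinear_t])
  then show ?thesis by simp
qed

lemma extension:
  assumes scale: "\<And>c \<xi> \<eta>. h (c *\<^sub>C \<xi>) \<eta> = c *\<^sub>C h \<xi> \<eta>" and K: "0 \<le> K"
    and bound: "\<And>xs. norm (\<Sum>p\<leftarrow>xs. h (fst p) (snd p)) \<le> K * norm (\<Sum>p\<leftarrow>xs. t (fst p) (snd p))"
  shows "\<exists>Y. clinear_op Y \<and> (\<forall>\<xi> \<eta>. blinfun_apply Y (t \<xi> \<eta>) = h \<xi> \<eta>) \<and> norm Y \<le> K"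
proof -
  have "\<exists>L. clinear_op L \<and>
      (\<forall>i\<in>UNIV. blinfun_apply L ((\<lambda>p. t (fst p) (snd p)) i) = (\<lambda>p. h (fst p) (snd p)) i) \<and>
      (\<forall>x. norm (L x) \<le> K * norm x)"
  proof (rule bounded_extension)
    fix p :: "'e \<times> 'f" and c
    show "\<exists>q\<in>UNIV. t (fst q) (snd q) = c *\<^sub>C t (fst p) (snd p) \<and> h (fst q) (snd q) = c *\<^sub>C h (fst p) (snd p)"
      by (rule bexI[of _ "(c *\<^sub>C fst p, snd p)"]) (simp_all add: scale t_scale_left)
    have "t \<xi> \<eta> \<in> range (\<lambda>p. t (fst p) (snd p))" for \<xi> \<eta>
      by (rule image_eqI[of _ _ "(\<xi>, \<eta>)"]) auto
    then have "range (\<lambda>p. t (fst p) (snd p)) = {t \<xi> \<eta> | \<xi> \<eta>. True}" by auto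
    then show "\<lbrakk>range (\<lambda>p. t (fst p) (snd p))\<rbrakk> = UNIV" by (simp only: dense)
  qed (use K bound in auto)
  then obtain Y where Y: "clinear_op Y" "\<And>\<xi> \<eta>. blinfun_apply Y (t \<xi> \<eta>) = h \<xi> \<eta>"
      "\<And>x. norm (Y x) \<le> K * norm x"
    by auto
  then show ?thesis using K by (intro exI[of _ Y]) (auto intro: norm_blinfun_bound)
qed

text \<open>The inner square of a sum of values of \<open>h\<close> is the pairing of the sum of
  tensors with its image under \<open>P \<otimes> 1\<close>, so \<open>ip_bound\<close> and
  \<open>left_factor_bound\<close> give the bound with \<open>2 = sqrt 4\<close>. In the
  applications \<open>P\<close> is an adjoint times an operator, or left multiplication by
  \<open>ip E \<xi> \<xi>\<close>.\<close>

lemma positive_extension: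
  assumes Y: "hilbert_ip ipY"
    and P: "clinear_op P" "\<And>x y. ipE (blinfun_apply P x) y = ipE x (blinfun_apply P y)"
    and scale: "\<And>c \<xi> \<eta>. h (c *\<^sub>C \<xi>) \<eta> = c *\<^sub>C h \<xi> \<eta>"
    and ip: "\<And>\<xi> \<eta> \<xi>' \<eta>'. ipY (h \<xi> \<eta>) (h \<xi>' \<eta>') = ipX (t \<xi> \<eta>) (t (P \<xi>') \<eta>')"
  shows "\<exists>Y. clinear_op Y \<and> (\<forall>\<xi> \<eta>. blinfun_apply Y (t \<xi> \<eta>) = h \<xi> \<eta>) \<and> norm Y \<le> 2 * sqrt (norm P)"
proof (rule extension[OF scale])
  interpret Y: hilbert_ip ipY by fact
  show "norm (\<Sum>p\<leftarrow>xs. h (fst p) (snd p)) \<le> 2 * sqrt (norm P) * norm (\<Sum>p\<leftarrow>xs. t (fst p) (snd p))" for xs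
  proof (rule power2_le_imp_le)
    let ?z = "\<Sum>p\<leftarrow>xs. t (fst p) (snd p)" and ?w = "\<Sum>p\<leftarrow>xs. t (P (fst p)) (snd p)"
    have "ipX ?z ?w = ipY (\<Sum>p\<leftarrow>xs. h (fst p) (snd p)) (\<Sum>p\<leftarrow>xs. h (fst p) (snd p))"
      by (rule ip_sum_list_pairing[OF X.hilbert_ip_axioms Y, where R = "(=)"]) (simp_all add: ip)
    then have "(norm (\<Sum>p\<leftarrow>xs. h (fst p) (snd p)))\<^sup>2 = norm (ipX ?z ?w)" by (simp add: Y.ip_norm)
    also have "\<dots> \<le> 4 * norm ?z * norm ?w" by (rule X.ip_bound)
    also have "\<dots> \<le> 4 * norm ?z * (norm P * norm ?z)"
      by (intro mult_left_mono left_factor_bound P) auto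
    also have "\<dots> = (2 * sqrt (norm P) * norm ?z)\<^sup>2"
      by (simp add: power_mult_distrib power2_eq_square[of "norm ?z"])
    finally show "(norm (\<Sum>p\<leftarrow>xs. h (fst p) (snd p)))\<^sup>2 \<le> (2 * sqrt (norm P) * norm ?z)\<^sup>2" .
  qed simp
qed simp

end

section \<open>Tensor products of bimodules and of homogeneous operators\<close>

locale bimod_tensor = E: bimod E + F: bimod F + X: bimod X
  for E :: "('b::cstar_algebra, 'e::complex_banach) bimodule"
    and F :: "('b, 'f::complex_banach) bimodule"
    and X :: "('b, 'x::complex_banach) bimodule" +
  fixes t :: "'e \<Rightarrow> 'f \<Rightarrow> 'x"
  assumes bimodule_tensor: "bimodule_tensor E F X t"
begin

sublocale T: tensor "ip E" "ip F" "ip X" "lact F" t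
  by (intro tensor.intro tensor_axioms.intro E.hilbert_ip_axioms F.hilbert_ip_axioms X.hilbert_ip_axioms
      F.bounded_bilinear_lact F.lact_scale_left F.lact_scale_right)
     (use bimodule_tensor in \<open>simp add: bimodule_tensor_def\<close>)

sublocale EE: bimod_pair E E by unfold_locales
sublocale FF: bimod_pair F F by unfold_locales

lemma t_ract: "t (ract E \<xi> b) \<eta> = t \<xi> (lact F b \<eta>)"
  by (rule T.t_eqI_left) (simp add: T.ip_t E.ip_ract F.lact_mult)

text \<open>\<open>\<kappa>\<close> and \<open>\<rho>\<close>, the right index of \<open>c\<close>
  and the left index of \<open>d\<close>, meet at the middle of the tensor product. Both
  \<open>d\<close> and \<open>d'\<close> have to intertwine left actions, whence the two memberships
  in \<open>hom_ops\<close>; the bundle is stable under passing to adjoints.\<close>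

definition tensorable where
  "tensorable \<kappa> c c' \<rho> \<sigma> d d' \<longleftrightarrow> \<kappa> \<in> PAut \<and> \<rho> \<in> PAut \<and> \<sigma> \<in> PAut \<and> compatible \<kappa> \<rho> \<and>
     hom_adjoint \<kappa> E E (blinfun_apply c) (blinfun_apply c') \<and>
     d \<in> hom_ops F F \<rho> \<sigma> \<and> d' \<in> hom_ops F F (pinv \<rho>) (pinv \<sigma>) \<and>
     hom_adjoint \<sigma> F F (blinfun_apply d) (blinfun_apply d')"

lemma tensorable_adjoint:
  "tensorable \<kappa> c c' \<rho> \<sigma> d d' \<Longrightarrow> tensorable (pinv \<kappa>) c' c (pinv \<rho>) (pinv \<sigma>) d' d"
  by (simp add: tensorable_def pinv_PAut compatible_pinv EE.hom_adjoint_sym FF.hom_adjoint_sym pinv_pinv)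

text \<open>The inner product on the left is \<open>ip F (d' \<eta>)\<close> of
  \<open>ip E (c' \<xi>) \<xi>'\<close> acting on \<open>\<eta>'\<close>. Applying
  \<open>\<sigma>\<close> moves \<open>d\<close> to the right, and compatibility lets
  \<open>d\<close> pass the coefficient, turning it into its image
  \<open>ip E \<xi> (c \<xi>')\<close> under \<open>\<kappa>\<close>.\<close>

lemma tensorable_pairing:
  assumes "tensorable \<kappa> c c' \<rho> \<sigma> d d'"
  shows "\<sigma> (ip X (t (c' \<xi>) (d' \<eta>)) (t \<xi>' \<eta>')) = Some (ip X (t \<xi> \<eta>) (t (c \<xi>') (d \<eta>')))"
proof -
  note a = assms[unfolded tensorable_def]
  have "d (lact F (ip E (c' \<xi>) \<xi>') \<eta>') = lact F (ip E \<xi> (c \<xi>')) (d \<eta>')"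
    by (rule FF.hom_ops_compatible[of \<kappa> \<rho> _ \<sigma>]) (use a in \<open>auto simp: hom_adjoint_def\<close>)
  then show ?thesis
    using hom_adjointD[of \<sigma> F F d d' \<eta> "lact F (ip E (c' \<xi>) \<xi>') \<eta>'"] a by (simp add: T.ip_t)
qed

text \<open>\<open>d'd\<close> commutes with all of \<open>B\<close>, although \<open>d\<close> itself twists the left action by \<open>\<rho>\<close>.\<close>

lemma adjoint_compose_lact:
  assumes "\<rho> \<in> PAut" "d \<in> hom_ops F F \<rho> \<sigma>" "d' \<in> hom_ops F F (pinv \<rho>) (pinv \<sigma>)"
  shows "d' (d (lact F b \<eta>)) = lact F b (d' (d \<eta>))"
proof (rule F.lact_separates[of "dom \<rho>"])
  have 1: "d' x \<in> \<lbrakk>{lact F b \<eta> | b \<eta>. b \<in> dom \<rho>}\<rbrakk>" for x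
    using assms(1,3) by (auto simp: hom_ops_def ran_pinv)
  show "d' (d (lact F b \<eta>)) \<in> \<lbrakk>{lact F b \<eta> | b \<eta>. b \<in> dom \<rho>}\<rbrakk>" by (rule 1)
  show "lact F b (d' (d \<eta>)) \<in> \<lbrakk>{lact F b \<eta> | b \<eta>. b \<in> dom \<rho>}\<rbrakk>"
    by (rule F.lact_closed_span_ideal[OF _ 1]) (use closed_idealD[OF PAut_ideal(1)[OF assms(1)]] in blast)
  have 2: "d' (d (lact F x \<xi>)) = lact F x (d' (d \<xi>))" if "x \<in> dom \<rho>" for x \<xi>
  proof -
    obtain x' where x: "\<rho> x = Some x'" using \<open>x \<in> dom \<rho>\<close> by blast
    then have "pinv \<rho> x' = Some x" by (simp add: pinv_eq_Some_iff assms(1))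
    then show ?thesis using assms(2,3) x by (simp add: hom_ops_def)
  qed
  show "lact F w (d' (d (lact F b \<eta>))) = lact F w (lact F b (d' (d \<eta>)))" if "w \<in> dom \<rho>" for w
  proof -
    have "w * b \<in> dom \<rho>" by (rule closed_idealD(3)[OF PAut_ideal(1)[OF assms(1)] that])
    then show ?thesis using 2[OF that, of "lact F b \<eta>"] 2[of "w * b" \<eta>] by (simp add: F.lact_mult)
  qed
qed (rule PAut_dom_star[OF assms(1)])

text \<open>By \<open>tensorable_pairing\<close>, \<open>\<sigma>\<close> maps the pairing of the
  sum with \<open>P\<close> and \<open>R\<close> inserted against the original sum to the inner
  square of the image. As \<open>\<sigma>\<close> is isometric, the two factor bounds apply. The 8
  is the square root of 64: 4 from \<open>ip_bound\<close> and 4 for each of the adjoints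
  \<open>c'\<close> and \<open>d'\<close>.\<close>

lemma tensor_op_exists:
  assumes "tensorable \<kappa> c c' \<rho> \<sigma> d d'"
  shows "\<exists>Y. clinear_op Y \<and> (\<forall>\<xi> \<eta>. blinfun_apply Y (t \<xi> \<eta>) = t (c \<xi>) (d \<eta>)) \<and> norm Y \<le> 8 * norm c * norm d"
proof (rule T.extension)
  note a = assms[unfolded tensorable_def]
  have c: "clinear_op c" "norm c' \<le> 4 * norm c"
    using EE.hom_adjoint_clinear[of \<kappa> c] EE.hom_adjoint_blinfun[of \<kappa> c c'] a
    by (auto simp: blinfun_apply_inject)
  have d: "clinear_op d" "norm d' \<le> 4 * norm d"
    using FF.hom_adjoint_clinear[of \<sigma> d] FF.hom_adjoint_blinfun[of \<sigma> d d'] a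
    by (auto simp: blinfun_apply_inject)
  show "t (c (k *\<^sub>C \<xi>)) (d \<eta>) = k *\<^sub>C t (c \<xi>) (d \<eta>)" for k \<xi> \<eta>
    by (simp add: clinear_opD[OF c(1)] T.t_scale_left)
  define P where "P = c' o\<^sub>L c"
  define R where "R = d' o\<^sub>L d"
  have c': "clinear_op c'"
    using EE.hom_adjoint_clinear[OF pinv_PAut EE.hom_adjoint_sym] a by blast
  have d': "clinear_op d'"
    using FF.hom_adjoint_clinear[OF pinv_PAut FF.hom_adjoint_sym] a by blast
  have P: "clinear_op P" "ip E (P x) y = ip E x (P y)" for x y
  proof -
    show "clinear_op P" by (simp add: P_def clinear_op_compose c c')
    show "ip E (P x) y = ip E x (P y)"
      using PAut_inj[of \<kappa>] hom_adjointD[of \<kappa> E E c c' "c x" y] EE.hom_adjointD'[of \<kappa> c c' x "c y"] a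
      by (simp add: P_def)
  qed
  have R: "clinear_op R" "ip F (R x) y = ip F x (R y)" for x y
  proof -
    show "clinear_op R" by (simp add: R_def clinear_op_compose d d')
    show "ip F (R x) y = ip F x (R y)"
      using PAut_inj[of \<sigma>] hom_adjointD[of \<sigma> F F d d' "d x" y] FF.hom_adjointD'[of \<sigma> d d' x "d y"] a
      by (simp add: R_def)
  qed
  have R_comm: "R (lact F b \<eta>) = lact F b (R \<eta>)" for b \<eta>
    using adjoint_compose_lact[of \<rho> d \<sigma> d'] a by (simp add: R_def)
  have norm_P: "norm P \<le> 4 * norm c * norm c"
    unfolding P_def using c(2) by (intro order_trans[OF norm_blinfun_compose] mult_right_mono) auto
  have norm_R: "norm R \<le> 4 * norm d * norm d"
    unfolding R_def using d(2) by (intro order_trans[OF norm_blinfun_compose] mult_right_mono) auto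
  show "norm (\<Sum>p\<leftarrow>xs. t (c (fst p)) (d (snd p))) \<le> 8 * norm c * norm d * norm (\<Sum>p\<leftarrow>xs. t (fst p) (snd p))"
    for xs
  proof (rule power2_le_imp_le)
    let ?z = "\<Sum>p\<leftarrow>xs. t (fst p) (snd p)" and ?w = "\<Sum>p\<leftarrow>xs. t (P (fst p)) (R (snd p))"
    let ?y = "\<Sum>p\<leftarrow>xs. t (c (fst p)) (d (snd p))"
    have \<sigma>: "\<sigma> \<in> PAut" using a by blast
    have "\<sigma> (ip X ?w ?z) = Some (ip X ?y ?y)"
      by (rule ip_sum_list_pairing[OF X.hilbert_ip_axioms X.hilbert_ip_axioms, where R = "\<lambda>a b. \<sigma> a = Some b"])
         (simp_all add: PAut_zero PAut_add \<sigma> P_def R_def tensorable_pairing[OF assms])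
    then have "(norm ?y)\<^sup>2 = norm (ip X ?w ?z)"
      using PAut_norm[OF \<sigma>] by (simp add: X.ip_norm)
    also have "\<dots> \<le> 4 * norm ?w * norm ?z" by (rule X.ip_bound)
    also have "\<dots> \<le> 4 * (norm P * (norm R * norm ?z)) * norm ?z"
    proof -
      have "norm ?w \<le> norm P * norm (\<Sum>p\<leftarrow>xs. t (fst p) (R (snd p)))"
        using T.left_factor_bound[OF P, of "map (\<lambda>p. (fst p, R (snd p))) xs"] by (simp add: o_def)
      also have "\<dots> \<le> norm P * (norm R * norm ?z)"
        by (intro mult_left_mono T.right_factor_bound R R_comm) auto
      finally show ?thesis by (intro mult_right_mono) auto
    qed
    also have "\<dots> \<le> 4 * ((4 * norm c * norm c) * ((4 * norm d * norm d) * norm ?z)) * norm ?z"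
      by (intro mult_right_mono mult_left_mono mult_mono norm_P norm_R) auto
    also have "\<dots> = (8 * norm c * norm d * norm ?z)\<^sup>2" by (simp add: power2_eq_square)
    finally show "(norm ?y)\<^sup>2 \<le> (8 * norm c * norm d * norm ?z)\<^sup>2" .
  qed simp
qed simp

lemma tensor_op_tensorable:
  assumes "tensorable \<kappa> c c' \<rho> \<sigma> d d'"
  shows "tensor_op t t c d (t \<xi> \<eta>) = t (c \<xi>) (d \<eta>)" "clinear_op (tensor_op t t c d)"
    "norm (tensor_op t t c d) \<le> 8 * norm c * norm d"
proof -
  obtain Y where Y: "clinear_op Y" "\<And>\<xi> \<eta>. blinfun_apply Y (t \<xi> \<eta>) = t (c \<xi>) (d \<eta>)" "norm Y \<le> 8 * norm c * norm d"
    using tensor_op_exists[OF assms] by blast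
  have "tensor_op t t c d = Y" by (rule T.tensor_op_eqI[OF Y(2)])
  then show "tensor_op t t c d (t \<xi> \<eta>) = t (c \<xi>) (d \<eta>)" "clinear_op (tensor_op t t c d)"
    "norm (tensor_op t t c d) \<le> 8 * norm c * norm d"
    using Y by simp_all
qed

text \<open>The relation on elementary tensors is extended one argument at a time by
  \<open>PAut_closed_span\<close>; for the conjugate-linear argument stars are taken first.\<close>

lemma tensor_op_adjoint:
  assumes "tensorable \<kappa> c c' \<rho> \<sigma> d d'"
  shows "hom_adjoint \<sigma> X X (tensor_op t t c d) (tensor_op t t c' d')"
  unfolding hom_adjoint_def
proof (intro allI)
  fix x y
  let ?Y = "tensor_op t t c d" and ?Y' = "tensor_op t t c' d'"
  have \<sigma>: "\<sigma> \<in> PAut" using assms by (simp add: tensorable_def)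
  note Y = tensor_op_tensorable[OF assms] tensor_op_tensorable[OF tensorable_adjoint[OF assms]]
  have 1: "\<sigma> (ip X (?Y' (t \<xi> \<eta>)) y) = Some (ip X (t \<xi> \<eta>) (?Y y))" for \<xi> \<eta> y
  proof (rule PAut_closed_span[OF \<sigma>, where f = "\<lambda>y. ip X (?Y' (t \<xi> \<eta>)) y"
        and g = "\<lambda>y. ip X (t \<xi> \<eta>) (?Y y)" and S = "{t \<xi> \<eta> | \<xi> \<eta>. True}"])
    show "bounded_linear (\<lambda>y. ip X (t \<xi> \<eta>) (?Y y))"
      by (rule bounded_linear_compose[OF X.bounded_linear_ip_right blinfun.bounded_linear_right])
  qed (auto simp: X.bounded_linear_ip_right X.ip_scale_right clinear_opD[OF Y(2)] Y
        tensorable_pairing[OF assms] T.dense[simplified])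
  have "\<sigma> (ip X y (?Y' x)) = Some (ip X (?Y y) x)" for y x
  proof (rule PAut_closed_span[OF \<sigma>, where f = "\<lambda>x. ip X y (?Y' x)"
        and g = "\<lambda>x. ip X (?Y y) x" and S = "{t \<xi> \<eta> | \<xi> \<eta>. True}"])
    show "bounded_linear (\<lambda>x. ip X y (?Y' x))"
      by (rule bounded_linear_compose[OF X.bounded_linear_ip_right blinfun.bounded_linear_right])
    fix s assume "s \<in> {t \<xi> \<eta> | \<xi> \<eta>. True}"
    then obtain \<xi> \<eta> where s: "s = t \<xi> \<eta>" by blast
    show "\<sigma> (ip X y (?Y' s)) = Some (ip X (?Y y) s)"
      using PAut_star[OF \<sigma> 1[of \<xi> \<eta> y]] by (simp add: s X.ip_star)
  qed (auto simp: X.bounded_linear_ip_right X.ip_scale_right clinear_opD[OF Y(5)] T.dense[simplified])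
  from PAut_star[OF \<sigma> this[of x y]]
  show "\<sigma> (ip X (?Y' y) x) = Some (ip X y (?Y x))" by (simp add: X.ip_star)
qed

end

section \<open>Covariant representations\<close>

locale covariant =
  fixes \<Theta> :: "('b::cstar_algebra \<rightharpoonup> 'b) set"
    and \<pi> :: "'b \<Rightarrow> 'k::chilbert_space \<Rightarrow>\<^sub>L 'k"
    and \<upsilon> :: "('b \<rightharpoonup> 'b) \<Rightarrow> 'k \<Rightarrow>\<^sub>L 'k"
  assumes admissible_semigroup: "admissible_semigroup \<Theta>"
    and covariant_rep: "covariant_rep \<Theta> \<pi> \<upsilon>"
begin

lemma Theta_PAut: "\<theta> \<in> \<Theta> \<Longrightarrow> \<theta> \<in> PAut"
  and Theta_pinv: "\<theta> \<in> \<Theta> \<Longrightarrow> pinv \<theta> \<in> \<Theta>"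
  and Theta_comp: "\<theta> \<in> \<Theta> \<Longrightarrow> \<theta>' \<in> \<Theta> \<Longrightarrow> \<theta> \<circ>\<^sub>m \<theta>' \<in> \<Theta>"
  and Theta_pid: "pid \<in> \<Theta>"
  using admissible_semigroup by (auto simp: admissible_semigroup_def inverse_subsemigroup_def)

lemma clinear_pi: "clinear_op (\<pi> b)"
  and pi_add: "\<pi> (a + b) = \<pi> a + \<pi> b"
  and pi_scale: "\<pi> (c *\<^sub>C b) = c *\<^sub>C \<pi> b"
  and pi_mult: "\<pi> (a * b) = \<pi> a o\<^sub>L \<pi> b"
  and pi_star: "\<pi> (star b) = adj (\<pi> b)"
  and clinear_upsilon: "\<theta> \<in> \<Theta> \<Longrightarrow> clinear_op (\<upsilon> \<theta>)"
  and upsilon_comp: "\<theta> \<in> \<Theta> \<Longrightarrow> \<theta>' \<in> \<Theta> \<Longrightarrow> \<upsilon> \<theta> o\<^sub>L \<upsilon> \<theta>' = \<upsilon> (\<theta> \<circ>\<^sub>m \<theta>')"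
  and upsilon_adj: "\<theta> \<in> \<Theta> \<Longrightarrow> adj (\<upsilon> \<theta>) = \<upsilon> (pinv \<theta>)"
  and upsilon_range: "\<theta> \<in> \<Theta> \<Longrightarrow> range (\<upsilon> \<theta>) = \<lbrakk>{\<pi> b \<zeta> | b \<zeta>. b \<in> ran \<theta>}\<rbrakk>"
  and covariance: "\<theta> \<in> \<Theta> \<Longrightarrow> \<theta> b = Some b' \<Longrightarrow> \<upsilon> \<theta> o\<^sub>L \<pi> b o\<^sub>L adj (\<upsilon> \<theta>) = \<pi> b'"
  using covariant_rep by (auto simp: covariant_rep_def)

lemma cinner_pi: "cinner (\<pi> (star b) x) y = cinner x (\<pi> b y)"
  by (simp add: pi_star cinner_adj_left clinear_pi)

lemma cinner_upsilon: "\<theta> \<in> \<Theta> \<Longrightarrow> cinner (\<upsilon> (pinv \<theta>) x) y = cinner x (\<upsilon> \<theta> y)"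
  by (simp add: upsilon_adj[symmetric] cinner_adj_left clinear_upsilon)

lemma upsilon_upsilon: "\<theta> \<in> \<Theta> \<Longrightarrow> \<theta>' \<in> \<Theta> \<Longrightarrow> \<upsilon> \<theta> (\<upsilon> \<theta>' k) = \<upsilon> (\<theta> \<circ>\<^sub>m \<theta>') k"
  using upsilon_comp[of \<theta> \<theta>'] by (metis blinfun_apply_blinfun_compose)

lemma cinner_upsilon_upsilon:
  assumes "\<theta> \<in> \<Theta>" shows "cinner (\<upsilon> \<theta> x) (\<upsilon> \<theta> y) = cinner x (\<upsilon> (pinv \<theta> \<circ>\<^sub>m \<theta>) y)"
  using cinner_upsilon[OF Theta_pinv[OF assms], of x "\<upsilon> \<theta> y"] assms
  by (simp add: pinv_pinv Theta_PAut upsilon_upsilon Theta_pinv)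

lemma bounded_bilinear_pi: "bounded_bilinear (\<lambda>b. blinfun_apply (\<pi> b))"
proof
  have "norm (\<pi> b k) \<le> 2 * norm b * norm k" for b k
    by (rule cinner.star_rep_norm_le)
       (simp_all add: pi_add pi_scale pi_mult blinfun.add_left blinfun_apply_scaleC cinner_pi)
  then show "\<exists>K. \<forall>a b. norm (\<pi> a b) \<le> norm a * norm b * K"
    by (intro exI[of _ 2]) (simp add: mult_ac)
qed (simp_all add: pi_add blinfun.add_left blinfun.add_right scaleR_scaleC pi_scale blinfun_apply_scaleC
      clinear_opD[OF clinear_pi])

text \<open>\<open>\<theta> \<circ>\<^sub>m pinv \<theta>\<close> is the identity on
  \<open>ran \<theta>\<close>, so its image under \<open>\<upsilon>\<close> is a self-adjoint
  idempotent whose range is the closed span of \<open>\<pi>(ran \<theta>)\<close> applied to the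
  Hilbert space.\<close>

lemma upsilon_projection:
  assumes \<theta>: "\<theta> \<in> \<Theta>" and b: "b \<in> ran \<theta>"
  shows "\<upsilon> (\<theta> \<circ>\<^sub>m pinv \<theta>) (\<pi> b k) = \<pi> b k" "\<pi> b (\<upsilon> (\<theta> \<circ>\<^sub>m pinv \<theta>) k) = \<pi> b k"
proof -
  let ?e = "\<theta> \<circ>\<^sub>m pinv \<theta>"
  note P = Theta_PAut[OF \<theta>]
  have e: "?e \<in> \<Theta>" by (intro Theta_comp \<theta> Theta_pinv)
  have e_iff: "?e x = Some y \<longleftrightarrow> x = y \<and> x \<in> ran \<theta>" for x y
    by (auto simp: map_comp_Some_iff pinv_eq_Some_iff[OF P] ran_def)
  have ran: "ran ?e = ran \<theta>" using e_iff by (auto simp: ran_def[of ?e])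
  have ee: "?e \<circ>\<^sub>m ?e = ?e"
  proof
    have "(?e \<circ>\<^sub>m ?e) x = Some y \<longleftrightarrow> ?e x = Some y" for x y
      unfolding map_comp_Some_iff[of ?e ?e] e_iff by blast
    then show "(?e \<circ>\<^sub>m ?e) x = ?e x" for x by (metis not_Some_eq)
  qed
  have pe: "pinv ?e = ?e"
  proof
    have "?e \<in> PAut" by (rule Theta_PAut[OF e])
    then have "pinv ?e x = Some y \<longleftrightarrow> ?e x = Some y" for x y
      by (auto simp: pinv_eq_Some_iff e_iff)
    then show "pinv ?e x = ?e x" for x by (metis not_Some_eq)
  qed
  have "\<upsilon> ?e z = z" if "z \<in> range (\<upsilon> ?e)" for z
    using that upsilon_upsilon[OF e e] by (auto simp: ee)
  moreover have "\<pi> b k \<in> range (\<upsilon> ?e)" if "b \<in> ran \<theta>" for b k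
    unfolding upsilon_range[OF e] ran using that by (intro closed_span_base) blast
  ultimately have 1: "\<upsilon> ?e (\<pi> b k) = \<pi> b k" if "b \<in> ran \<theta>" for b k using that by blast
  show "\<upsilon> ?e (\<pi> b k) = \<pi> b k" by (rule 1[OF b])
  show "\<pi> b (\<upsilon> ?e k) = \<pi> b k"
  proof (rule cinner.ip_eqI)
    fix z
    have "cinner z (\<pi> b (\<upsilon> ?e k)) = cinner (\<pi> (star b) z) (\<upsilon> ?e k)" by (simp add: cinner_pi)
    also have "\<dots> = cinner (\<upsilon> ?e (\<pi> (star b) z)) k" using cinner_upsilon[OF e] by (simp add: pe)
    also have "\<dots> = cinner z (\<pi> b k)" by (simp add: 1[OF PAut_ran_star[OF P b]] cinner_pi)
    finally show "cinner z (\<pi> b (\<upsilon> ?e k)) = cinner z (\<pi> b k)" .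
  qed
qed

lemma upsilon_projection_dom:
  assumes \<theta>: "\<theta> \<in> \<Theta>" and b: "b \<in> dom \<theta>"
  shows "\<upsilon> (pinv \<theta> \<circ>\<^sub>m \<theta>) (\<pi> b k) = \<pi> b k" "\<pi> b (\<upsilon> (pinv \<theta> \<circ>\<^sub>m \<theta>) k) = \<pi> b k"
  using upsilon_projection[OF Theta_pinv[OF \<theta>]] b
  by (simp_all add: pinv_pinv Theta_PAut[OF \<theta>] ran_pinv)

text \<open>Covariance is stated with the adjoint of \<open>\<upsilon> \<theta>\<close> on the
  right; multiplying by \<open>\<upsilon> \<theta>\<close> produces a projection that
  \<open>\<pi> b\<close> absorbs.\<close>

lemma pi_upsilon:
  assumes \<theta>: "\<theta> \<in> \<Theta>" and b: "\<theta> b = Some b'"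
  shows "\<pi> b' (\<upsilon> \<theta> k) = \<upsilon> \<theta> (\<pi> b k)"
proof -
  have "\<pi> b' (\<upsilon> \<theta> k) = \<upsilon> \<theta> (\<pi> b (\<upsilon> (pinv \<theta>) (\<upsilon> \<theta> k)))"
    using covariance[OF \<theta> b] upsilon_adj[OF \<theta>] by (metis blinfun_apply_blinfun_compose)
  then show ?thesis
    using upsilon_projection_dom(2)[OF \<theta> domI[of \<theta>, OF b]] by (simp add: upsilon_upsilon \<theta> Theta_pinv)
qed

lemma cinner_upsilon_pi:
  assumes \<theta>: "\<theta> \<in> \<Theta>" and b: "\<theta> b = Some b'"
  shows "cinner (\<upsilon> \<theta> k) (\<pi> b' (\<upsilon> \<theta> k')) = cinner k (\<pi> b k')"
  using upsilon_projection_dom(1)[OF \<theta> domI[of \<theta>, OF b]]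
  by (simp add: pi_upsilon[OF \<theta> b] cinner_upsilon_upsilon[OF \<theta>])

text \<open>Restricting \<open>\<nu>\<close> to the range of \<open>\<mu>\<close> gives
  \<open>\<mu>\<close>, and \<open>\<pi> b\<close> absorbs the projection that effects the
  restriction.\<close>

lemma pi_upsilon_mono:
  assumes \<mu>: "\<mu> \<in> \<Theta>" and \<nu>: "\<nu> \<in> \<Theta>" and le: "\<mu> \<subseteq>\<^sub>m \<nu>" and b: "b \<in> ran \<mu>"
  shows "\<pi> b (\<upsilon> \<nu> k) = \<pi> b (\<upsilon> \<mu> k)"
proof -
  let ?e = "\<mu> \<circ>\<^sub>m pinv \<mu>"
  have e: "?e \<in> \<Theta>" by (intro Theta_comp \<mu> Theta_pinv)
  have e_iff: "?e x = Some y \<longleftrightarrow> x = y \<and> x \<in> ran \<mu>" for x y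
    by (auto simp: map_comp_Some_iff pinv_eq_Some_iff[OF Theta_PAut[OF \<mu>]] ran_def)
  have "(?e \<circ>\<^sub>m \<nu>) x = Some y \<longleftrightarrow> \<mu> x = Some y" for x y
  proof
    assume "(?e \<circ>\<^sub>m \<nu>) x = Some y"
    then have "\<nu> x = Some y" "y \<in> ran \<mu>" by (auto simp: map_comp_Some_iff[of ?e] e_iff)
    then obtain z where z: "\<mu> z = Some y" by (auto simp: ran_def)
    then have "\<nu> z = Some y" using le by (simp add: map_le_iff)
    then have "z = x" using \<open>\<nu> x = Some y\<close> by (rule PAut_inj[OF Theta_PAut[OF \<nu>]])
    then show "\<mu> x = Some y" using z by simp
  next
    assume x: "\<mu> x = Some y"
    then have "\<nu> x = Some y" using le by (simp add: map_le_iff)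
    then show "(?e \<circ>\<^sub>m \<nu>) x = Some y" using x by (auto simp: map_comp_Some_iff[of ?e] e_iff ran_def)
  qed
  then have \<nu>_eq: "?e \<circ>\<^sub>m \<nu> = \<mu>" by (metis not_Some_eq ext)
  have "\<pi> b (\<upsilon> \<nu> k) = \<pi> b (\<upsilon> ?e (\<upsilon> \<nu> k))" using upsilon_projection(2)[OF \<mu> b] by simp
  then show ?thesis by (simp add: upsilon_upsilon[OF e \<nu>] \<nu>_eq)
qed

text \<open>\<open>\<upsilon> pid\<close> projects onto the closed span of the vectors
  \<open>\<pi> b k\<close>, which may be a proper subspace; \<open>\<pi> b\<close> does not see the
  difference.\<close>

lemma pi_upsilon_pid: "\<pi> b (\<upsilon> pid k) = \<pi> b k"
  using upsilon_projection(2)[OF Theta_pid, of b] by (simp add: ran_def)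

end

lemma adj_eqI_span:
  assumes S: "\<lbrakk>S\<rbrakk> = UNIV" and S': "\<lbrakk>S'\<rbrakk> = UNIV" and A: "clinear_op A" and B: "clinear_op B"
    and ip: "\<And>s s'. s \<in> S \<Longrightarrow> s' \<in> S' \<Longrightarrow> cinner (blinfun_apply B s') s = cinner s' (blinfun_apply A s)"
  shows "adj A = B"
proof (rule adj_eqI)
  fix x y
  have 1: "cinner (B s') x = cinner s' (A x)" if "s' \<in> S'" for s' x
  proof (rule bounded_clinear_eqI_span[where S = S])
    show "bounded_linear (\<lambda>x. cinner s' (A x))"
      by (rule bounded_linear_compose[OF cinner.bounded_linear_ip_right blinfun.bounded_linear_right])
  qed (use S ip that in \<open>auto simp: cinner.bounded_linear_ip_right cinner.ip_scale_right clinear_opD[OF A]\<close>)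
  have "cinner x (B y) = cinner (A x) y"
  proof (rule bounded_clinear_eqI_span[where S = S'])
    show "bounded_linear (\<lambda>y. cinner x (B y))"
      by (rule bounded_linear_compose[OF cinner.bounded_linear_ip_right blinfun.bounded_linear_right])
    show "cinner x (B s) = cinner (A x) s" if "s \<in> S'" for s
      using 1[OF that, of x] cinner_commute by metis
  qed (use S' in \<open>auto simp: cinner.bounded_linear_ip_right cinner.ip_scale_right clinear_opD[OF B]\<close>)
  then show "cinner (B y) x = cinner y (A x)" using cinner_commute by metis
qed

locale induced = covariant \<Theta> \<pi> \<upsilon> + E: bimod E
  for \<Theta> :: "('b::cstar_algebra \<rightharpoonup> 'b) set" and \<pi> :: "'b \<Rightarrow> 'k::chilbert_space \<Rightarrow>\<^sub>L 'k" and \<upsilon>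
    and E :: "('b, 'e::complex_banach) bimodule" +
  fixes tE :: "'e \<Rightarrow> 'k \<Rightarrow> 'ie::chilbert_space"
  assumes induced_space: "induced_space E \<pi> tE"
begin

sublocale T: tensor "ip E" cinner cinner "\<lambda>b. blinfun_apply (\<pi> b)" tE
  by (intro tensor.intro tensor_axioms.intro E.hilbert_ip_axioms hilbert_ip_cinner bounded_bilinear_pi)
     (use induced_space in \<open>simp_all add: induced_space_def pi_scale blinfun_apply_scaleC clinear_opD[OF clinear_pi]\<close>)

text \<open>The inner square of \<open>tE x (k - k')\<close> contains \<open>k - k'\<close> only
  through \<open>\<pi> (ip E x x) (k - k')\<close>.\<close>

lemma t_eq_of_pi:
  assumes "\<pi> (ip E x x) k = \<pi> (ip E x x) k'" shows "tE x k = tE x k'"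
proof -
  have "tE x k - tE x k' = tE x (k - k')"
    by (simp add: bounded_bilinear.diff_right[OF T.bounded_bilinear_t])
  moreover have "cinner (tE x (k - k')) (tE x (k - k')) = 0"
    by (simp add: T.ip_t blinfun.diff_right assms)
  ultimately show ?thesis by simp
qed

lemma t_upsilon_mono:
  "\<mu> \<in> \<Theta> \<Longrightarrow> \<nu> \<in> \<Theta> \<Longrightarrow> \<mu> \<subseteq>\<^sub>m \<nu> \<Longrightarrow> ip E x x \<in> ran \<mu> \<Longrightarrow> tE x (\<upsilon> \<nu> k) = tE x (\<upsilon> \<mu> k)"
  by (intro t_eq_of_pi pi_upsilon_mono)

lemma t_upsilon_pid: "tE x (\<upsilon> pid k) = tE x k"
  by (intro t_eq_of_pi pi_upsilon_pid)

end

locale induced_pair = E: induced \<Theta> \<pi> \<upsilon> E tE + F: induced \<Theta> \<pi> \<upsilon> F tF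
  for \<Theta> :: "('b::cstar_algebra \<rightharpoonup> 'b) set" and \<pi> :: "'b \<Rightarrow> 'k::chilbert_space \<Rightarrow>\<^sub>L 'k" and \<upsilon>
    and E :: "('b, 'e::complex_banach) bimodule" and tE :: "'e \<Rightarrow> 'k \<Rightarrow> 'ie::chilbert_space"
    and F :: "('b, 'f::complex_banach) bimodule" and tF :: "'f \<Rightarrow> 'k \<Rightarrow> 'jf::chilbert_space"
begin

sublocale EF: bimod_pair E F by unfold_locales

text \<open>\<open>\<upsilon> \<sigma>\<close> turns \<open>\<pi>\<close> of
  \<open>ip E \<xi> (P \<xi>')\<close> into \<open>\<pi>\<close> of its image
  \<open>ip F (T \<xi>) (T \<xi>')\<close> under \<open>\<sigma>\<close>, so the Gram matrix is that
  of the source with \<open>P\<close> (adjoint times \<open>T\<close>) inserted. As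
  \<open>norm P \<le> 4 * norm T * norm T\<close>, the constant is \<open>2 * 2\<close>.\<close>

lemma induced_op:
  fixes T :: "'e \<Rightarrow>\<^sub>L 'f"
  assumes \<sigma>: "\<sigma> \<in> \<Theta>" and h: "hom_adjoint \<sigma> E F T S"
  shows "tensor_op tE tF T (\<upsilon> \<sigma>) (tE \<xi> k) = tF (T \<xi>) (\<upsilon> \<sigma> k)"
    "clinear_op (tensor_op tE tF T (\<upsilon> \<sigma>))" "norm (tensor_op tE tF T (\<upsilon> \<sigma>)) \<le> 4 * norm T"
proof -
  note P\<sigma> = E.Theta_PAut[OF \<sigma>]
  obtain S' where S': "S = blinfun_apply S'" "clinear_op S'" "norm S' \<le> 4 * norm T"
    using EF.hom_adjoint_blinfun[OF P\<sigma> h] by blast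
  have T: "clinear_op T" by (rule EF.hom_adjoint_clinear[OF P\<sigma> h])
  define P where "P = S' o\<^sub>L T"
  have P: "clinear_op P" by (simp add: P_def clinear_op_compose S' T)
  have P_sa: "ip E (P x) y = ip E x (P y)" for x y
    using PAut_inj[OF P\<sigma>] hom_adjointD[OF h, of "T x" y] EF.hom_adjointD'[OF P\<sigma> h, of x "T y"]
    by (simp add: P_def S')
  have "\<exists>Y. clinear_op Y \<and> (\<forall>\<xi> k. blinfun_apply Y (tE \<xi> k) = tF (T \<xi>) (\<upsilon> \<sigma> k)) \<and> norm Y \<le> 2 * sqrt (norm P)"
  proof (rule E.T.positive_extension[OF hilbert_ip_cinner P P_sa])
    show "tF (T (c *\<^sub>C \<xi>)) (\<upsilon> \<sigma> k) = c *\<^sub>C tF (T \<xi>) (\<upsilon> \<sigma> k)" for c \<xi> k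
      by (simp add: clinear_opD[OF T] F.T.t_scale_left)
    show "cinner (tF (T \<xi>) (\<upsilon> \<sigma> k)) (tF (T \<xi>') (\<upsilon> \<sigma> k')) = cinner (tE \<xi> k) (tE (P \<xi>') k')" for \<xi> k \<xi>' k'
      using E.cinner_upsilon_pi[OF \<sigma> EF.hom_adjointD'[OF P\<sigma> h, of \<xi> "T \<xi>'"]]
      by (simp add: F.T.ip_t E.T.ip_t P_def S')
  qed
  then obtain Y where Y: "clinear_op Y" "\<And>\<xi> k. blinfun_apply Y (tE \<xi> k) = tF (T \<xi>) (\<upsilon> \<sigma> k)"
    "norm Y \<le> 2 * sqrt (norm P)" by blast
  have "norm P \<le> 4 * norm T * norm T"
    unfolding P_def using S'(3) by (intro order_trans[OF norm_blinfun_compose] mult_right_mono) auto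
  then have "sqrt (norm P) \<le> 2 * norm T"
    by (intro real_le_lsqrt) (simp_all add: power2_eq_square)
  then have "norm Y \<le> 4 * norm T" using Y(3) by simp
  moreover have "tensor_op tE tF T (\<upsilon> \<sigma>) = Y" by (rule E.T.tensor_op_eqI[OF Y(2)])
  ultimately show "tensor_op tE tF T (\<upsilon> \<sigma>) (tE \<xi> k) = tF (T \<xi>) (\<upsilon> \<sigma> k)"
    "clinear_op (tensor_op tE tF T (\<upsilon> \<sigma>))" "norm (tensor_op tE tF T (\<upsilon> \<sigma>)) \<le> 4 * norm T"
    using Y by simp_all
qed

lemma adj_induced_op:
  fixes T :: "'e \<Rightarrow>\<^sub>L 'f" and S :: "'f \<Rightarrow>\<^sub>L 'e"
  assumes \<sigma>: "\<sigma> \<in> \<Theta>" and h: "hom_adjoint \<sigma> E F T S"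
  shows "adj (tensor_op tE tF T (\<upsilon> \<sigma>)) = tensor_op tF tE S (\<upsilon> (pinv \<sigma>))"
proof -
  interpret FE: induced_pair \<Theta> \<pi> \<upsilon> F tF E tE by unfold_locales
  note P\<sigma> = E.Theta_PAut[OF \<sigma>]
  have h': "hom_adjoint (pinv \<sigma>) F E S T" by (rule EF.hom_adjoint_sym[OF P\<sigma> h])
  note I = induced_op[OF \<sigma> h] FE.induced_op[OF E.Theta_pinv[OF \<sigma>] h']
  show ?thesis
  proof (rule adj_eqI_span[OF E.T.dense F.T.dense I(2,5)])
    fix s s' assume "s \<in> {tE \<xi> k | \<xi> k. True}" "s' \<in> {tF \<xi> k | \<xi> k. True}"
    then obtain \<xi> k \<eta> l where s: "s = tE \<xi> k" "s' = tF \<eta> l" by blast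
    have a: "\<sigma> (ip E (S \<eta>) \<xi>) = Some (ip F \<eta> (T \<xi>))" by (rule hom_adjointD[OF h])
    have "cinner (tF \<eta> l) (tF (T \<xi>) (\<upsilon> \<sigma> k)) = cinner l (\<upsilon> \<sigma> (\<pi> (ip E (S \<eta>) \<xi>) k))"
      by (simp add: F.T.ip_t E.pi_upsilon[OF \<sigma> a])
    also have "\<dots> = cinner (tE (S \<eta>) (\<upsilon> (pinv \<sigma>) l)) (tE \<xi> k)"
      by (simp add: E.T.ip_t E.cinner_upsilon[OF \<sigma>])
    finally show "cinner (tensor_op tF tE S (\<upsilon> (pinv \<sigma>)) s') s = cinner s' (tensor_op tE tF T (\<upsilon> \<sigma>) s)"
      by (simp add: s I)
  qed
qed

end

section \<open>Relative tensor products\<close>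

text \<open>Density of the second set of generators upgrades the isometry to a unitary, once its
  range is known to be closed.\<close>

lemma isometry_extension:
  fixes g :: "'i \<Rightarrow> 'x::chilbert_space" and h :: "'i \<Rightarrow> 'y::chilbert_space"
  assumes scale: "\<And>i c. i \<in> I \<Longrightarrow> \<exists>j\<in>I. g j = c *\<^sub>C g i \<and> h j = c *\<^sub>C h i"
    and dense: "\<lbrakk>g ` I\<rbrakk> = UNIV" "\<lbrakk>h ` I\<rbrakk> = UNIV"
    and ip: "\<And>i j. i \<in> I \<Longrightarrow> j \<in> I \<Longrightarrow> cinner (h i) (h j) = cinner (g i) (g j)"
  shows "\<exists>U. unitary_op U \<and> (\<forall>i\<in>I. blinfun_apply U (g i) = h i)"
proof -
  have "\<exists>U. clinear_op U \<and> (\<forall>i\<in>I. blinfun_apply U (g i) = h i) \<and> (\<forall>x. norm (U x) \<le> 1 * norm x)"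
  proof (rule bounded_extension[OF scale dense(1)])
    fix xs assume xs: "set xs \<subseteq> I"
    have "cinner (\<Sum>i\<leftarrow>xs. g i) (\<Sum>i\<leftarrow>xs. g i) = cinner (\<Sum>i\<leftarrow>xs. h i) (\<Sum>i\<leftarrow>xs. h i)"
      by (rule ip_sum_list_pairing[OF hilbert_ip_cinner hilbert_ip_cinner, where R = "(=)"])
         (simp_all add: ip subsetD[OF xs])
    then show "norm (\<Sum>i\<leftarrow>xs. h i) \<le> 1 * norm (\<Sum>i\<leftarrow>xs. g i)"
      using cinner.ip_norm[of "\<Sum>i\<leftarrow>xs. g i"] cinner.ip_norm[of "\<Sum>i\<leftarrow>xs. h i"]
      by (metis mult_1 norm_ge_zero order_refl power2_eq_iff_nonneg)
  qed auto
  then obtain U where U: "clinear_op U" "\<And>i. i \<in> I \<Longrightarrow> blinfun_apply U (g i) = h i" by blast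
  have "adj U o\<^sub>L U = id_blinfun"
  proof (rule blinfun_eqI)
    fix y
    have 1: "cinner (U (g i)) (U y) = cinner (g i) y" if "i \<in> I" for i y
    proof (rule bounded_clinear_eqI_span[where S = "g ` I"])
      show "bounded_linear (\<lambda>y. cinner (U (g i)) (U y))"
        by (rule bounded_linear_compose[OF cinner.bounded_linear_ip_right blinfun.bounded_linear_right])
    qed (use that dense in \<open>auto simp: cinner.bounded_linear_ip_right cinner.ip_scale_right clinear_opD[OF U(1)] U ip\<close>)
    have "adj U (U y) = y"
      by (rule cinner.ip_eqI_span[OF dense(1)]) (auto simp: cinner_adj_right[OF U(1)] 1)
    then show "blinfun_apply (adj U o\<^sub>L U) y = blinfun_apply id_blinfun y" by simp
  qed
  then have adjU: "adj U (U x) = x" for x by (metis blinfun_apply_blinfun_compose blinfun_apply_id_blinfun)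
  have iso: "cinner (U x) (U y) = cinner x y" for x y
    by (simp add: cinner_adj_right[OF U(1), symmetric] adjU)
  have "UNIV \<subseteq> range U"
    unfolding dense(2)[symmetric]
  proof (rule closed_span_minimal)
    show "h ` I \<subseteq> range U" using U(2) by (metis image_subsetI rangeI)
    show "csubspace (range U)"
    proof (rule csubspaceI)
      show "0 \<in> range U" by (rule image_eqI[of _ _ 0]) auto
      show "x + y \<in> range U" if "x \<in> range U" "y \<in> range U" for x y
        using that by (auto simp flip: blinfun.add_right)
      show "c *\<^sub>C x \<in> range U" if "x \<in> range U" for c x
        using that by (auto simp flip: clinear_opD[OF U(1)])
    qed
    show "closed (range U)"
    proof -
      \<comment> \<open>The range is the fixed space of a continuous map, hence closed.\<close>
      have "range U = {y. U (adj U y) = y}" using adjU by (auto simp: image_iff) metis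
      moreover have "closed {y. U (adj U y) = y}" by (intro closed_Collect_eq continuous_intros)
      ultimately show ?thesis by simp
    qed
  qed
  then have "surj U" by blast
  then show ?thesis using U iso by (auto simp: unitary_op_def)
qed

lemma unitary_adj:
  assumes "unitary_op U" shows "adj U (U x) = x" "U (adj U y) = y" "clinear_op U" "clinear_op (adj U)"
proof -
  show U: "clinear_op U" using assms by (simp add: unitary_op_def)
  then show "clinear_op (adj U)" by (rule clinear_adj)
  have 1: "adj U (U x) = x" for x
    by (rule cinner.ip_eqI) (use assms in \<open>simp add: cinner_adj_right[OF U] unitary_op_def\<close>)
  show "adj U (U x) = x" by (rule 1)
  obtain z where "y = U z" using assms unfolding unitary_op_def surj_def by blast
  then show "U (adj U y) = y" by (simp add: 1)
qed

lemma adj_compose_eqI_span: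
  assumes S: "\<lbrakk>S\<rbrakk> = UNIV" and S': "\<lbrakk>S'\<rbrakk> = UNIV" and A: "clinear_op A" and B: "clinear_op B" and C: "clinear_op C"
    and ip: "\<And>s s'. s \<in> S \<Longrightarrow> s' \<in> S' \<Longrightarrow> cinner (blinfun_apply A s) (blinfun_apply B s') = cinner s (blinfun_apply C s')"
  shows "adj A o\<^sub>L B = C"
proof (rule blinfun_eqI)
  fix y
  have 1: "cinner (A s) (B y) = cinner s (C y)" if "s \<in> S" for s
  proof (rule bounded_clinear_eqI_span[where S = S' and x = y])
    show "bounded_linear (\<lambda>y. cinner (A s) (B y))" "bounded_linear (\<lambda>y. cinner s (C y))"
      by (rule bounded_linear_compose[OF cinner.bounded_linear_ip_right blinfun.bounded_linear_right])+
  qed (use S' ip that in \<open>auto simp: cinner.ip_scale_right clinear_opD[OF B] clinear_opD[OF C]\<close>)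
  show "blinfun_apply (adj A o\<^sub>L B) y = blinfun_apply C y"
    by (rule cinner.ip_eqI_span[OF S]) (simp add: cinner_adj_right[OF A] 1)
qed

text \<open>\<open>commute\<close> expresses that the two algebras of the C*-base commute. It makes
  \<open>A\<close> and \<open>D\<close> interchangeable, so that statements on \<open>ket2\<close>
  are those on \<open>ket1\<close> after \<open>swap\<close>.\<close>

locale relative_tensor_space =
  fixes A :: "('h::chilbert_space \<Rightarrow>\<^sub>L 'm::chilbert_space) set"
    and D :: "('h \<Rightarrow>\<^sub>L 'n::chilbert_space) set"
    and r :: "('h \<Rightarrow>\<^sub>L 'm) \<Rightarrow> 'h \<Rightarrow> ('h \<Rightarrow>\<^sub>L 'n) \<Rightarrow> 'r::chilbert_space"
  assumes rel: "relative_tensor A D r"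
    and csubspace_A: "csubspace A" and csubspace_D: "csubspace D"
    and clinear_A: "a \<in> A \<Longrightarrow> clinear_op a" and clinear_D: "d \<in> D \<Longrightarrow> clinear_op d"
    and commute: "a \<in> A \<Longrightarrow> a' \<in> A \<Longrightarrow> d \<in> D \<Longrightarrow> d' \<in> D \<Longrightarrow>
      (adj a o\<^sub>L a') o\<^sub>L (adj d o\<^sub>L d') = (adj d o\<^sub>L d') o\<^sub>L (adj a o\<^sub>L a')"
    and dense_A: "\<lbrakk>{blinfun_apply a \<zeta> | a \<zeta>. a \<in> A}\<rbrakk> = UNIV"
    and dense_D: "\<lbrakk>{blinfun_apply d \<zeta> | d \<zeta>. d \<in> D}\<rbrakk> = UNIV"
begin

lemma commute_apply:
  assumes "a \<in> A" "a' \<in> A" "d \<in> D" "d' \<in> D"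
  shows "adj a (a' (adj d (d' \<zeta>))) = adj d (d' (adj a (a' \<zeta>)))"
  using arg_cong[OF commute[OF assms], of "\<lambda>T. blinfun_apply T \<zeta>"] by simp

lemma ip_r:
  "a \<in> A \<Longrightarrow> a' \<in> A \<Longrightarrow> d \<in> D \<Longrightarrow> d' \<in> D \<Longrightarrow>
    cinner (r a \<zeta> d) (r a' \<zeta>' d') = cinner \<zeta> (adj a (a' (adj d (d' \<zeta>'))))"
  using rel by (simp add: relative_tensor_def)

lemma dense_r: "\<lbrakk>{r a \<zeta> d | a \<zeta> d. a \<in> A \<and> d \<in> D}\<rbrakk> = UNIV"
  using rel by (simp add: relative_tensor_def)

lemma r_eqI:
  assumes "\<And>a \<zeta> d. a \<in> A \<Longrightarrow> d \<in> D \<Longrightarrow> cinner (r a \<zeta> d) x = cinner (r a \<zeta> d) y"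
  shows "x = y"
  by (rule cinner.ip_eqI_span[OF dense_r]) (use assms in blast)

lemma r_add: "a \<in> A \<Longrightarrow> a' \<in> A \<Longrightarrow> d \<in> D \<Longrightarrow> r (a + a') \<zeta> d = r a \<zeta> d + r a' \<zeta> d"
  by (rule r_eqI)
     (simp add: ip_r csubspace_A cplx.subspace_add cinner.ip_add_right blinfun.add_left blinfun.add_right)

lemma r_scale: "a \<in> A \<Longrightarrow> d \<in> D \<Longrightarrow> r (c *\<^sub>C a) \<zeta> d = c *\<^sub>C r a \<zeta> d"
  by (rule r_eqI)
     (simp add: ip_r csubspace_A cplx.subspace_scale cinner.ip_scale_right blinfun_apply_scaleC
       clinear_opD[OF clinear_adj[OF clinear_A]])

lemma r_scale_mid: "a \<in> A \<Longrightarrow> d \<in> D \<Longrightarrow> r a (c *\<^sub>C \<zeta>) d = c *\<^sub>C r a \<zeta> d"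
  by (rule r_eqI)
     (simp add: ip_r cinner.ip_scale_right clinear_opD[OF clinear_A] clinear_opD[OF clinear_D]
       clinear_opD[OF clinear_adj[OF clinear_A]] clinear_opD[OF clinear_adj[OF clinear_D]])

text \<open>By commutation, the inner product of \<open>r a \<zeta> d\<close> and
  \<open>r a \<zeta>' d'\<close> is that of \<open>d \<zeta>\<close> and
  \<open>d' (M \<zeta>')\<close>. The insertion of \<open>M\<close> is bounded by
  \<open>operator_list_bound\<close>, as \<open>M\<close> commutes with each
  \<open>adj d o\<^sub>L d'\<close>. Again \<open>4 = sqrt (4 * 4)\<close>.\<close>

lemma ket1_exists:
  assumes a: "a \<in> A"
  shows "\<exists>X. clinear_op X \<and> (\<forall>d\<in>D. \<forall>\<zeta>. blinfun_apply X (blinfun_apply d \<zeta>) = r a \<zeta> d) \<and> norm X \<le> 4 * norm a"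
proof -
  define M where "M = adj a o\<^sub>L a"
  note ca = clinear_A[OF a] clinear_adj[OF clinear_A[OF a]]
  have M: "clinear_op M" by (simp add: M_def clinear_op_compose ca)
  have M_sa: "cinner (M x) y = cinner x (M y)" for x y
    by (simp add: M_def cinner_adj_left[OF ca(1)] cinner_adj_right[OF ca(1)])
  have norm_M: "norm M \<le> 4 * norm a * norm a"
    unfolding M_def using norm_adj_le[OF ca(1)]
    by (intro order_trans[OF norm_blinfun_compose] mult_right_mono) auto
  have MD: "M (adj d (d' \<zeta>)) = adj d (d' (M \<zeta>))" if "d \<in> D" "d' \<in> D" for d d' \<zeta>
    using commute_apply[OF a a that] by (simp add: M_def)
  let ?I = "D \<times> (UNIV :: 'h set)"
  let ?g = "\<lambda>p::('h \<Rightarrow>\<^sub>L 'n) \<times> 'h. blinfun_apply (fst p) (snd p)" and ?h = "\<lambda>p. r a (snd p) (fst p)"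
  have "\<exists>L. clinear_op L \<and> (\<forall>p\<in>?I. blinfun_apply L (?g p) = ?h p) \<and> (\<forall>x. norm (L x) \<le> (4 * norm a) * norm x)"
  proof (rule bounded_extension)
    show "\<exists>q\<in>?I. ?g q = c *\<^sub>C ?g p \<and> ?h q = c *\<^sub>C ?h p" if "p \<in> ?I" for p c
      using that by (intro bexI[of _ "(fst p, c *\<^sub>C snd p)"]) (auto simp: clinear_opD[OF clinear_D] r_scale_mid[OF a])
    have "blinfun_apply d \<zeta> \<in> ?g ` ?I" if "d \<in> D" for d \<zeta>
      by (rule image_eqI[of _ _ "(d, \<zeta>)"]) (use that in auto)
    then have "?g ` ?I = {blinfun_apply d \<zeta> | d \<zeta>. d \<in> D}" by auto
    then show "\<lbrakk>?g ` ?I\<rbrakk> = UNIV" by (simp only: dense_D)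
    fix xs :: "(('h \<Rightarrow>\<^sub>L 'n) \<times> 'h) list" assume xs: "set xs \<subseteq> ?I"
    show "norm (\<Sum>p\<leftarrow>xs. ?h p) \<le> 4 * norm a * norm (\<Sum>p\<leftarrow>xs. ?g p)"
    proof (rule power2_le_imp_le)
      let ?z = "\<Sum>p\<leftarrow>xs. ?g p" and ?w = "\<Sum>p\<leftarrow>xs. blinfun_apply (fst p) (M (snd p))"
      have "cinner ?z ?w = cinner (\<Sum>p\<leftarrow>xs. ?h p) (\<Sum>p\<leftarrow>xs. ?h p)"
      proof (rule ip_sum_list_pairing[OF hilbert_ip_cinner hilbert_ip_cinner, where R = "(=)"])
        fix p q assume "p \<in> set xs" "q \<in> set xs"
        then have "fst p \<in> D" "fst q \<in> D" using xs by auto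
        then show "cinner (?g p) (blinfun_apply (fst q) (M (snd q))) = cinner (?h p) (?h q)"
          by (simp add: ip_r[OF a a] MD cinner_adj_right[OF clinear_D] flip: blinfun_apply_blinfun_compose[of "adj a" a] M_def)
      qed auto
      then have "(norm (\<Sum>p\<leftarrow>xs. ?h p))\<^sup>2 = norm (cinner ?z ?w)" by (simp add: cinner.ip_norm)
      also have "\<dots> \<le> 4 * norm ?z * norm ?w" by (rule cinner.ip_bound)
      also have "\<dots> \<le> 4 * norm ?z * (norm M * norm ?z)"
      proof -
        have "norm (\<Sum>p\<leftarrow>xs. (\<lambda>Z p. blinfun_apply (fst p) (blinfun_apply Z (snd p))) M p)
            \<le> norm M * norm (\<Sum>p\<leftarrow>xs. (\<lambda>Z p. blinfun_apply (fst p) (blinfun_apply Z (snd p))) id_blinfun p)"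
        proof (rule operator_list_bound[OF hilbert_ip_cinner hilbert_ip_cinner M M_sa _ _ _ xs])
          fix Z Z' p q
          assume Z: "clinear_op Z" "\<And>x y. cinner (blinfun_apply Z x) y = cinner x (blinfun_apply Z y)"
            and Y: "\<And>Y. clinear_op Y \<Longrightarrow> Y o\<^sub>L M = M o\<^sub>L Y \<Longrightarrow> Y o\<^sub>L Z = Z o\<^sub>L Y"
            and pq: "p \<in> ?I" "q \<in> ?I"
          then have D: "fst p \<in> D" "fst q \<in> D" by auto
          let ?Y = "adj (fst p) o\<^sub>L fst q"
          have "?Y o\<^sub>L Z = Z o\<^sub>L ?Y"
          proof (rule Y)
            show "clinear_op ?Y" by (intro clinear_op_compose clinear_adj clinear_D D)
            show "?Y o\<^sub>L M = M o\<^sub>L ?Y" by (rule blinfun_eqI) (simp add: MD D)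
          qed
          then have "adj (fst p) (fst q (Z x)) = Z (adj (fst p) (fst q x))" for x
            by (metis blinfun_apply_blinfun_compose)
          then show "cinner (blinfun_apply (fst p) (blinfun_apply Z (snd p))) (blinfun_apply (fst q) (blinfun_apply Z' (snd q))) =
              cinner (blinfun_apply (fst p) (blinfun_apply id_blinfun (snd p)))
                (blinfun_apply (fst q) (blinfun_apply (Z o\<^sub>L Z') (snd q)))"
            using D by (simp add: cinner_adj_right[OF clinear_D, symmetric] Z(2))
        qed (simp_all add: blinfun.add_left blinfun.add_right blinfun.scaleR_left blinfun.scaleR_right)
        then show ?thesis by (intro mult_left_mono) auto
      qed
      also have "\<dots> \<le> 4 * norm ?z * ((4 * norm a * norm a) * norm ?z)"
        by (intro mult_left_mono mult_right_mono norm_M) auto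
      also have "\<dots> = (4 * norm a * norm ?z)\<^sup>2" by (simp add: power2_eq_square)
      finally show "(norm (\<Sum>p\<leftarrow>xs. ?h p))\<^sup>2 \<le> (4 * norm a * norm ?z)\<^sup>2" .
    qed simp
  qed simp
  then obtain X where X: "clinear_op X" "\<And>p. p \<in> ?I \<Longrightarrow> blinfun_apply X (?g p) = ?h p"
    "\<And>x. norm (X x) \<le> (4 * norm a) * norm x" by blast
  have "norm X \<le> 4 * norm a" by (rule norm_blinfun_bound) (simp_all add: X(3))
  moreover have "blinfun_apply X (blinfun_apply d \<zeta>) = r a \<zeta> d" if "d \<in> D" for d \<zeta>
    using X(2)[of "(d, \<zeta>)"] that by simp
  ultimately show ?thesis using X(1) by blast
qed

lemma eqI_D:
  assumes "\<And>d \<zeta>. d \<in> D \<Longrightarrow> blinfun_apply X (blinfun_apply d \<zeta>) = blinfun_apply Y (blinfun_apply d \<zeta>)"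
  shows "X = Y"
proof (rule blinfun_eqI_span[OF dense_D])
  fix c x assume "x \<in> {blinfun_apply d \<zeta> | d \<zeta>. d \<in> D}"
  then obtain d \<zeta> where d: "x = blinfun_apply d \<zeta>" "d \<in> D" by blast
  then have "c *\<^sub>C x = blinfun_apply d (c *\<^sub>C \<zeta>)" by (simp add: clinear_opD[OF clinear_D])
  then show "c *\<^sub>C x \<in> {blinfun_apply d \<zeta> | d \<zeta>. d \<in> D}" using d(2) by blast
qed (use assms in auto)

lemma ket1:
  assumes a: "a \<in> A"
  shows "d \<in> D \<Longrightarrow> blinfun_apply (ket1 r D a) (blinfun_apply d \<zeta>) = r a \<zeta> d"
    "clinear_op (ket1 r D a)" "norm (ket1 r D a) \<le> 4 * norm a"
proof -
  obtain X where X: "clinear_op X" "\<And>d \<zeta>. d \<in> D \<Longrightarrow> blinfun_apply X (blinfun_apply d \<zeta>) = r a \<zeta> d" "norm X \<le> 4 * norm a"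
    using ket1_exists[OF a] by blast
  have "ket1 r D a = X"
    unfolding ket1_def by (rule the_equality) (auto simp: X intro: eqI_D)
  then show "d \<in> D \<Longrightarrow> blinfun_apply (ket1 r D a) (blinfun_apply d \<zeta>) = r a \<zeta> d"
    "clinear_op (ket1 r D a)" "norm (ket1 r D a) \<le> 4 * norm a"
    using X by simp_all
qed

lemma ket1_add: "a \<in> A \<Longrightarrow> a' \<in> A \<Longrightarrow> ket1 r D (a + a') = ket1 r D a + ket1 r D a'"
  by (rule eqI_D) (simp add: ket1 csubspace_A cplx.subspace_add r_add blinfun.add_left)

lemma ket1_scale: "a \<in> A \<Longrightarrow> ket1 r D (c *\<^sub>C a) = c *\<^sub>C ket1 r D a"
  by (rule eqI_D) (simp add: ket1 csubspace_A cplx.subspace_scale r_scale blinfun_apply_scaleC)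

lemma ket1_closed_span:
  assumes T: "clinear_op T" and V: "csubspace V" "closed V" and S: "S \<subseteq> A"
    and gen: "\<And>s. s \<in> S \<Longrightarrow> T o\<^sub>L ket1 r D s \<in> V" and a: "a \<in> A" "a \<in> \<lbrakk>S\<rbrakk>"
  shows "T o\<^sub>L ket1 r D a \<in> V"
proof (rule closed_span_bounded_map[OF csubspace_A S, where K = "norm T * 4"])
  show "T o\<^sub>L ket1 r D (x + y) = (T o\<^sub>L ket1 r D x) + (T o\<^sub>L ket1 r D y)" if "x \<in> A" "y \<in> A" for x y
    by (simp add: ket1_add that bounded_bilinear.add_right[OF bounded_bilinear_blinfun_compose])
  show "T o\<^sub>L ket1 r D (c *\<^sub>C x) = c *\<^sub>C (T o\<^sub>L ket1 r D x)" if "x \<in> A" for c x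
    by (rule blinfun_eqI) (simp add: ket1_scale that blinfun_apply_scaleC clinear_opD[OF T])
  show "norm (T o\<^sub>L ket1 r D x) \<le> norm T * 4 * norm x" if "x \<in> A" for x
    using mult_left_mono[OF ket1(3)[OF that], of "norm T"] norm_blinfun_compose[of T "ket1 r D x"]
    by simp
qed (use V gen a in auto)

lemma swap: "relative_tensor_space D A (\<lambda>d \<zeta> a. r a \<zeta> d)"
proof
  have "{r a \<zeta> d | d \<zeta> a. d \<in> D \<and> a \<in> A} = {r a \<zeta> d | a \<zeta> d. a \<in> A \<and> d \<in> D}" by blast
  then show "relative_tensor D A (\<lambda>d \<zeta> a. r a \<zeta> d)"
    unfolding relative_tensor_def using dense_r by (auto simp: ip_r commute_apply)
  show "\<lbrakk>{blinfun_apply a \<zeta> | a \<zeta>. a \<in> D}\<rbrakk> = UNIV" "\<lbrakk>{blinfun_apply d \<zeta> | d \<zeta>. d \<in> A}\<rbrakk> = UNIV"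
    by (rule dense_D dense_A)+
qed (simp_all add: csubspace_A csubspace_D clinear_A clinear_D commute)

end

lemma ket2_eq_ket1: "ket2 r A d = ket1 (\<lambda>d \<zeta> a. r a \<zeta> d) A d"
  by (simp add: ket1_def ket2_def)

section \<open>The factorizations of induced spaces\<close>

text \<open>Since \<open>\<eta>\<close> lies in the submodule generated by
  \<open>ran \<theta>\<close>, every \<open>ip E \<zeta> \<eta>\<close> has a preimage
  \<open>y \<zeta>\<close> under \<open>\<theta>\<close>, and the adjoint is
  \<open>star (y \<zeta>)\<close>. The work lies in \<open>b\<close> outside
  \<open>dom \<theta>\<close>, where homogeneity of \<open>\<eta>\<close> says nothing about
  \<open>lact E b \<eta>\<close>.\<close>

lemma (in bimod) r_op_hom_adjoint:
  assumes \<theta>: "\<theta> \<in> PAut" and \<eta>: "\<eta> \<in> hom_elts (pinv \<theta>) E"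
  shows "\<exists>S. hom_adjoint \<theta> self_bimodule E (r_op E \<eta>) S"
proof -
  let ?\<kappa> = "pinv \<theta>"
  have \<eta>1: "\<eta> \<in> \<lbrakk>{ract E \<xi> b | \<xi> b. b \<in> ran \<theta>}\<rbrakk>"
    using \<eta> by (simp add: hom_elts_def)
  have \<eta>2: "ract E \<eta> w = lact E v \<eta>" if "\<theta> v = Some w" for v w
    using \<eta> that by (simp add: hom_elts_def pinv_eq_Some_iff[OF \<theta>])
  note I = PAut_ideal[OF \<theta>]
  have in_ran: "ip E \<zeta> \<eta> \<in> ran \<theta>" for \<zeta> by (rule ip_in_ideal[OF I(2) \<eta>1])
  then have "\<exists>y. \<theta> y = Some (ip E \<zeta> \<eta>)" for \<zeta> by (auto simp: ran_def)
  then obtain y where y: "\<And>\<zeta>. \<theta> (y \<zeta>) = Some (ip E \<zeta> \<eta>)" by metis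
  have "\<theta> (y \<zeta> * b) = Some (ip E \<zeta> (lact E b \<eta>))" for \<zeta> b
  proof -
    have "y \<zeta> * b \<in> dom \<theta>" using closed_idealD(3)[OF I(1)] y by blast
    then obtain z where z: "\<theta> (y \<zeta> * b) = Some z" by blast
    \<comment> \<open>The error lies in \<open>ran \<theta>\<close>, so \<open>star u\<close> is the
      image of some \<open>v\<close>. Homogeneity applies to \<open>v\<close> and to
      \<open>b * v\<close>, which shows that \<open>u * star u\<close> vanishes.\<close>
    define u where "u = ip E \<zeta> (lact E b \<eta>) - z"
    have "ip E \<zeta> (lact E b \<eta>) \<in> ran \<theta>" unfolding ip_lact by (rule in_ran)
    moreover have "z \<in> ran \<theta>" using z by (rule ranI)
    ultimately have "u \<in> ran \<theta>"
      unfolding u_def using cplx.subspace_diff[OF closed_idealD(1)[OF I(2)]] by blast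
    then have "star u \<in> ran \<theta>" by (rule PAut_ran_star[OF \<theta>])
    then obtain v where v: "\<theta> v = Some (star u)" by (auto simp: ran_def)
    have "b * v \<in> dom \<theta>" using closed_idealD(4)[OF I(1)] v by blast
    then obtain x' where x': "\<theta> (b * v) = Some x'" by blast
    have "ip E \<zeta> (lact E b \<eta>) * star u = ip E \<zeta> (lact E b (ract E \<eta> (star u)))"
      by (simp add: lact_ract ip_ract)
    also have "\<dots> = ip E \<zeta> (lact E (b * v) \<eta>)" by (simp add: \<eta>2[OF v] lact_mult)
    also have "\<dots> = ip E \<zeta> \<eta> * x'" by (simp add: \<eta>2[OF x', symmetric] ip_ract)
    also have "\<dots> = z * star u"
      using PAut_mult[OF \<theta> y x', of \<zeta>] PAut_mult[OF \<theta> z v] by (simp add: mult.assoc)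
    finally have "u * star u = 0" by (simp add: u_def left_diff_distrib)
    then have "star u = 0" by - (rule cstar_eq_0I, simp only: star_star)
    then have "u = 0" by (metis star_star star_zero)
    then show ?thesis using z by (simp add: u_def)
  qed
  then have "hom_adjoint \<theta> self_bimodule E (r_op E \<eta>) (\<lambda>\<zeta>. star (y \<zeta>))"
    by (simp add: hom_adjoint_def self_bimodule_def star_star r_op_apply)
  then show ?thesis by blast
qed

section \<open>Left multiplication on induced spaces, and generators of the factorizations\<close>

context induced
begin

lemma t_ract: "tE (ract E \<xi> b) k = tE \<xi> (\<pi> b k)"
  by (rule T.t_eqI_left) (simp add: T.ip_t E.ip_ract pi_mult)

sublocale EE: induced_pair \<Theta> \<pi> \<upsilon> E tE E tE by unfold_locales

definition left_op :: "'b \<Rightarrow> 'ie \<Rightarrow>\<^sub>L 'ie" where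
  "left_op b = tensor_op tE tE (l_mult E b) (\<upsilon> pid)"

lemma l_mult_hom_adjoint: "hom_adjoint pid E E (l_mult E b) (l_mult E (star b))"
  by (simp add: hom_adjoint_def E.l_mult_apply E.lact_star)

lemma left_op: "left_op b (tE \<xi> k) = tE (lact E b \<xi>) k" "clinear_op (left_op b)"
    "adj (left_op b) = left_op (star b)"
  unfolding left_op_def
  using EE.induced_op[OF Theta_pid l_mult_hom_adjoint] EE.adj_induced_op[OF Theta_pid l_mult_hom_adjoint]
  by (simp_all add: E.l_mult_apply t_upsilon_pid)

lemma blinfun_eqI_tE:
  "(\<And>\<xi> k. blinfun_apply Y (tE \<xi> k) = blinfun_apply Z (tE \<xi> k)) \<Longrightarrow> Y = Z"
  by (rule T.blinfun_eqI_t)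

end

locale based = B: induced \<Theta> \<pi> \<upsilon> self_bimodule tB + E: induced \<Theta> \<pi> \<upsilon> E tE
  for \<Theta> :: "('b::cstar_algebra \<rightharpoonup> 'b) set" and \<pi> :: "'b \<Rightarrow> 'k::chilbert_space \<Rightarrow>\<^sub>L 'k" and \<upsilon>
    and tB :: "'b \<Rightarrow> 'k \<Rightarrow> 'h::chilbert_space"
    and E :: "('b, 'e::complex_banach) bimodule" and tE :: "'e \<Rightarrow> 'k \<Rightarrow> 'ie::chilbert_space" +
  assumes decomposable: "decomposable_wrt \<Theta> E"
begin

sublocale BE: induced_pair \<Theta> \<pi> \<upsilon> self_bimodule tB E tE by unfold_locales

text \<open>Formed for every \<open>\<xi>\<close>, homogeneous or not. The second leg is
  \<open>id_blinfun\<close>, as in \<open>\<tau>\<close>, whereas \<open>J\<close> puts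
  \<open>\<upsilon> pid\<close> there; the last claim of the lemma \<open>L_op\<close> reconciles
  the two.\<close>

definition L_op :: "'e \<Rightarrow> 'h \<Rightarrow>\<^sub>L 'ie" where
  "L_op \<xi> = tensor_op tB tE (l_op E \<xi>) id_blinfun"

definition R_op :: "'e \<Rightarrow> ('b \<rightharpoonup> 'b) \<Rightarrow> 'h \<Rightarrow>\<^sub>L 'ie" where
  "R_op \<eta> \<theta> = tensor_op tB tE (r_op E \<eta>) (\<upsilon> \<theta>)"

lemma l_op_hom_adjoint: "hom_adjoint pid self_bimodule E (l_op E \<xi>) (\<lambda>\<eta>. ip E \<xi> \<eta>)"
  by (simp add: hom_adjoint_def self_bimodule_def E.E.l_op_apply E.E.ip_ract E.E.ip_star)

lemma L_op:
  "L_op \<xi> (tB b k) = tE (ract E \<xi> b) k" "clinear_op (L_op \<xi>)" "norm (L_op \<xi>) \<le> 4 * norm \<xi>"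
  "tensor_op tB tE (l_op E \<xi>) (\<upsilon> pid) = L_op \<xi>"
proof -
  note I = BE.induced_op[OF B.Theta_pid l_op_hom_adjoint, of \<xi>]
  show eq: "tensor_op tB tE (l_op E \<xi>) (\<upsilon> pid) = L_op \<xi>"
    unfolding L_op_def
    by (rule B.T.tensor_op_eqI[symmetric]) (simp add: I E.t_upsilon_pid)
  show "L_op \<xi> (tB b k) = tE (ract E \<xi> b) k" "clinear_op (L_op \<xi>)"
    using I by (simp_all add: eq E.t_upsilon_pid E.E.l_op_apply)
  have "norm (l_op E \<xi>) \<le> norm \<xi>"
    by (rule norm_blinfun_bound) (simp_all add: E.E.l_op_apply E.E.ract_norm)
  then show "norm (L_op \<xi>) \<le> 4 * norm \<xi>" using I(3) by (simp add: eq)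
qed

lemma L_op_add: "L_op (\<xi> + \<eta>) = L_op \<xi> + L_op \<eta>"
  by (rule B.blinfun_eqI_tE) (simp add: L_op blinfun.add_left E.E.ract_add_left E.T.t_add_left)

lemma L_op_scale: "L_op (c *\<^sub>C \<xi>) = c *\<^sub>C L_op \<xi>"
  by (rule B.blinfun_eqI_tE) (simp add: L_op blinfun_apply_scaleC E.E.ract_scale_left E.T.t_scale_left)

lemma R_op:
  assumes \<theta>: "\<theta> \<in> \<Theta>" and \<eta>: "\<eta> \<in> hom_elts (pinv \<theta>) E"
  shows "R_op \<eta> \<theta> (tB b k) = tE (lact E b \<eta>) (\<upsilon> \<theta> k)" "clinear_op (R_op \<eta> \<theta>)"
proof -
  obtain S where "hom_adjoint \<theta> self_bimodule E (r_op E \<eta>) S"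
    using E.E.r_op_hom_adjoint[OF B.Theta_PAut[OF \<theta>] \<eta>] by blast
  from BE.induced_op[OF \<theta> this]
  show "R_op \<eta> \<theta> (tB b k) = tE (lact E b \<eta>) (\<upsilon> \<theta> k)" "clinear_op (R_op \<eta> \<theta>)"
    by (simp_all add: R_op_def E.E.r_op_apply)
qed

lemma tensor_op_zero: "tensor_op tB tE 0 Z = 0"
  by (rule B.T.tensor_op_eqI) (simp add: bounded_bilinear.zero_left[OF E.T.bounded_bilinear_t])

text \<open>\<open>\<alpha>\<close> is generated by homogeneous elements; decomposability and
  continuity of \<open>L_op\<close> reach the others.\<close>

lemma L_op_in_alpha: "L_op \<xi> \<in> \<alpha> \<Theta> \<upsilon> tB tE E"
proof (rule closed_span_bounded_map[where A = UNIV and f = L_op and K = 4])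
  show "csubspace (\<alpha> \<Theta> \<upsilon> tB tE E)" "closed (\<alpha> \<Theta> \<upsilon> tB tE E)" by (simp_all add: \<alpha>_def J_def)
  show "\<xi> \<in> \<lbrakk>\<Union>\<theta>\<in>\<Theta>. hom_elts \<theta> E\<rbrakk>" using decomposable by (simp add: decomposable_wrt_def)
  show "L_op s \<in> \<alpha> \<Theta> \<upsilon> tB tE E" if s: "s \<in> (\<Union>\<theta>\<in>\<Theta>. hom_elts \<theta> E)" for s
  proof -
    obtain \<theta> where "\<theta> \<in> \<Theta>" "s \<in> hom_elts \<theta> E" using s by blast
    then show ?thesis
      unfolding \<alpha>_def J_def L_op(4)[symmetric]
      by (intro closed_span_base CollectI exI[of _ "l_op E s"] exI[of _ \<theta>] exI[of _ pid])
         (simp add: l_fam_def B.Theta_pid)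
  qed
qed (simp_all add: L_op_add L_op_scale L_op cplx.subspace_UNIV)

lemma alpha_eq: "\<alpha> \<Theta> \<upsilon> tB tE E = \<lbrakk>range L_op\<rbrakk>"
proof
  show "\<alpha> \<Theta> \<upsilon> tB tE E \<subseteq> \<lbrakk>range L_op\<rbrakk>"
    unfolding \<alpha>_def J_def
  proof (rule closed_span_minimal, safe)
    fix c \<rho> \<sigma> assume "c \<in> l_fam E \<rho> \<sigma>"
    then consider \<xi> where "\<sigma> = pid" "c = l_op E \<xi>" | "c = 0"
      by (auto simp: l_fam_def split: if_splits)
    then show "tensor_op tB tE c (\<upsilon> \<sigma>) \<in> \<lbrakk>range L_op\<rbrakk>"
      by cases (simp_all add: L_op(4) closed_span_base tensor_op_zero cplx.subspace_0)
  qed auto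
  show "\<lbrakk>range L_op\<rbrakk> \<subseteq> \<alpha> \<Theta> \<upsilon> tB tE E"
  proof (rule closed_span_minimal)
    show "range L_op \<subseteq> \<alpha> \<Theta> \<upsilon> tB tE E" using L_op_in_alpha by blast
  qed (simp_all add: \<alpha>_def J_def)
qed

lemma beta_eq: "\<beta> \<Theta> \<upsilon> tB tE E = \<lbrakk>{R_op \<eta> \<theta> | \<eta> \<theta>. \<theta> \<in> \<Theta> \<and> \<eta> \<in> hom_elts (pinv \<theta>) E}\<rbrakk>"
  (is "_ = \<lbrakk>?R\<rbrakk>")
proof
  show "\<beta> \<Theta> \<upsilon> tB tE E \<subseteq> \<lbrakk>?R\<rbrakk>"
    unfolding \<beta>_def J_def
  proof (rule closed_span_minimal, safe)
    fix c \<rho> \<sigma> assume "\<sigma> \<in> \<Theta>" "c \<in> r_fam E \<rho> \<sigma>"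
    then consider \<eta> where "c = r_op E \<eta>" "\<eta> \<in> hom_elts (pinv \<sigma>) E" | "c = 0"
      by (auto simp: r_fam_def split: if_splits)
    then show "tensor_op tB tE c (\<upsilon> \<sigma>) \<in> \<lbrakk>?R\<rbrakk>"
    proof cases
      case 1
      then show ?thesis using \<open>\<sigma> \<in> \<Theta>\<close> by (intro closed_span_base) (auto simp: R_op_def)
    qed (simp add: tensor_op_zero cplx.subspace_0)
  qed auto
  show "\<lbrakk>?R\<rbrakk> \<subseteq> \<beta> \<Theta> \<upsilon> tB tE E"
    unfolding \<beta>_def J_def
  proof (intro closed_span_mono, safe)
    fix \<eta> \<theta> assume "\<theta> \<in> \<Theta>" "\<eta> \<in> hom_elts (pinv \<theta>) E"
    then show "\<exists>c \<rho> \<sigma>. R_op \<eta> \<theta> = tensor_op tB tE c (\<upsilon> \<sigma>) \<and> \<rho> \<in> \<Theta> \<and> \<sigma> \<in> \<Theta> \<and> c \<in> r_fam E \<rho> \<sigma>"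
      by (intro exI[of _ "r_op E \<eta>"] exI[of _ pid] exI[of _ \<theta>]) (simp add: r_fam_def R_op_def B.Theta_pid)
  qed
qed

lemma clinear_alpha: "a \<in> \<alpha> \<Theta> \<upsilon> tB tE E \<Longrightarrow> clinear_op a"
  unfolding alpha_eq by (rule clinear_closed_span) (auto simp: L_op)

lemma clinear_beta: "d \<in> \<beta> \<Theta> \<upsilon> tB tE E \<Longrightarrow> clinear_op d"
  unfolding beta_eq by (rule clinear_closed_span) (auto simp: R_op)

lemma UNIV_of_tE:
  assumes "csubspace V" "closed V" "\<And>\<xi> k. tE \<xi> k \<in> V" shows "V = UNIV"
  using closed_span_minimal[of "{tE \<xi> k | \<xi> k. True}" V] assms E.T.dense by auto

lemma dense_alpha: "\<lbrakk>{blinfun_apply a \<zeta> | a \<zeta>. a \<in> \<alpha> \<Theta> \<upsilon> tB tE E}\<rbrakk> = UNIV"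
proof (rule UNIV_of_tE)
  fix \<xi> k
  let ?V = "\<lbrakk>{blinfun_apply a \<zeta> | a \<zeta>. a \<in> \<alpha> \<Theta> \<upsilon> tB tE E}\<rbrakk>"
  show "tE \<xi> k \<in> ?V"
  proof (rule closed_span_vimage[where f = "\<lambda>\<xi>. tE \<xi> k" and S = "{ract E \<eta> b | \<eta> b. True}"])
    show "bounded_linear (\<lambda>\<xi>. tE \<xi> k)" by (rule bounded_bilinear.bounded_linear_left[OF E.T.bounded_bilinear_t])
    fix s assume "s \<in> {ract E \<eta> b | \<eta> b. True}"
    then obtain \<eta> b where s: "s = ract E \<eta> b" by blast
    have "L_op \<eta> (tB b k) \<in> ?V" using L_op_in_alpha by (intro closed_span_base) blast
    then show "tE s k \<in> ?V" by (simp add: s L_op)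
  next
    show "\<xi> \<in> \<lbrakk>{ract E \<eta> b | \<eta> b. True}\<rbrakk>" using E.E.ract_span_UNIV by blast
  qed (simp_all add: E.T.t_scale_left)
qed simp_all

text \<open>Elements \<open>lact E b \<eta>\<close> with \<open>\<eta>\<close> homogeneous are
  reached first. Decomposability frees \<open>\<eta>\<close>, and nondegeneracy of the left action
  then gives every \<open>\<xi>\<close>.\<close>

lemma dense_beta: "\<lbrakk>{blinfun_apply d \<zeta> | d \<zeta>. d \<in> \<beta> \<Theta> \<upsilon> tB tE E}\<rbrakk> = UNIV"
proof (rule UNIV_of_tE)
  fix \<xi> k
  let ?V = "\<lbrakk>{blinfun_apply d \<zeta> | d \<zeta>. d \<in> \<beta> \<Theta> \<upsilon> tB tE E}\<rbrakk>"
  have bl: "bounded_linear (\<lambda>\<xi>. tE \<xi> k)" for k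
    by (rule bounded_bilinear.bounded_linear_left[OF E.T.bounded_bilinear_t])
  have hom: "tE (lact E b \<eta>) k \<in> ?V" if \<kappa>: "\<kappa> \<in> \<Theta>" and \<eta>: "\<eta> \<in> hom_elts \<kappa> E" for \<kappa> \<eta> b
  proof -
    note P = B.Theta_PAut[OF \<kappa>]
    have \<theta>: "pinv \<kappa> \<in> \<Theta>" by (rule B.Theta_pinv[OF \<kappa>])
    have \<eta>': "\<eta> \<in> hom_elts (pinv (pinv \<kappa>)) E" using \<eta> by (simp add: pinv_pinv P)
    have "ip E \<eta> \<eta> \<in> dom \<kappa>"
      using \<eta> by (intro E.E.ip_in_ideal[OF PAut_ideal(1)[OF P]]) (simp add: hom_elts_def)
    then obtain p :: "nat \<Rightarrow> 'b" where p: "\<And>n. p n \<in> dom \<kappa>" "(\<lambda>n. ract E \<eta> (p n)) \<longlonglongrightarrow> \<eta>"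
      using E.E.ract_approximate_unit[OF PAut_ideal(1)[OF P]] by blast
    have lim: "(\<lambda>n. tE (lact E b (ract E \<eta> (p n))) k) \<longlonglongrightarrow> tE (lact E b \<eta>) k"
      by (intro bounded_linear.tendsto[OF bl]
          bounded_linear.tendsto[OF bounded_bilinear.bounded_linear_right[OF E.E.bounded_bilinear_lact]] p(2))
    have "tE (lact E b (ract E \<eta> (p n))) k \<in> ?V" for n
    proof -
      \<comment> \<open>\<open>R_op\<close> only produces second legs in the range of
        \<open>\<upsilon> (pinv \<kappa>)\<close>. The approximate unit \<open>p\<close>, moved
        across the tensor sign from \<open>\<eta>\<close> to \<open>k\<close>, brings the second leg
        into it.\<close>
      have "\<pi> (p n) k \<in> range (\<upsilon> (pinv \<kappa>))"
        unfolding B.upsilon_range[OF \<theta>] ran_pinv[OF P] using p(1) by (intro closed_span_base) blast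
      then obtain k' where k': "\<pi> (p n) k = \<upsilon> (pinv \<kappa>) k'" by blast
      have "tE (lact E b (ract E \<eta> (p n))) k = R_op \<eta> (pinv \<kappa>) (tB b k')"
        by (simp add: E.E.lact_ract E.t_ract k' R_op[OF \<theta> \<eta>'])
      moreover have "R_op \<eta> (pinv \<kappa>) \<in> \<beta> \<Theta> \<upsilon> tB tE E"
        unfolding beta_eq using \<theta> \<eta>' by (intro closed_span_base) blast
      ultimately show ?thesis by (intro closed_span_base) blast
    qed
    then show ?thesis using closed_sequentially[OF closed_closed_span _ lim] by blast
  qed
  have lact: "tE (lact E b \<eta>) k \<in> ?V" for b \<eta>
  proof (rule closed_span_vimage[where f = "\<lambda>\<eta>. tE (lact E b \<eta>) k" and S = "\<Union>\<theta>\<in>\<Theta>. hom_elts \<theta> E"])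
    show "bounded_linear (\<lambda>\<eta>. tE (lact E b \<eta>) k)"
      by (rule bounded_linear_compose[OF bl bounded_bilinear.bounded_linear_right[OF E.E.bounded_bilinear_lact]])
    show "\<eta> \<in> \<lbrakk>\<Union>\<theta>\<in>\<Theta>. hom_elts \<theta> E\<rbrakk>" using decomposable by (simp add: decomposable_wrt_def)
    show "tE (lact E b s) k \<in> ?V" if "s \<in> (\<Union>\<theta>\<in>\<Theta>. hom_elts \<theta> E)" for s
      using that hom by blast
  qed (simp_all add: E.E.lact_scale_right E.T.t_scale_left)
  show "tE \<xi> k \<in> ?V"
  proof (rule closed_span_vimage[where f = "\<lambda>\<xi>. tE \<xi> k" and S = "{lact E b \<eta> | b \<eta>. True}", OF bl])
    show "\<xi> \<in> \<lbrakk>{lact E b \<eta> | b \<eta>. True}\<rbrakk>" using E.E.lact_nondegenerate by blast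
    show "tE s k \<in> ?V" if "s \<in> {lact E b \<eta> | b \<eta>. True}" for s using that lact by blast
  qed (simp_all add: E.T.t_scale_left)
qed simp_all

lemma adj_L_op_L_op: "adj (L_op \<xi>) o\<^sub>L L_op \<xi>' = B.left_op (ip E \<xi> \<xi>')"
proof (rule adj_compose_eqI_span[OF B.T.dense B.T.dense])
  fix s s' assume "s \<in> {tB b k | b k. True}" "s' \<in> {tB b k | b k. True}"
  then obtain b k b' k' where s: "s = tB b k" "s' = tB b' k'" by blast
  have "ip self_bimodule b (lact self_bimodule (ip E \<xi> \<xi>') b') = ip E (ract E \<xi> b) (ract E \<xi>' b')"
    by (simp add: self_bimodule_def E.E.ip_ract E.E.ip_ract_left mult.assoc)
  then show "cinner (L_op \<xi> s) (L_op \<xi>' s') = cinner s (B.left_op (ip E \<xi> \<xi>') s')"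
    by (simp add: s L_op B.left_op E.T.ip_t B.T.ip_t)
qed (simp_all add: L_op B.left_op)

text \<open>\<open>R_op\<close> multiplies by \<open>\<eta>\<close> from the right, which commutes
  with left multiplication. Together with \<open>adj_L_op_L_op\<close>, this yields the commutation
  required by \<open>relative_tensor_space\<close>.\<close>

lemma beta_intertwines:
  assumes d: "d \<in> \<beta> \<Theta> \<upsilon> tB tE E"
  shows "d o\<^sub>L B.left_op b = E.left_op b o\<^sub>L d"
proof -
  have "(d o\<^sub>L B.left_op b) - (E.left_op b o\<^sub>L d) \<in> {0}"
  proof (rule closed_span_vimage[where f = "\<lambda>d. (d o\<^sub>L B.left_op b) - (E.left_op b o\<^sub>L d)"])
    show "bounded_linear (\<lambda>d. (d o\<^sub>L B.left_op b) - (E.left_op b o\<^sub>L d))"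
      by (intro bounded_linear_sub bounded_bilinear.bounded_linear_left[OF bounded_bilinear_blinfun_compose]
          bounded_bilinear.bounded_linear_right[OF bounded_bilinear_blinfun_compose])
    show "(c *\<^sub>C x o\<^sub>L B.left_op b) - (E.left_op b o\<^sub>L c *\<^sub>C x) =
        c *\<^sub>C ((x o\<^sub>L B.left_op b) - (E.left_op b o\<^sub>L x))" for c x
      by (rule blinfun_eqI) (simp add: blinfun_apply_scaleC blinfun.diff_left clinear_opD[OF E.left_op(2)]
          cplx.scale_right_diff_distrib)
    show "csubspace {0 :: 'h \<Rightarrow>\<^sub>L 'ie}" by (intro csubspaceI) auto
    show "d \<in> \<lbrakk>{R_op \<eta> \<theta> | \<eta> \<theta>. \<theta> \<in> \<Theta> \<and> \<eta> \<in> hom_elts (pinv \<theta>) E}\<rbrakk>" using d by (simp add: beta_eq)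
    fix s assume "s \<in> {R_op \<eta> \<theta> | \<eta> \<theta>. \<theta> \<in> \<Theta> \<and> \<eta> \<in> hom_elts (pinv \<theta>) E}"
    then obtain \<eta> \<theta> where s: "s = R_op \<eta> \<theta>" "\<theta> \<in> \<Theta>" "\<eta> \<in> hom_elts (pinv \<theta>) E" by blast
    have "lact E (lact self_bimodule b c) \<eta> = lact E b (lact E c \<eta>)" for c
      by (simp add: self_bimodule_def E.E.lact_mult)
    then have "s o\<^sub>L B.left_op b = E.left_op b o\<^sub>L s"
      by (intro B.blinfun_eqI_tE) (simp add: s(1) R_op[OF s(2,3)] B.left_op E.left_op)
    then show "(s o\<^sub>L B.left_op b) - (E.left_op b o\<^sub>L s) \<in> {0}" by simp
  qed simp
  then show ?thesis by simp
qed

lemma beta_adj_intertwines: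
  assumes d: "d \<in> \<beta> \<Theta> \<upsilon> tB tE E"
  shows "B.left_op b o\<^sub>L adj d = adj d o\<^sub>L E.left_op b"
proof -
  note cd = clinear_beta[OF d]
  have "adj (d o\<^sub>L B.left_op (star b)) = adj (E.left_op (star b) o\<^sub>L d)"
    by (simp only: beta_intertwines[OF d])
  then show ?thesis by (simp add: adj_compose cd B.left_op E.left_op star_star)
qed

lemma left_op_commutes_beta:
  assumes "d \<in> \<beta> \<Theta> \<upsilon> tB tE E" "d' \<in> \<beta> \<Theta> \<upsilon> tB tE E"
  shows "B.left_op b (adj d (d' \<zeta>)) = adj d (E.left_op b (d' \<zeta>))"
    and "adj d (E.left_op b (d' \<zeta>)) = adj d (d' (B.left_op b \<zeta>))"
  using beta_adj_intertwines[OF assms(1), of b] beta_intertwines[OF assms(2), of b]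
  by (metis blinfun_apply_blinfun_compose)+

end

section \<open>The unitary and the inclusion\<close>

context bimod
begin

text \<open>Approximate \<open>\<eta>\<close> by \<open>ract E \<eta> (p n)\<close> with
  \<open>\<kappa> (p n) = Some q\<close>. Then \<open>v\<close> acting on it is \<open>v * q\<close>
  acting on \<open>\<eta>\<close>, hence \<open>\<eta>\<close> times the preimage of
  \<open>v * q\<close> under \<open>\<kappa>\<close>, an element of
  \<open>dom \<nu>\<close>.\<close>

lemma ip_lact_hom_elts:
  assumes \<kappa>: "\<kappa> \<in> PAut" and \<nu>: "\<nu> \<in> PAut" and I: "closed_ideal I"
    and dom: "dom \<nu> = {y. \<exists>x\<in>I. \<kappa> y = Some x}"
    and \<eta>: "\<eta> \<in> hom_elts \<kappa> E" and v: "v \<in> I"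
  shows "ip E \<zeta> (lact E v \<eta>) \<in> dom \<nu>"
proof -
  note K = closed_idealD[OF PAut_ideal(1)[OF \<nu>]]
  have "ip E \<eta> \<eta> \<in> dom \<kappa>"
    using \<eta> by (intro ip_in_ideal[OF PAut_ideal(1)[OF \<kappa>]]) (simp add: hom_elts_def)
  then obtain p :: "nat \<Rightarrow> 'b" where p: "\<And>n. p n \<in> dom \<kappa>" "(\<lambda>n. ract E \<eta> (p n)) \<longlonglongrightarrow> \<eta>"
    using ract_approximate_unit[OF PAut_ideal(1)[OF \<kappa>]] by blast
  have lim: "(\<lambda>n. ip E \<zeta> (lact E v (ract E \<eta> (p n)))) \<longlonglongrightarrow> ip E \<zeta> (lact E v \<eta>)"
    by (intro bounded_linear.tendsto[OF bounded_linear_ip_right]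
        bounded_linear.tendsto[OF bounded_bilinear.bounded_linear_right[OF bounded_bilinear_lact]] p(2))
  have "ip E \<zeta> (lact E v (ract E \<eta> (p n))) \<in> dom \<nu>" for n
  proof -
    obtain q where q: "\<kappa> (p n) = Some q" using p(1) by blast
    have h: "ract E \<eta> b = lact E b' \<eta>" if "\<kappa> b = Some b'" for b b'
      using \<eta> that by (simp add: hom_elts_def)
    have "v * q \<in> ran \<kappa>"
      using closed_idealD(4)[OF PAut_ideal(2)[OF \<kappa>]] ranI[of \<kappa>, OF q] by blast
    then obtain y where y: "\<kappa> y = Some (v * q)" by (auto simp: ran_def)
    have "y \<in> dom \<nu>" using y closed_idealD(3)[OF I v] dom by blast
    moreover have "lact E v (ract E \<eta> (p n)) = ract E \<eta> y"
      by (simp add: h[OF q] h[OF y] lact_mult)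
    ultimately show ?thesis using K by (simp add: ip_ract)
  qed
  then show ?thesis using closed_sequentially[OF K(2) _ lim] by blast
qed

text \<open>As \<open>z\<close> is approximated by sums of elements \<open>lact E b \<zeta>\<close>,
  the factor \<open>b\<close> can be moved to \<open>w\<close>, where it produces an element of
  \<open>I\<close> acting on \<open>\<eta>\<close>. It will be used for \<open>w = \<eta>\<close>
  and for \<open>w\<close> equal to a coefficient acting on \<open>\<eta>\<close>.\<close>

lemma ip_hom_elts_closed_span:
  assumes \<kappa>: "\<kappa> \<in> PAut" and \<nu>: "\<nu> \<in> PAut" and I: "closed_ideal I"
    and dom: "dom \<nu> = {y. \<exists>x\<in>I. \<kappa> y = Some x}" and \<eta>: "\<eta> \<in> hom_elts \<kappa> E"
    and z: "z \<in> \<lbrakk>{lact E b \<zeta> | b \<zeta>. b \<in> N}\<rbrakk>"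
    and w: "\<And>x. x \<in> N \<Longrightarrow> \<exists>v\<in>I. lact E (star x) w = lact E v \<eta>"
  shows "ip E z w \<in> dom \<nu>"
proof -
  note K = closed_idealD[OF PAut_ideal(1)[OF \<nu>]]
  have "ip E w z \<in> dom \<nu>"
  proof (rule closed_span_vimage[OF bounded_linear_ip_right ip_scale_right K(1,2) _ z])
    fix s assume "s \<in> {lact E b \<zeta> | b \<zeta>. b \<in> N}"
    then obtain b \<zeta> where s: "s = lact E b \<zeta>" "b \<in> N" by blast
    then obtain v where v: "v \<in> I" "lact E (star b) w = lact E v \<eta>" using w by blast
    have "ip E w s = ip E (lact E (star b) w) \<zeta>" by (simp add: s ip_lact)
    also have "\<dots> = star (ip E \<zeta> (lact E v \<eta>))" by (simp only: v(2) ip_star)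
    finally show "ip E w s \<in> dom \<nu>"
      using PAut_dom_star[OF \<nu> ip_lact_hom_elts[OF \<kappa> \<nu> I dom \<eta> v(1)]] by simp
  qed
  then show ?thesis using PAut_dom_star[OF \<nu>] ip_star by metis
qed

end

section \<open>The unitary \<open>\<tau>\<close> and the kets it transports\<close>

locale setting = E: based \<Theta> \<pi> \<upsilon> tB E tE + F: based \<Theta> \<pi> \<upsilon> tB F tF
    + X: induced \<Theta> \<pi> \<upsilon> X tX + EF: bimod_tensor E F X t
  for \<Theta> :: "('b::cstar_algebra \<rightharpoonup> 'b) set" and \<pi> :: "'b \<Rightarrow> 'k::chilbert_space \<Rightarrow>\<^sub>L 'k" and \<upsilon>
    and tB :: "'b \<Rightarrow> 'k \<Rightarrow> 'h::chilbert_space"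
    and E :: "('b, 'e::complex_banach) bimodule" and tE :: "'e \<Rightarrow> 'k \<Rightarrow> 'ie::chilbert_space"
    and F :: "('b, 'f::complex_banach) bimodule" and tF :: "'f \<Rightarrow> 'k \<Rightarrow> 'jf::chilbert_space"
    and X :: "('b, 'x::complex_banach) bimodule" and tX :: "'x \<Rightarrow> 'k \<Rightarrow> 'ix::chilbert_space"
    and t :: "'e \<Rightarrow> 'f \<Rightarrow> 'x" +
  fixes r :: "('h \<Rightarrow>\<^sub>L 'ie) \<Rightarrow> 'h \<Rightarrow> ('h \<Rightarrow>\<^sub>L 'jf) \<Rightarrow> 'r::chilbert_space"
  assumes relative_tensor: "relative_tensor (\<alpha> \<Theta> \<upsilon> tB tE E) (\<beta> \<Theta> \<upsilon> tB tF F) r"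
begin

abbreviation A where "A \<equiv> \<alpha> \<Theta> \<upsilon> tB tE E"
abbreviation D where "D \<equiv> \<beta> \<Theta> \<upsilon> tB tF F"

lemma commute_L_op:
  assumes d: "d \<in> D" "d' \<in> D" and a: "a \<in> A"
    and gen: "\<And>\<xi>. (adj a0 o\<^sub>L E.L_op \<xi>) o\<^sub>L (adj d o\<^sub>L d') = (adj d o\<^sub>L d') o\<^sub>L (adj a0 o\<^sub>L E.L_op \<xi>)"
    and a0: "a0 \<in> A"
  shows "(adj a0 o\<^sub>L a) o\<^sub>L (adj d o\<^sub>L d') = (adj d o\<^sub>L d') o\<^sub>L (adj a0 o\<^sub>L a)"
proof -
  let ?K = "adj d o\<^sub>L d'"
  have K: "clinear_op ?K" by (intro clinear_op_compose clinear_adj F.clinear_beta d)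
  have a0': "clinear_op (adj a0)" by (intro clinear_adj E.clinear_alpha a0)
  have bl: "bounded_linear (\<lambda>x. adj a0 o\<^sub>L x)"
    by (rule bounded_bilinear.bounded_linear_right[OF bounded_bilinear_blinfun_compose])
  show ?thesis
  proof (rule bounded_clinear_eqI_span[where f = "\<lambda>x. (adj a0 o\<^sub>L x) o\<^sub>L ?K" and g = "\<lambda>x. ?K o\<^sub>L (adj a0 o\<^sub>L x)"])
    show "bounded_linear (\<lambda>x. (adj a0 o\<^sub>L x) o\<^sub>L ?K)" "bounded_linear (\<lambda>x. ?K o\<^sub>L (adj a0 o\<^sub>L x))"
      by (rule bounded_linear_compose[OF _ bl] bounded_bilinear.bounded_linear_left[OF bounded_bilinear_blinfun_compose]
          bounded_bilinear.bounded_linear_right[OF bounded_bilinear_blinfun_compose])+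
    show "(adj a0 o\<^sub>L c *\<^sub>C x) o\<^sub>L ?K = c *\<^sub>C ((adj a0 o\<^sub>L x) o\<^sub>L ?K)"
      "?K o\<^sub>L (adj a0 o\<^sub>L c *\<^sub>C x) = c *\<^sub>C (?K o\<^sub>L (adj a0 o\<^sub>L x))" for c and x :: "'h \<Rightarrow>\<^sub>L 'ie"
      by (rule blinfun_eqI, simp add: blinfun_apply_scaleC clinear_opD[OF a0'] clinear_opD[OF K, simplified])+
    show "a \<in> \<lbrakk>range E.L_op\<rbrakk>" using a by (simp add: E.alpha_eq)
    show "(adj a0 o\<^sub>L s) o\<^sub>L ?K = ?K o\<^sub>L (adj a0 o\<^sub>L s)" if "s \<in> range E.L_op" for s
      using that gen by blast
  qed
qed

sublocale RT: relative_tensor_space A D r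
proof
  show "relative_tensor A D r" by (rule relative_tensor)
  show "csubspace A" "csubspace D" by (simp_all add: \<alpha>_def \<beta>_def J_def)
  show "\<lbrakk>{blinfun_apply a \<zeta> | a \<zeta>. a \<in> A}\<rbrakk> = UNIV" "\<lbrakk>{blinfun_apply d \<zeta> | d \<zeta>. d \<in> D}\<rbrakk> = UNIV"
    by (rule E.dense_alpha F.dense_beta)+
  have LL: "(adj (E.L_op \<xi>) o\<^sub>L E.L_op \<xi>') o\<^sub>L (adj d o\<^sub>L d') = (adj d o\<^sub>L d') o\<^sub>L (adj (E.L_op \<xi>) o\<^sub>L E.L_op \<xi>')"
    if "d \<in> D" "d' \<in> D" for \<xi> \<xi>' d d'
    unfolding E.adj_L_op_L_op
    by (rule blinfun_eqI) (simp add: F.left_op_commutes_beta[OF that])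
  have LA: "(adj (E.L_op \<xi>) o\<^sub>L a) o\<^sub>L (adj d o\<^sub>L d') = (adj d o\<^sub>L d') o\<^sub>L (adj (E.L_op \<xi>) o\<^sub>L a)"
    if "a \<in> A" "d \<in> D" "d' \<in> D" for \<xi> a d d'
    by (rule commute_L_op[OF that(2,3,1) LL[OF that(2,3)] E.L_op_in_alpha])
  \<comment> \<open>Only the second factor can be extended by linearity, the first being
    conjugate-linear; taking adjoints exchanges the two roles.\<close>
  have AL: "(adj a o\<^sub>L E.L_op \<xi>) o\<^sub>L (adj d o\<^sub>L d') = (adj d o\<^sub>L d') o\<^sub>L (adj a o\<^sub>L E.L_op \<xi>)"
    if "a \<in> A" "d \<in> D" "d' \<in> D" for \<xi> a d d'
  proof -
    note c = E.clinear_alpha[OF \<open>a \<in> A\<close>] E.L_op(2)[of \<xi>] F.clinear_beta[OF \<open>d \<in> D\<close>] F.clinear_beta[OF \<open>d' \<in> D\<close>]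
    have "adj ((adj (E.L_op \<xi>) o\<^sub>L a) o\<^sub>L (adj d' o\<^sub>L d)) = adj ((adj d' o\<^sub>L d) o\<^sub>L (adj (E.L_op \<xi>) o\<^sub>L a))"
      by (simp only: LA[OF that(1,3,2)])
    then show ?thesis
      by (simp add: adj_compose adj_adj clinear_op_compose clinear_adj c)
  qed
  show "(adj a o\<^sub>L a') o\<^sub>L (adj d o\<^sub>L d') = (adj d o\<^sub>L d') o\<^sub>L (adj a o\<^sub>L a')"
    if "a \<in> A" "a' \<in> A" "d \<in> D" "d' \<in> D" for a a' d d'
    by (rule commute_L_op[OF that(3,4,2) AL[OF that(1,3,4)] that(1)])
qed (simp_all add: E.clinear_alpha F.clinear_beta)

sublocale RT': relative_tensor_space D A "\<lambda>d \<zeta> a. r a \<zeta> d" by (rule RT.swap)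

text \<open>The operator that puts \<open>\<xi>\<close> in front of a vector of the induced space of
  \<open>F\<close>, in the form in which it occurs in \<open>\<tau>\<close>.\<close>

definition lam :: "'e \<Rightarrow> 'jf \<Rightarrow>\<^sub>L 'ix" where
  "lam \<xi> = tensor_op tF tX (Blinfun (t \<xi>)) id_blinfun"

lemma lam: "lam \<xi> (tF \<eta> k) = tX (t \<xi> \<eta>) k" "clinear_op (lam \<xi>)"
proof -
  let ?b = "ip E \<xi> \<xi>"
  note bl = bounded_bilinear.bounded_linear_right[OF EF.T.bounded_bilinear_t, of \<xi>]
  have "\<exists>Y. clinear_op Y \<and> (\<forall>\<eta> k. blinfun_apply Y (tF \<eta> k) = tX (t \<xi> \<eta>) k) \<and>
      norm Y \<le> 2 * sqrt (norm (l_mult F ?b))"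
  proof (rule F.E.T.positive_extension[OF hilbert_ip_cinner])
    show "clinear_op (l_mult F ?b)"
      by (simp add: clinear_op_def F.E.E.l_mult_apply F.E.E.lact_scale_right)
    show "ip F (l_mult F ?b x) y = ip F x (l_mult F ?b y)" for x y
      by (simp add: F.E.E.l_mult_apply F.E.E.ip_lact_left E.E.E.ip_star)
    show "tX (t \<xi> (c *\<^sub>C \<eta>)) k = c *\<^sub>C tX (t \<xi> \<eta>) k" for c \<eta> k
      by (simp add: EF.T.t_scale_right X.T.t_scale_left)
    show "cinner (tX (t \<xi> \<eta>) k) (tX (t \<xi> \<eta>') k') = cinner (tF \<eta> k) (tF (l_mult F ?b \<eta>') k')" for \<eta> k \<eta>' k'
      by (simp add: X.T.ip_t EF.T.ip_t F.E.T.ip_t F.E.E.l_mult_apply)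
  qed
  then obtain Y where Y: "clinear_op Y" "\<And>\<eta> k. blinfun_apply Y (tF \<eta> k) = tX (t \<xi> \<eta>) k" by blast
  have "lam \<xi> = Y"
    unfolding lam_def by (rule F.E.T.tensor_op_eqI) (simp add: Y bounded_linear_Blinfun_apply[OF bl])
  then show "lam \<xi> (tF \<eta> k) = tX (t \<xi> \<eta>) k" "clinear_op (lam \<xi>)" using Y by simp_all
qed

lemma adj_lam_lam: "adj (lam \<xi>) o\<^sub>L lam \<xi>' = F.E.left_op (ip E \<xi> \<xi>')"
proof (rule adj_compose_eqI_span[OF F.E.T.dense F.E.T.dense])
  fix s s' assume "s \<in> {tF \<eta> k | \<eta> k. True}" "s' \<in> {tF \<eta> k | \<eta> k. True}"
  then obtain \<eta> k \<eta>' k' where s: "s = tF \<eta> k" "s' = tF \<eta>' k'" by blast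
  show "cinner (lam \<xi> s) (lam \<xi>' s') = cinner s (F.E.left_op (ip E \<xi> \<xi>') s')"
    by (simp add: s lam F.E.left_op X.T.ip_t EF.T.ip_t F.E.T.ip_t)
qed (simp_all add: lam F.E.left_op)

lemma blinfun_eqI_tX:
  assumes Y: "clinear_op Y" and Z: "clinear_op Z"
    and eq: "\<And>\<xi> \<eta> k. blinfun_apply Y (tX (t \<xi> \<eta>) k) = blinfun_apply Z (tX (t \<xi> \<eta>) k)"
  shows "Y = Z"
proof (rule X.T.blinfun_eqI_t)
  fix x k
  note bl = bounded_bilinear.bounded_linear_left[OF X.T.bounded_bilinear_t, of k]
  show "Y (tX x k) = Z (tX x k)"
  proof (rule bounded_clinear_eqI_span[where S = "{t \<xi> \<eta> | \<xi> \<eta>. True}" and x = x])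
    show "bounded_linear (\<lambda>x. Y (tX x k))" "bounded_linear (\<lambda>x. Z (tX x k))"
      by (rule bounded_linear_compose[OF blinfun.bounded_linear_right bl])+
  qed (use eq in \<open>auto simp: X.T.t_scale_left clinear_opD[OF Y] clinear_opD[OF Z] EF.T.dense[simplified]\<close>)
qed

text \<open>\<open>r a \<zeta> d\<close> is linear and bounded in \<open>a\<close>, because it is a
  value of \<open>ket1 r D a\<close>; so \<open>a\<close> may be restricted to the generators of
  \<open>A\<close>.\<close>

lemma dense_L_op: "\<lbrakk>{r (E.L_op \<xi>) \<zeta> d | \<xi> \<zeta> d. d \<in> D}\<rbrakk> = UNIV"
proof -
  let ?V = "\<lbrakk>{r (E.L_op \<xi>) \<zeta> d | \<xi> \<zeta> d. d \<in> D}\<rbrakk>"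
  have "r a \<zeta> d \<in> ?V" if a: "a \<in> A" and d: "d \<in> D" for a \<zeta> d
  proof (rule closed_span_bounded_map[where f = "\<lambda>a. r a \<zeta> d" and A = A and S = "range E.L_op"
        and K = "4 * norm (blinfun_apply d \<zeta>)"])
    show "norm (r x \<zeta> d) \<le> 4 * norm (blinfun_apply d \<zeta>) * norm x" if "x \<in> A" for x
      using norm_blinfun[of "ket1 r D x" "blinfun_apply d \<zeta>"]
        mult_right_mono[OF RT.ket1(3)[OF that], of "norm (blinfun_apply d \<zeta>)"]
      by (simp add: RT.ket1(1)[OF that d] mult_ac)
    show "a \<in> \<lbrakk>range E.L_op\<rbrakk>" using a by (simp add: E.alpha_eq)
    show "r s \<zeta> d \<in> ?V" if "s \<in> range E.L_op" for s
      using that d by (intro closed_span_base) blast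
    show "range E.L_op \<subseteq> A" using E.L_op_in_alpha by blast
  qed (simp_all add: RT.csubspace_A RT.r_add RT.r_scale a d)
  then have "\<lbrakk>{r a \<zeta> d | a \<zeta> d. a \<in> A \<and> d \<in> D}\<rbrakk> \<subseteq> ?V"
    by (intro closed_span_minimal) auto
  then show ?thesis using RT.dense_r by auto
qed

lemma dense_lam: "\<lbrakk>{lam \<xi> (blinfun_apply d \<zeta>) | \<xi> \<zeta> d. d \<in> D}\<rbrakk> = UNIV"
proof -
  let ?V = "\<lbrakk>{lam \<xi> (blinfun_apply d \<zeta>) | \<xi> \<zeta> d. d \<in> D}\<rbrakk>"
  have 1: "lam \<xi> y \<in> ?V" for \<xi> y
  proof (rule closed_span_vimage[where f = "blinfun_apply (lam \<xi>)" and S = "{blinfun_apply d \<zeta> | d \<zeta>. d \<in> D}"])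
    show "y \<in> \<lbrakk>{blinfun_apply d \<zeta> | d \<zeta>. d \<in> D}\<rbrakk>" using F.dense_beta by blast
    show "lam \<xi> s \<in> ?V" if "s \<in> {blinfun_apply d \<zeta> | d \<zeta>. d \<in> D}" for s
      using that by (intro closed_span_base) blast
  qed (simp_all add: blinfun.bounded_linear_right clinear_opD[OF lam(2)])
  have 2: "tX x k \<in> ?V" for x k
  proof (rule closed_span_vimage[where f = "\<lambda>x. tX x k" and S = "{t \<xi> \<eta> | \<xi> \<eta>. True}"])
    show "bounded_linear (\<lambda>x. tX x k)" by (rule bounded_bilinear.bounded_linear_left[OF X.T.bounded_bilinear_t])
    show "x \<in> \<lbrakk>{t \<xi> \<eta> | \<xi> \<eta>. True}\<rbrakk>" using EF.T.dense by blast
    fix s assume "s \<in> {t \<xi> \<eta> | \<xi> \<eta>. True}"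
    then obtain \<xi> \<eta> where "s = t \<xi> \<eta>" by blast
    then show "tX s k \<in> ?V" using 1[of \<xi> "tF \<eta> k"] by (simp add: lam)
  qed (simp_all add: X.T.t_scale_left)
  have "\<lbrakk>{tX x k | x k. True}\<rbrakk> \<subseteq> ?V" by (rule closed_span_minimal) (use 2 in auto)
  then show ?thesis using X.T.dense by auto
qed

definition U :: "'r \<Rightarrow>\<^sub>L 'ix" where
  "U = \<tau> E t tB tE tF tX r D"

text \<open>Both Gram matrices contain left multiplication by \<open>ip E \<xi> \<xi>'\<close>, on
  one side acting after \<open>adj d o\<^sub>L d'\<close> and on the other between
  \<open>adj d\<close> and \<open>d'\<close>. They agree since operators in \<open>D\<close> and
  their adjoints intertwine left multiplications.\<close>

lemma unitary_U: "unitary_op U"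
  and U_r: "d \<in> D \<Longrightarrow> U (r (E.L_op \<xi>) \<zeta> d) = lam \<xi> (blinfun_apply d \<zeta>)"
proof -
  let ?I = "{p :: 'e \<times> 'h \<times> ('h \<Rightarrow>\<^sub>L 'jf). snd (snd p) \<in> D}"
  let ?g = "\<lambda>p. r (E.L_op (fst p)) (fst (snd p)) (snd (snd p))"
  let ?h = "\<lambda>p. lam (fst p) (blinfun_apply (snd (snd p)) (fst (snd p)))"
  have "\<exists>U. unitary_op U \<and> (\<forall>p\<in>?I. blinfun_apply U (?g p) = ?h p)"
  proof (rule isometry_extension)
    show "\<exists>q\<in>?I. ?g q = c *\<^sub>C ?g p \<and> ?h q = c *\<^sub>C ?h p" if "p \<in> ?I" for p c
      using that
      by (intro bexI[of _ "(fst p, c *\<^sub>C fst (snd p), snd (snd p))"])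
         (simp_all add: RT.r_scale_mid E.L_op_in_alpha clinear_opD[OF F.clinear_beta] clinear_opD[OF lam(2)])
    have "r (E.L_op \<xi>) \<zeta> d \<in> ?g ` ?I" "lam \<xi> (blinfun_apply d \<zeta>) \<in> ?h ` ?I" if "d \<in> D" for \<xi> \<zeta> d
      by (rule image_eqI[of _ _ "(\<xi>, \<zeta>, d)"]; use that in simp)+
    then have gh: "?g ` ?I = {r (E.L_op \<xi>) \<zeta> d | \<xi> \<zeta> d. d \<in> D}"
      "?h ` ?I = {lam \<xi> (blinfun_apply d \<zeta>) | \<xi> \<zeta> d. d \<in> D}" by auto
    show "\<lbrakk>?g ` ?I\<rbrakk> = UNIV" "\<lbrakk>?h ` ?I\<rbrakk> = UNIV" unfolding gh by (rule dense_L_op dense_lam)+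
    fix p q assume "p \<in> ?I" "q \<in> ?I"
    then obtain \<xi> \<zeta> d \<xi>' \<zeta>' d' where p: "p = (\<xi>, \<zeta>, d)" "d \<in> D" "q = (\<xi>', \<zeta>', d')" "d' \<in> D"
      by (metis mem_Collect_eq prod.collapse)
    let ?b = "ip E \<xi> \<xi>'"
    have l: "adj (lam \<xi>) (lam \<xi>' y) = F.E.left_op ?b y" for y
      using adj_lam_lam by (metis blinfun_apply_blinfun_compose)
    have L: "adj (E.L_op \<xi>) (E.L_op \<xi>' y) = E.B.left_op ?b y" for y
      using E.adj_L_op_L_op by (metis blinfun_apply_blinfun_compose)
    have "cinner (?h p) (?h q) = cinner (blinfun_apply d \<zeta>) (F.E.left_op ?b (blinfun_apply d' \<zeta>'))"
      by (simp add: p l[symmetric] cinner_adj_right[OF lam(2)])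
    also have "\<dots> = cinner \<zeta> (adj d (F.E.left_op ?b (blinfun_apply d' \<zeta>')))"
      by (simp add: cinner_adj_right[OF F.clinear_beta[OF p(2)]])
    also have "\<dots> = cinner (?g p) (?g q)"
      by (simp add: p RT.ip_r E.L_op_in_alpha L F.left_op_commutes_beta(1))
    finally show "cinner (?h p) (?h q) = cinner (?g p) (?g q)" .
  qed
  then obtain V where V: "unitary_op V" "\<And>p. p \<in> ?I \<Longrightarrow> blinfun_apply V (?g p) = ?h p" by blast
  have V': "blinfun_apply V (r (E.L_op \<xi>) \<zeta> d) = lam \<xi> (blinfun_apply d \<zeta>)" if "d \<in> D" for \<xi> \<zeta> d
    using V(2)[of "(\<xi>, \<zeta>, d)"] that by simp
  have "U = V"
    unfolding U_def \<tau>_def E.L_op_def[symmetric] lam_def[symmetric]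
  proof (rule the_equality)
    show "unitary_op V \<and> (\<forall>\<xi> \<zeta>. \<forall>d\<in>D. V (r (E.L_op \<xi>) \<zeta> d) = lam \<xi> (blinfun_apply d \<zeta>))"
      using V(1) V' by blast
    fix W assume W: "unitary_op W \<and> (\<forall>\<xi> \<zeta>. \<forall>d\<in>D. W (r (E.L_op \<xi>) \<zeta> d) = lam \<xi> (blinfun_apply d \<zeta>))"
    show "W = V"
    proof (rule blinfun_eqI_span[OF dense_L_op])
      fix c x assume "x \<in> {r (E.L_op \<xi>) \<zeta> d | \<xi> \<zeta> d. d \<in> D}"
      then obtain \<xi> \<zeta> d where x: "x = r (E.L_op \<xi>) \<zeta> d" "d \<in> D" by blast
      then have "c *\<^sub>C x = r (E.L_op \<xi>) (c *\<^sub>C \<zeta>) d" by (simp add: RT.r_scale_mid E.L_op_in_alpha)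
      then show "c *\<^sub>C x \<in> {r (E.L_op \<xi>) \<zeta> d | \<xi> \<zeta> d. d \<in> D}" using x(2) by blast
    qed (use W V' in auto)
  qed
  then show "unitary_op U" "d \<in> D \<Longrightarrow> U (r (E.L_op \<xi>) \<zeta> d) = lam \<xi> (blinfun_apply d \<zeta>)"
    using V(1) V' by simp_all
qed

lemma U_ket1: "U o\<^sub>L ket1 r D (E.L_op \<xi>) = lam \<xi>"
  by (rule RT.eqI_D) (simp add: RT.ket1 E.L_op_in_alpha U_r)

lemma R_op_in_beta: "\<theta> \<in> \<Theta> \<Longrightarrow> \<eta> \<in> hom_elts (pinv \<theta>) F \<Longrightarrow> F.R_op \<eta> \<theta> \<in> D"
  unfolding F.beta_eq by (intro closed_span_base) blast

text \<open>\<open>ket2\<close> is known on vectors \<open>L_op \<xi> (tB b k)\<close>, that is, on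
  \<open>ract E \<xi> b\<close> in the first leg; there the balancing of \<open>t\<close> moves
  \<open>b\<close> onto \<open>\<eta>\<close>. Such elements span a dense subspace of
  \<open>E\<close>.\<close>

lemma U_ket2:
  assumes \<theta>: "\<theta> \<in> \<Theta>" and \<eta>: "\<eta> \<in> hom_elts (pinv \<theta>) F"
  shows "U (ket2 r A (F.R_op \<eta> \<theta>) (tE \<xi> k)) = tX (t \<xi> \<eta>) (\<upsilon> \<theta> k)"
proof -
  note R = R_op_in_beta[OF \<theta> \<eta>]
  let ?k = "ket2 r A (F.R_op \<eta> \<theta>)"
  have ck: "clinear_op ?k" unfolding ket2_eq_ket1 by (rule RT'.ket1(2)[OF R])
  note cU = unitary_adj(3)[OF unitary_U]
  have base: "U (?k (tE (ract E \<xi> b) k)) = tX (t (ract E \<xi> b) \<eta>) (\<upsilon> \<theta> k)" for \<xi> b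
  proof -
    have "?k (E.L_op \<xi> (tB b k)) = r (E.L_op \<xi>) (tB b k) (F.R_op \<eta> \<theta>)"
      unfolding ket2_eq_ket1 by (rule RT'.ket1(1)[OF R E.L_op_in_alpha])
    then show ?thesis
      by (simp add: E.L_op U_r[OF R] F.R_op[OF \<theta> \<eta>] lam EF.t_ract)
  qed
  show ?thesis
  proof (rule bounded_clinear_eqI_span[where S = "{ract E \<xi> b | \<xi> b. True}" and x = \<xi>])
    show "bounded_linear (\<lambda>\<xi>. U (?k (tE \<xi> k)))"
      by (intro bounded_linear_compose[OF blinfun.bounded_linear_right]
          bounded_bilinear.bounded_linear_left[OF E.E.T.bounded_bilinear_t])
    show "bounded_linear (\<lambda>\<xi>. tX (t \<xi> \<eta>) (\<upsilon> \<theta> k))"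
      by (rule bounded_linear_compose[OF bounded_bilinear.bounded_linear_left[OF X.T.bounded_bilinear_t]
            bounded_bilinear.bounded_linear_left[OF EF.T.bounded_bilinear_t]])
    show "\<xi> \<in> \<lbrakk>{ract E \<xi> b | \<xi> b. True}\<rbrakk>" using E.E.E.ract_span_UNIV by blast
  qed (use base in \<open>auto simp: E.E.T.t_scale_left X.T.t_scale_left EF.T.t_scale_left
      clinear_opD[OF ck] clinear_opD[OF cU]\<close>)
qed

section \<open>The operators induced by \<open>c \<otimes> d\<close> and their action on
  kets\<close>

abbreviation fiber_op where
  "fiber_op c d \<sigma> \<equiv> tensor_op tX tX (tensor_op t t c d) (\<upsilon> \<sigma>)"

lemma fiber_op:
  assumes tens: "EF.tensorable \<mu> c c' \<rho> \<sigma> d d'" and \<sigma>: "\<sigma> \<in> \<Theta>"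
  shows "fiber_op c d \<sigma> (tX (t \<xi> \<eta>) k) = tX (t (c \<xi>) (d \<eta>)) (\<upsilon> \<sigma> k)"
    "clinear_op (fiber_op c d \<sigma>)"
    "norm (fiber_op c d \<sigma>) \<le> 32 * norm c * norm d"
    "adj (fiber_op c d \<sigma>) = fiber_op c' d' (pinv \<sigma>)"
proof -
  note h = EF.tensor_op_adjoint[OF tens] and T = EF.tensor_op_tensorable[OF tens]
  note I = X.EE.induced_op[OF \<sigma> h]
  show "fiber_op c d \<sigma> (tX (t \<xi> \<eta>) k) = tX (t (c \<xi>) (d \<eta>)) (\<upsilon> \<sigma> k)"
    by (simp add: I T)
  show "clinear_op (fiber_op c d \<sigma>)" by (rule I)
  show "norm (fiber_op c d \<sigma>) \<le> 32 * norm c * norm d"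
    using I(3) T(3) by linarith
  show "adj (fiber_op c d \<sigma>) = fiber_op c' d' (pinv \<sigma>)"
    by (rule X.EE.adj_induced_op[OF \<sigma> h])
qed

lemma tensorableD:
  assumes "EF.tensorable \<mu> c c' \<rho> \<sigma> d d'"
  shows "\<mu> \<in> PAut" "\<rho> \<in> PAut" "\<sigma> \<in> PAut" "compatible \<mu> \<rho>"
    "hom_adjoint \<mu> E E c c'" "hom_adjoint \<sigma> F F d d'"
    "d \<in> hom_ops F F \<rho> \<sigma>" "d' x \<in> \<lbrakk>{lact F b \<zeta> | b \<zeta>. b \<in> dom \<rho>}\<rbrakk>"
proof -
  have "\<rho> \<in> PAut" using assms by (simp add: EF.tensorable_def)
  then have "range d' \<subseteq> \<lbrakk>{lact F b \<zeta> | b \<zeta>. b \<in> dom \<rho>}\<rbrakk>"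
    using assms by (simp add: EF.tensorable_def hom_ops_def ran_pinv)
  then show "d' x \<in> \<lbrakk>{lact F b \<zeta> | b \<zeta>. b \<in> dom \<rho>}\<rbrakk>" by blast
qed (use assms in \<open>simp_all add: EF.tensorable_def\<close>)

text \<open>The twisted commutation is a direct composition of the three relations. The support
  condition needs more: \<open>ip F (d \<eta>) (d \<eta>)\<close> is the image under
  \<open>\<sigma>\<close> of \<open>ip F (d' (d \<eta>)) \<eta>\<close>, and since \<open>d'\<close>
  takes values in the submodule generated by \<open>dom \<rho>\<close>, the latter lies in the
  domain of \<open>\<rho> \<circ>\<^sub>m pinv \<theta>\<close>. An approximate unit then puts
  \<open>d \<eta>\<close> into the submodule.\<close>

lemma hom_elts_image:
  assumes tens: "EF.tensorable \<mu> c c' \<rho> \<sigma> d d'" and Th: "\<rho> \<in> \<Theta>" "\<sigma> \<in> \<Theta>" "\<theta> \<in> \<Theta>"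
    and \<eta>: "\<eta> \<in> hom_elts (pinv \<theta>) F"
  shows "d \<eta> \<in> hom_elts (pinv (\<sigma> \<circ>\<^sub>m \<theta> \<circ>\<^sub>m pinv \<rho>)) F"
proof -
  let ?\<theta> = "\<sigma> \<circ>\<^sub>m \<theta> \<circ>\<^sub>m pinv \<rho>"
  note Td = tensorableD[OF tens]
  have \<theta>': "?\<theta> \<in> \<Theta>" by (intro E.B.Theta_comp E.B.Theta_pinv Th)
  note P = E.B.Theta_PAut[OF \<theta>'] and P\<theta> = E.B.Theta_PAut[OF Th(3)]
  have \<theta>'_I: "?\<theta> b' = Some b" if "\<rho> x = Some b'" "\<theta> x = Some y" "\<sigma> y = Some b" for b' b x y
    using that by (simp add: map_comp_Some_iff pinv_eq_Some_iff Td)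
  have "ip F (d' (d \<eta>)) \<eta> \<in> dom (\<rho> \<circ>\<^sub>m pinv \<theta>)"
  proof (rule F.E.E.ip_hom_elts_closed_span[OF _ _ _ _ \<eta> Td(8), where I = "dom \<rho>"])
    show "pinv \<theta> \<in> PAut" "\<rho> \<circ>\<^sub>m pinv \<theta> \<in> PAut"
      by (intro E.B.Theta_PAut E.B.Theta_comp E.B.Theta_pinv Th)+
    show "closed_ideal (dom \<rho>)" by (rule PAut_ideal[OF Td(2)])
    show "dom (\<rho> \<circ>\<^sub>m pinv \<theta>) = {y. \<exists>x\<in>dom \<rho>. pinv \<theta> y = Some x}"
      by (auto simp: dom_def map_comp_Some_iff)
    show "\<exists>v\<in>dom \<rho>. lact F (star x) \<eta> = lact F v \<eta>" if "x \<in> dom \<rho>" for x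
      using PAut_dom_star[OF Td(2) that] by blast
  qed
  then obtain x z where x: "pinv \<theta> (ip F (d' (d \<eta>)) \<eta>) = Some x" "\<rho> x = Some z"
    by (auto simp: dom_def map_comp_Some_iff)
  then have "?\<theta> z = Some (ip F (d \<eta>) (d \<eta>))"
    by (intro \<theta>'_I[OF x(2) _ hom_adjointD[OF Td(6)]]) (simp add: pinv_eq_Some_iff P\<theta>)
  then have ran: "ip F (d \<eta>) (d \<eta>) \<in> ran ?\<theta>" by (rule ranI)
  obtain p :: "nat \<Rightarrow> 'b" where p: "\<And>n. p n \<in> ran ?\<theta>" "(\<lambda>n. ract F (d \<eta>) (p n)) \<longlonglongrightarrow> d \<eta>"
    using F.E.E.ract_approximate_unit[OF PAut_ideal(2)[OF P] ran] by blast
  have "ract F (d \<eta>) (p n) \<in> \<lbrakk>{ract F \<xi> b | \<xi> b. b \<in> ran ?\<theta>}\<rbrakk>" for n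
    using p(1) by (intro closed_span_base) blast
  then have 1: "d \<eta> \<in> \<lbrakk>{ract F \<xi> b | \<xi> b. b \<in> ran ?\<theta>}\<rbrakk>"
    by (rule closed_sequentially[OF closed_closed_span _ p(2)])
  have 2: "ract F (d \<eta>) b = lact F b' (d \<eta>)" if b: "?\<theta> b' = Some b" for b b'
  proof -
    obtain x y where xy: "\<rho> x = Some b'" "\<theta> x = Some y" "\<sigma> y = Some b"
      using b by (auto simp: map_comp_Some_iff pinv_eq_Some_iff Td)
    have "ract F \<eta> y = lact F x \<eta>"
      using \<eta> xy(2) by (simp add: hom_elts_def pinv_eq_Some_iff P\<theta>)
    moreover have "d (lact F x \<eta>) = lact F b' (d \<eta>)" using Td(7) xy(1) by (simp add: hom_ops_def)
    ultimately show ?thesis using F.E.EE.EF.hom_adjoint_ract[OF Td(3,6) xy(3), of \<eta>] by simp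
  qed
  show ?thesis using 1 2 by (simp add: hom_elts_def pinv_eq_Some_iff P)
qed

text \<open>With \<open>a = ip E (c' (c \<xi>)) \<xi>\<close>, the inner square is the image under
  \<open>\<sigma>\<close> of \<open>ip F (d' (d \<eta>)) (lact F a \<eta>)\<close>. Both
  \<open>dom \<rho>\<close>, through \<open>d'\<close>, and \<open>dom \<mu>\<close>, through
  \<open>a\<close>, restrict this element.\<close>

lemma ip_tensor_image:
  assumes tens: "EF.tensorable \<mu> c c' \<rho> \<sigma> d d'" and Th: "\<mu> \<in> \<Theta>" "\<rho> \<in> \<Theta>" "\<theta> \<in> \<Theta>"
    and \<eta>: "\<eta> \<in> hom_elts (pinv \<theta>) F"
  shows "ip X (t (c \<xi>) (d \<eta>)) (t (c \<xi>) (d \<eta>)) \<in> ran (\<sigma> \<circ>\<^sub>m \<theta> \<circ>\<^sub>m (pinv \<rho> \<circ>\<^sub>m \<mu>))"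
proof -
  let ?e = "pinv \<rho> \<circ>\<^sub>m \<mu>"
  note Td = tensorableD[OF tens] and P\<theta> = E.B.Theta_PAut[OF Th(3)]
  have e: "?e \<in> \<Theta>" by (intro E.B.Theta_comp E.B.Theta_pinv Th)
  have comp: "(\<forall>x y z. \<mu> x = Some y \<longrightarrow> \<rho> x = Some z \<longrightarrow> y = z) \<and> (\<forall>x y z. \<mu> x = Some z \<longrightarrow> \<rho> y = Some z \<longrightarrow> x = y)"
    using Td(4) compatible_iff[OF Td(1,2)] by blast
  define a where "a = ip E (c' (c \<xi>)) \<xi>"
  have a: "\<mu> a = Some (ip E (c \<xi>) (c \<xi>))" unfolding a_def by (rule hom_adjointD[OF Td(5)])
  have "ip X (t (c \<xi>) (d \<eta>)) (t (c \<xi>) (d \<eta>)) = ip F (d \<eta>) (d (lact F a \<eta>))"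
    unfolding EF.T.ip_t F.E.EE.EF.hom_ops_compatible[OF Td(1,2,4,7) a] ..
  then have y: "\<sigma> (ip F (d' (d \<eta>)) (lact F a \<eta>)) = Some (ip X (t (c \<xi>) (d \<eta>)) (t (c \<xi>) (d \<eta>)))"
    by (simp only: hom_adjointD[OF Td(6)])
  have "ip F (d' (d \<eta>)) (lact F a \<eta>) \<in> dom (?e \<circ>\<^sub>m pinv \<theta>)"
  proof (rule F.E.E.ip_hom_elts_closed_span[OF _ _ _ _ \<eta> Td(8), where I = "dom ?e"])
    show "pinv \<theta> \<in> PAut" "?e \<circ>\<^sub>m pinv \<theta> \<in> PAut"
      by (intro E.B.Theta_PAut E.B.Theta_comp E.B.Theta_pinv Th)+
    show "closed_ideal (dom ?e)" by (rule PAut_ideal[OF E.B.Theta_PAut[OF e]])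
    show "dom (?e \<circ>\<^sub>m pinv \<theta>) = {y. \<exists>x\<in>dom ?e. pinv \<theta> y = Some x}"
      by (auto simp: dom_def map_comp_Some_iff[of ?e "pinv \<theta>"])
    fix x assume x: "x \<in> dom \<rho>"
    \<comment> \<open>On the common domain the compatible maps \<open>\<mu>\<close> and
      \<open>\<rho>\<close> agree, so \<open>pinv \<rho> \<circ>\<^sub>m \<mu>\<close> fixes
      \<open>star x * a\<close>.\<close>
    have "star x * a \<in> dom \<rho>" "star x * a \<in> dom \<mu>"
      using closed_idealD(3)[OF PAut_ideal(1)[OF Td(2)] PAut_dom_star[OF Td(2) x]]
        closed_idealD(4)[OF PAut_ideal(1)[OF Td(1)], of a] a by auto
    then obtain u v where uv: "\<rho> (star x * a) = Some u" "\<mu> (star x * a) = Some v" by blast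
    then have "v = u" using comp by blast
    then have "?e (star x * a) = Some (star x * a)"
      using uv by (simp add: map_comp_Some_iff pinv_eq_Some_iff Td)
    then show "\<exists>v\<in>dom ?e. lact F (star x) (lact F a \<eta>) = lact F v \<eta>"
      by (intro bexI[of _ "star x * a"]) (auto simp: F.E.E.lact_mult)
  qed
  then obtain x z where x: "pinv \<theta> (ip F (d' (d \<eta>)) (lact F a \<eta>)) = Some x" "?e x = Some z"
    by (auto simp: dom_def map_comp_Some_iff[of ?e "pinv \<theta>"])
  obtain w where "\<mu> x = Some w" "\<rho> z = Some w"
    using x(2) by (auto simp: map_comp_Some_iff pinv_eq_Some_iff Td)
  then have "z = x" using comp by metis
  then have "(\<sigma> \<circ>\<^sub>m \<theta> \<circ>\<^sub>m ?e) x = Some (ip X (t (c \<xi>) (d \<eta>)) (t (c \<xi>) (d \<eta>)))"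
    using x y by (simp add: map_comp_Some_iff[of _ ?e] map_comp_Some_iff[of \<sigma> \<theta>] pinv_eq_Some_iff P\<theta>)
  then show ?thesis by (rule ranI)
qed

lemma map_comp_pinv_le:
  assumes "\<mu> \<in> PAut" "\<rho> \<in> PAut" "compatible \<mu> \<rho>"
  shows "g \<circ>\<^sub>m (pinv \<rho> \<circ>\<^sub>m \<mu>) \<subseteq>\<^sub>m g"
proof -
  have "x = y" if "\<mu> x = Some z" "\<rho> y = Some z" for x y z
    using assms(3) that unfolding compatible_iff[OF assms(1,2)] by blast
  then show ?thesis
    by (fastforce simp: map_le_iff map_comp_Some_iff pinv_eq_Some_iff assms)
qed

lemma fiber_op_ket1:
  assumes tens: "EF.tensorable \<mu> c c' \<rho> \<sigma> d d'" and \<sigma>: "\<sigma> \<in> \<Theta>"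
  shows "(adj U o\<^sub>L fiber_op c d \<sigma> o\<^sub>L U) o\<^sub>L ket1 r D (E.L_op \<xi>) =
    ket1 r D (E.L_op (c \<xi>)) o\<^sub>L tensor_op tF tF d (\<upsilon> \<sigma>)"
proof -
  let ?Y = "fiber_op c d \<sigma>" and ?d = "tensor_op tF tF d (\<upsilon> \<sigma>)"
  have k: "U (ket1 r D (E.L_op \<xi>) y) = lam \<xi> y" for \<xi> y
    using U_ket1 by (metis blinfun_apply_blinfun_compose)
  have YL: "?Y o\<^sub>L lam \<xi> = lam (c \<xi>) o\<^sub>L ?d"
    by (rule F.E.T.blinfun_eqI_t)
       (simp add: lam fiber_op[OF tens \<sigma>] F.E.EE.induced_op[OF \<sigma> tensorableD(6)[OF tens]])
  have Y: "?Y (lam \<xi> y) = lam (c \<xi>) (?d y)" for y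
    using arg_cong[OF YL, of "\<lambda>T. blinfun_apply T y"] by simp
  show ?thesis
  proof (rule blinfun_eqI)
    fix y
    have "adj U (lam (c \<xi>) (?d y)) = ket1 r D (E.L_op (c \<xi>)) (?d y)"
      by (simp add: unitary_adj(1)[OF unitary_U] flip: k)
    then show "blinfun_apply ((adj U o\<^sub>L ?Y o\<^sub>L U) o\<^sub>L ket1 r D (E.L_op \<xi>)) y =
        blinfun_apply (ket1 r D (E.L_op (c \<xi>)) o\<^sub>L ?d) y"
      by (simp add: k Y)
  qed
qed

lemma fiber_op_ket2:
  assumes tens: "EF.tensorable \<mu> c c' \<rho> \<sigma> d d'" and Th: "\<mu> \<in> \<Theta>" "\<rho> \<in> \<Theta>" "\<sigma> \<in> \<Theta>" "\<theta> \<in> \<Theta>"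
    and \<eta>: "\<eta> \<in> hom_elts (pinv \<theta>) F"
  shows "(adj U o\<^sub>L fiber_op c d \<sigma> o\<^sub>L U) o\<^sub>L ket2 r A (F.R_op \<eta> \<theta>) =
    ket2 r A (F.R_op (d \<eta>) (\<sigma> \<circ>\<^sub>m \<theta> \<circ>\<^sub>m pinv \<rho>)) o\<^sub>L tensor_op tE tE c (\<upsilon> \<mu>)"
proof -
  let ?Y = "fiber_op c d \<sigma>" and ?c = "tensor_op tE tE c (\<upsilon> \<mu>)"
  let ?\<theta> = "\<sigma> \<circ>\<^sub>m \<theta> \<circ>\<^sub>m pinv \<rho>" and ?g = "\<sigma> \<circ>\<^sub>m \<theta>"
  note Td = tensorableD[OF tens]
  have \<theta>': "?\<theta> \<in> \<Theta>" and g: "?g \<in> \<Theta>" and ge: "?g \<circ>\<^sub>m (pinv \<rho> \<circ>\<^sub>m \<mu>) \<in> \<Theta>"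
    by (intro E.B.Theta_comp E.B.Theta_pinv Th)+
  have assoc: "?\<theta> \<circ>\<^sub>m \<mu> = ?g \<circ>\<^sub>m (pinv \<rho> \<circ>\<^sub>m \<mu>)"
    by (auto simp: map_comp_def split: option.splits)
  show ?thesis
  proof (rule E.E.T.blinfun_eqI_t)
    fix \<xi> k
    let ?x = "t (c \<xi>) (d \<eta>)"
    have "?Y (U (ket2 r A (F.R_op \<eta> \<theta>) (tE \<xi> k))) = tX ?x (\<upsilon> ?g k)"
      by (simp add: U_ket2[OF Th(4) \<eta>] fiber_op[OF tens Th(3)] E.B.upsilon_upsilon Th)
    \<comment> \<open>The only point where the two sides differ: the index shrinks from
      \<open>?g\<close> to \<open>?g \<circ>\<^sub>m (pinv \<rho> \<circ>\<^sub>m \<mu>)\<close>,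
      which \<open>?x\<close> cannot detect because its inner square lies in the range of the
      smaller one.\<close>
    also have "\<dots> = tX ?x (\<upsilon> (?g \<circ>\<^sub>m (pinv \<rho> \<circ>\<^sub>m \<mu>)) k)"
      by (rule X.t_upsilon_mono[OF ge g map_comp_pinv_le[OF Td(1,2,4)] ip_tensor_image[OF tens Th(1,2,4) \<eta>]])
    also have "\<dots> = U (ket2 r A (F.R_op (d \<eta>) ?\<theta>) (?c (tE \<xi> k)))"
      by (simp add: E.E.EE.induced_op[OF Th(1) Td(5)] U_ket2[OF \<theta>' hom_elts_image[OF tens Th(2,3,4) \<eta>]]
          E.B.upsilon_upsilon[OF \<theta>' Th(1)] assoc)
    finally show "blinfun_apply ((adj U o\<^sub>L ?Y o\<^sub>L U) o\<^sub>L ket2 r A (F.R_op \<eta> \<theta>)) (tE \<xi> k) =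
        blinfun_apply (ket2 r A (F.R_op (d \<eta>) ?\<theta>) o\<^sub>L ?c) (tE \<xi> k)"
      by (simp add: unitary_adj(1)[OF unitary_U])
  qed
qed

section \<open>From operators \<open>c \<otimes> d\<close> to the closed families\<close>

context
  fixes C :: "('b, 'e, 'e) opfam" and G :: "('b, 'f, 'f) opfam"
  assumes C: "admissible_family \<Theta> E C" and G: "admissible_family \<Theta> F G"
begin

lemma families: "cstar_family E C" "cstar_family F G" "fam_supported_by \<Theta> C" "fam_supported_by \<Theta> G"
  using C G by (auto simp: admissible_family_def)

lemma tensorable_families:
  assumes P: "\<rho>1 \<in> PAut" "\<mu> \<in> PAut" "\<rho> \<in> PAut" "\<sigma> \<in> PAut" "compatible \<mu> \<rho>"
    and c: "c \<in> C \<rho>1 \<mu>" and d: "d \<in> G \<rho> \<sigma>"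
  shows "\<exists>c'\<in>C (pinv \<rho>1) (pinv \<mu>). \<exists>d'\<in>G (pinv \<rho>) (pinv \<sigma>). EF.tensorable \<mu> c c' \<rho> \<sigma> d d'"
proof -
  obtain c' where c': "c' \<in> C (pinv \<rho>1) (pinv \<mu>)" "hom_adjoint \<mu> E E c c'"
    using E.E.E.cstar_family_adjoint[OF families(1) P(1,2) c] by blast
  obtain d' where d': "d' \<in> G (pinv \<rho>) (pinv \<sigma>)" "hom_adjoint \<sigma> F F d d'"
    using F.E.E.cstar_family_adjoint[OF families(2) P(3,4) d] by blast
  have "EF.tensorable \<mu> c c' \<rho> \<sigma> d d'"
    unfolding EF.tensorable_def
    using P c'(2) d'(2) F.E.E.cstar_family_hom_ops[OF families(2) P(3,4) d]
      F.E.E.cstar_family_hom_ops[OF families(2) pinv_PAut pinv_PAut d'(1)] by blast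
  then show ?thesis using c'(1) d'(1) by blast
qed

text \<open>In \<open>fam_fiber_product\<close> the middle indices range over all of
  \<open>PAut\<close>. Here they lie in \<open>\<Theta>\<close>, so that
  \<open>\<upsilon> \<mu>\<close> can be formed and the induced operators of \<open>c\<close> and
  \<open>d\<close> belong to the respective \<open>J\<close>.\<close>

definition generators :: "('ix \<Rightarrow>\<^sub>L 'ix) set" where
  "generators = {fiber_op c d \<sigma> | c d \<rho>1 \<mu> \<rho> \<sigma>.
     \<rho>1 \<in> \<Theta> \<and> \<mu> \<in> \<Theta> \<and> \<rho> \<in> \<Theta> \<and> \<sigma> \<in> \<Theta> \<and> compatible \<mu> \<rho> \<and> c \<in> C \<rho>1 \<mu> \<and> d \<in> G \<rho> \<sigma>}"

text \<open>The fiber product imposes conditions on \<open>T\<close> and on \<open>adj T\<close>.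
  Stability under adjoints makes the second set of conditions an instance of the first.\<close>

lemma adj_generators:
  assumes "Y \<in> \<lbrakk>generators\<rbrakk>" shows "clinear_op Y" "adj Y \<in> \<lbrakk>generators\<rbrakk>"
proof -
  have gen: "clinear_op Y \<and> adj Y \<in> \<lbrakk>generators\<rbrakk>" if Y: "Y \<in> generators" for Y
  proof -
    obtain c d \<rho>1 \<mu> \<rho> \<sigma> where *: "Y = fiber_op c d \<sigma>"
      "\<rho>1 \<in> \<Theta>" "\<mu> \<in> \<Theta>" "\<rho> \<in> \<Theta>" "\<sigma> \<in> \<Theta>" "compatible \<mu> \<rho>" "c \<in> C \<rho>1 \<mu>" "d \<in> G \<rho> \<sigma>"
      using Y unfolding generators_def by blast
    note P = *(2-5)[THEN E.B.Theta_PAut]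
    obtain c' d' where c': "c' \<in> C (pinv \<rho>1) (pinv \<mu>)" "d' \<in> G (pinv \<rho>) (pinv \<sigma>)"
      and tens: "EF.tensorable \<mu> c c' \<rho> \<sigma> d d'"
      using tensorable_families[OF P *(6-8)] by blast
    have "fiber_op c' d' (pinv \<sigma>) \<in> generators"
      unfolding generators_def
      using c' *(2-5)[THEN E.B.Theta_pinv] compatible_pinv[OF P(2,3) *(6)] by blast
    then show ?thesis
      unfolding *(1) using fiber_op(2,4)[OF tens *(5)] by (simp add: closed_span_base)
  qed
  show "clinear_op Y" "adj Y \<in> \<lbrakk>generators\<rbrakk>"
    by (rule adj_closed_span[OF csubspace_closed_span closed_closed_span gen assms]; assumption)+
qed

lemma family_subspace:
  assumes "\<rho> \<in> PAut" "\<sigma> \<in> PAut" shows "csubspace (C \<rho> \<sigma>)" "csubspace (G \<rho> \<sigma>)"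
  using families(1,2) assms by (auto simp: cstar_family_def op_family_def)

lemma tensorable_ex:
  assumes "\<rho>1 \<in> PAut" "\<mu> \<in> PAut" "\<rho> \<in> PAut" "\<sigma> \<in> PAut" "compatible \<mu> \<rho>" "c \<in> C \<rho>1 \<mu>" "d \<in> G \<rho> \<sigma>"
  obtains c' d' where "EF.tensorable \<mu> c c' \<rho> \<sigma> d d'"
  using tensorable_families[OF assms] by blast

text \<open>As \<open>G\<close> is supported by \<open>\<Theta>\<close>, \<open>d\<close> is
  approximated by operators with smaller indices in \<open>\<Theta>\<close>. Compatibility survives
  the shrinking of \<open>\<rho>\<close>.\<close>

lemma generators_right:
  assumes Th: "\<rho>1 \<in> \<Theta>" "\<mu> \<in> \<Theta>" "\<sigma> \<in> \<Theta>" and \<rho>: "\<rho> \<in> PAut" and comp: "compatible \<mu> \<rho>"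
    and c: "c \<in> C \<rho>1 \<mu>" and d: "d \<in> G \<rho> \<sigma>"
  shows "fiber_op c d \<sigma> \<in> \<lbrakk>generators\<rbrakk>"
proof -
  note P = Th[THEN E.B.Theta_PAut]
  let ?S = "{T. \<exists>\<rho>'\<in>\<Theta>. \<exists>\<sigma>'\<in>\<Theta>. \<rho>' \<subseteq>\<^sub>m \<rho> \<and> \<sigma>' \<subseteq>\<^sub>m \<sigma> \<and> T \<in> G \<rho>' \<sigma>'}"
  have G_eq: "G \<rho> \<sigma> = \<lbrakk>?S\<rbrakk>" using families(4) \<rho> P(3) by (simp add: fam_supported_by_def)
  note sub = family_subspace(2)[OF \<rho> P(3)]
  let ?f = "\<lambda>d. fiber_op c d \<sigma>"
  have f: "?f d (tX (t \<xi> \<eta>) k) = tX (t (c \<xi>) (d \<eta>)) (\<upsilon> \<sigma> k)" "clinear_op (?f d)"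
    "norm (?f d) \<le> 32 * norm c * norm d" if d: "d \<in> G \<rho> \<sigma>" for d \<xi> \<eta> k
  proof -
    obtain c' d' where "EF.tensorable \<mu> c c' \<rho> \<sigma> d d'"
      using tensorable_ex[OF P(1,2) \<rho> P(3) comp c d] .
    from fiber_op[OF this Th(3)]
    show "?f d (tX (t \<xi> \<eta>) k) = tX (t (c \<xi>) (d \<eta>)) (\<upsilon> \<sigma> k)" "clinear_op (?f d)"
      "norm (?f d) \<le> 32 * norm c * norm d" by blast+
  qed
  show ?thesis
  proof (rule closed_span_bounded_map[OF sub, where f = ?f and S = ?S and K = "32 * norm c"])
    show "?S \<subseteq> G \<rho> \<sigma>" unfolding G_eq by (rule closed_span_superset)
    show "?f (x + y) = ?f x + ?f y" if "x \<in> G \<rho> \<sigma>" "y \<in> G \<rho> \<sigma>" for x y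
      by (rule blinfun_eqI_tX)
         (simp_all add: f that cplx.subspace_add[OF sub] clinear_op_add blinfun.add_left
           EF.T.t_add_right X.T.t_add_left)
    show "?f (k *\<^sub>C x) = k *\<^sub>C ?f x" if "x \<in> G \<rho> \<sigma>" for k x
      by (rule blinfun_eqI_tX)
         (simp_all add: f that cplx.subspace_scale[OF sub] clinear_op_scaleC blinfun_apply_scaleC
           EF.T.t_scale_right X.T.t_scale_left)
    show "norm (?f x) \<le> 32 * norm c * norm x" if "x \<in> G \<rho> \<sigma>" for x by (rule f(3)[OF that])
    show "?f s \<in> \<lbrakk>generators\<rbrakk>" if s: "s \<in> ?S" for s
    proof -
      obtain \<rho>' \<sigma>' where *: "\<rho>' \<in> \<Theta>" "\<sigma>' \<in> \<Theta>" "\<rho>' \<subseteq>\<^sub>m \<rho>" "\<sigma>' \<subseteq>\<^sub>m \<sigma>" "s \<in> G \<rho>' \<sigma>'" using s by blast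
      note P' = E.B.Theta_PAut[OF *(1)] E.B.Theta_PAut[OF *(2)]
      have comp': "compatible \<mu> \<rho>'"
        by (rule compatible_mono[OF P(2) P(2) \<rho> P'(1) _ *(3) comp]) (simp add: map_le_iff)
      obtain c' d' where tens: "EF.tensorable \<mu> c c' \<rho>' \<sigma>' s d'"
        using tensorable_ex[OF P(1,2) P' comp' c *(5)] .
      note h = EF.tensor_op_adjoint[OF tens]
      \<comment> \<open>The approximants come with an index below \<open>\<sigma>\<close>, yet the
        induced operator is formed with \<open>\<upsilon> \<sigma>\<close>. Values of an operator
        with right index \<open>\<sigma>'\<close> have inner squares in
        \<open>ran \<sigma>'\<close>, so both choices coincide.\<close>
      have "tX (tensor_op t t c s x) (\<upsilon> \<sigma> k) = tX (tensor_op t t c s x) (\<upsilon> \<sigma>' k)" for x k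
        by (rule X.t_upsilon_mono[OF *(2) Th(3) *(4)]) (rule ranI[of \<sigma>', OF hom_adjointD[OF h]])
      then have "?f s = fiber_op c s \<sigma>'"
        by (intro X.T.tensor_op_eqI) (simp add: X.EE.induced_op[OF *(2) h])
      moreover have "fiber_op c s \<sigma>' \<in> generators"
        unfolding generators_def using Th *(1,2,5) comp' c by blast
      ultimately show ?thesis by (simp add: closed_span_base)
    qed
    show "d \<in> \<lbrakk>?S\<rbrakk>" using d G_eq by blast
  qed (use d in auto)
qed

text \<open>The support of \<open>C\<close> brings \<open>\<mu>\<close> into
  \<open>\<Theta>\<close>; the remaining index \<open>\<rho>\<close> is left to
  \<open>generators_right\<close>.\<close>

lemma generators_left:
  assumes Th: "\<rho>1 \<in> \<Theta>" "\<sigma> \<in> \<Theta>" and \<mu>: "\<mu> \<in> PAut" and \<rho>: "\<rho> \<in> PAut" and comp: "compatible \<mu> \<rho>"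
    and c: "c \<in> C \<rho>1 \<mu>" and d: "d \<in> G \<rho> \<sigma>"
  shows "fiber_op c d \<sigma> \<in> \<lbrakk>generators\<rbrakk>"
proof -
  note P = Th[THEN E.B.Theta_PAut]
  let ?S = "{T. \<exists>\<rho>'\<in>\<Theta>. \<exists>\<sigma>'\<in>\<Theta>. \<rho>' \<subseteq>\<^sub>m \<rho>1 \<and> \<sigma>' \<subseteq>\<^sub>m \<mu> \<and> T \<in> C \<rho>' \<sigma>'}"
  have C_eq: "C \<rho>1 \<mu> = \<lbrakk>?S\<rbrakk>" using families(3) \<mu> P(1) by (simp add: fam_supported_by_def)
  note sub = family_subspace(1)[OF P(1) \<mu>]
  let ?f = "\<lambda>c. fiber_op c d \<sigma>"
  have f: "?f c (tX (t \<xi> \<eta>) k) = tX (t (c \<xi>) (d \<eta>)) (\<upsilon> \<sigma> k)" "clinear_op (?f c)"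
    "norm (?f c) \<le> 32 * norm d * norm c" if c: "c \<in> C \<rho>1 \<mu>" for c \<xi> \<eta> k
  proof -
    obtain c' d' where "EF.tensorable \<mu> c c' \<rho> \<sigma> d d'"
      using tensorable_ex[OF P(1) \<mu> \<rho> P(2) comp c d] .
    from fiber_op[OF this Th(2)]
    show "?f c (tX (t \<xi> \<eta>) k) = tX (t (c \<xi>) (d \<eta>)) (\<upsilon> \<sigma> k)" "clinear_op (?f c)"
      "norm (?f c) \<le> 32 * norm d * norm c" by (simp_all add: mult_ac)
  qed
  show ?thesis
  proof (rule closed_span_bounded_map[OF sub, where f = ?f and S = ?S and K = "32 * norm d"])
    show "?S \<subseteq> C \<rho>1 \<mu>" unfolding C_eq by (rule closed_span_superset)
    show "?f (x + y) = ?f x + ?f y" if "x \<in> C \<rho>1 \<mu>" "y \<in> C \<rho>1 \<mu>" for x y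
      by (rule blinfun_eqI_tX)
         (simp_all add: f that cplx.subspace_add[OF sub] clinear_op_add blinfun.add_left
           EF.T.t_add_left X.T.t_add_left)
    show "?f (k *\<^sub>C x) = k *\<^sub>C ?f x" if "x \<in> C \<rho>1 \<mu>" for k x
      by (rule blinfun_eqI_tX)
         (simp_all add: f that cplx.subspace_scale[OF sub] clinear_op_scaleC blinfun_apply_scaleC
           EF.T.t_scale_left X.T.t_scale_left)
    show "norm (?f x) \<le> 32 * norm d * norm x" if "x \<in> C \<rho>1 \<mu>" for x by (rule f(3)[OF that])
    show "?f s \<in> \<lbrakk>generators\<rbrakk>" if s: "s \<in> ?S" for s
    proof -
      obtain \<rho>' \<sigma>' where *: "\<rho>' \<in> \<Theta>" "\<sigma>' \<in> \<Theta>" "\<sigma>' \<subseteq>\<^sub>m \<mu>" "s \<in> C \<rho>' \<sigma>'" using s by blast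
      have "compatible \<sigma>' \<rho>"
        by (rule compatible_mono[OF \<mu> E.B.Theta_PAut[OF *(2)] \<rho> \<rho> *(3) _ comp]) (simp add: map_le_iff)
      then show ?thesis by (rule generators_right[OF *(1,2) Th(2) \<rho> _ *(4) d])
    qed
    show "c \<in> \<lbrakk>?S\<rbrakk>" using c C_eq by blast
  qed (use c in auto)
qed

lemma J_fiber_product_le: "J \<Theta> \<upsilon> tX tX (fam_fiber_product t C G) \<subseteq> \<lbrakk>generators\<rbrakk>"
  unfolding J_def
proof (rule closed_span_minimal, safe)
  fix Z \<rho>1 \<sigma> assume Th: "\<rho>1 \<in> \<Theta>" "\<sigma> \<in> \<Theta>" and Z: "Z \<in> fam_fiber_product t C G \<rho>1 \<sigma>"
  note P = Th[THEN E.B.Theta_PAut]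
  let ?S = "{tensor_op t t c d | c d. \<exists>\<mu>\<in>PAut. \<exists>\<rho>\<in>PAut. c \<in> C \<rho>1 \<mu> \<and> d \<in> G \<rho> \<sigma> \<and> compatible \<mu> \<rho>}"
  \<comment> \<open>A closed subspace that contains all the operators \<open>c \<otimes> d\<close>
    and on which passing to the induced operator is linear and bounded; the closed span in
    \<open>fam_fiber_product\<close> stays inside it.\<close>
  let ?A = "{T. \<exists>S\<in>UNIV. hom_adjoint \<sigma> X X (blinfun_apply T) (blinfun_apply S)}"
  note A = X.EE.EF.hom_adjoint_set[OF P(2) cplx.subspace_UNIV closed_UNIV]
  let ?f = "\<lambda>Z. tensor_op tX tX Z (\<upsilon> \<sigma>)"
  have f: "?f Z (tX x k) = tX (Z x) (\<upsilon> \<sigma> k)" "norm (?f Z) \<le> 4 * norm Z" if "Z \<in> ?A" for Z x k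
  proof -
    obtain S where h: "hom_adjoint \<sigma> X X (blinfun_apply Z) (blinfun_apply S)" using \<open>Z \<in> ?A\<close> by blast
    show "?f Z (tX x k) = tX (Z x) (\<upsilon> \<sigma> k)" "norm (?f Z) \<le> 4 * norm Z"
      using X.EE.induced_op[OF Th(2) h] by simp_all
  qed
  have S_A: "?S \<subseteq> ?A"
  proof safe
    fix c d \<mu> \<rho> assume "\<mu> \<in> PAut" "\<rho> \<in> PAut" "c \<in> C \<rho>1 \<mu>" "d \<in> G \<rho> \<sigma>" "compatible \<mu> \<rho>"
    then obtain c' d' where "EF.tensorable \<mu> c c' \<rho> \<sigma> d d'"
      using tensorable_ex[OF P(1) _ _ P(2)] by metis
    from EF.tensor_op_adjoint[OF this]
    show "\<exists>S\<in>UNIV. hom_adjoint \<sigma> X X (blinfun_apply (tensor_op t t c d)) (blinfun_apply S)" by blast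
  qed
  show "?f Z \<in> \<lbrakk>generators\<rbrakk>"
  proof (rule closed_span_bounded_map[OF A(1) S_A, where f = ?f and K = 4])
    show "?f (x + y) = ?f x + ?f y" if "x \<in> ?A" "y \<in> ?A" for x y
      by (rule X.T.blinfun_eqI_t)
         (simp only: f[OF cplx.subspace_add[OF A(1) that]] f[OF that(1)] f[OF that(2)] blinfun.add_left X.T.t_add_left)
    show "?f (k *\<^sub>C x) = k *\<^sub>C ?f x" if "x \<in> ?A" for k x
      by (rule X.T.blinfun_eqI_t)
         (simp only: f[OF cplx.subspace_scale[OF A(1) that]] f[OF that] blinfun_apply_scaleC X.T.t_scale_left)
    show "norm (?f x) \<le> 4 * norm x" if "x \<in> ?A" for x by (rule f(2)[OF that])
    show "?f s \<in> \<lbrakk>generators\<rbrakk>" if "s \<in> ?S" for s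
      using that generators_left[OF Th] by blast
    show "Z \<in> \<lbrakk>?S\<rbrakk>" using Z by (simp add: fam_fiber_product_def)
    then show "Z \<in> ?A" using closed_span_minimal[OF S_A A] by blast
  qed simp_all
qed simp_all

text \<open>Both memberships pass to closed spans, in \<open>Y\<close> and then in the ket, so the
  formulas \<open>fiber_op_ket1\<close> and \<open>fiber_op_ket2\<close> on generators
  suffice.\<close>

lemma generators_kets:
  assumes Y: "Y \<in> \<lbrakk>generators\<rbrakk>"
  shows "a \<in> A \<Longrightarrow> (adj U o\<^sub>L Y o\<^sub>L U) o\<^sub>L ket1 r D a \<in> \<lbrakk>{ket1 r D a' o\<^sub>L y | a' y. a' \<in> A \<and> y \<in> J \<Theta> \<upsilon> tF tF G}\<rbrakk>"
    and "b \<in> D \<Longrightarrow> (adj U o\<^sub>L Y o\<^sub>L U) o\<^sub>L ket2 r A b \<in> \<lbrakk>{ket2 r A b' o\<^sub>L x | b' x. b' \<in> D \<and> x \<in> J \<Theta> \<upsilon> tE tE C}\<rbrakk>"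
proof -
  let ?V1 = "\<lbrakk>{ket1 r D a' o\<^sub>L y | a' y. a' \<in> A \<and> y \<in> J \<Theta> \<upsilon> tF tF G}\<rbrakk>"
  let ?V2 = "\<lbrakk>{ket2 r A b' o\<^sub>L x | b' x. b' \<in> D \<and> x \<in> J \<Theta> \<upsilon> tE tE C}\<rbrakk>"
  note cU = unitary_adj(3,4)[OF unitary_U]
  have lin: "bounded_linear (\<lambda>Y. (adj U o\<^sub>L Y o\<^sub>L U) o\<^sub>L K)"
    "(adj U o\<^sub>L c *\<^sub>C Y o\<^sub>L U) o\<^sub>L K = c *\<^sub>C ((adj U o\<^sub>L Y o\<^sub>L U) o\<^sub>L K)"
    for K :: "'z::real_normed_vector \<Rightarrow>\<^sub>L 'r" and c Y
  proof -
    have "bounded_linear (\<lambda>Y. adj U o\<^sub>L Y)" for U :: "'r \<Rightarrow>\<^sub>L 'ix"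
      by (rule bounded_bilinear.bounded_linear_right[OF bounded_bilinear_blinfun_compose])
    then show "bounded_linear (\<lambda>Y. (adj U o\<^sub>L Y o\<^sub>L U) o\<^sub>L K)"
      by (intro bounded_linear_compose[OF bounded_bilinear.bounded_linear_left[OF bounded_bilinear_blinfun_compose]])
    show "(adj U o\<^sub>L c *\<^sub>C Y o\<^sub>L U) o\<^sub>L K = c *\<^sub>C ((adj U o\<^sub>L Y o\<^sub>L U) o\<^sub>L K)"
      by (rule blinfun_eqI) (simp add: blinfun_apply_scaleC clinear_opD[OF cU(2)])
  qed
  have gen: "\<exists>c c' d d' \<mu> \<rho> \<sigma>. Y = fiber_op c d \<sigma> \<and> \<mu> \<in> \<Theta> \<and> \<rho> \<in> \<Theta> \<and> \<sigma> \<in> \<Theta> \<and>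
      EF.tensorable \<mu> c c' \<rho> \<sigma> d d' \<and> tensor_op tF tF d (\<upsilon> \<sigma>) \<in> J \<Theta> \<upsilon> tF tF G \<and>
      tensor_op tE tE c (\<upsilon> \<mu>) \<in> J \<Theta> \<upsilon> tE tE C" if Y: "Y \<in> generators" for Y
  proof -
    obtain c d \<rho>1 \<mu> \<rho> \<sigma> where *: "Y = fiber_op c d \<sigma>"
      "\<rho>1 \<in> \<Theta>" "\<mu> \<in> \<Theta>" "\<rho> \<in> \<Theta>" "\<sigma> \<in> \<Theta>" "compatible \<mu> \<rho>" "c \<in> C \<rho>1 \<mu>" "d \<in> G \<rho> \<sigma>"
      using Y unfolding generators_def by blast
    note P = *(2-5)[THEN E.B.Theta_PAut]
    obtain c' d' where tens: "EF.tensorable \<mu> c c' \<rho> \<sigma> d d'" using tensorable_ex[OF P *(6-8)] .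
    have "tensor_op tF tF d (\<upsilon> \<sigma>) \<in> J \<Theta> \<upsilon> tF tF G" "tensor_op tE tE c (\<upsilon> \<mu>) \<in> J \<Theta> \<upsilon> tE tE C"
      unfolding J_def using * by (auto intro!: closed_span_base)
    then show ?thesis using *(1,3-5) tens by blast
  qed
  show "(adj U o\<^sub>L Y o\<^sub>L U) o\<^sub>L ket1 r D a \<in> ?V1" if a: "a \<in> A"
  proof (rule closed_span_vimage[OF lin csubspace_closed_span closed_closed_span _ Y])
    fix Y assume "Y \<in> generators"
    then obtain c c' d d' \<mu> \<rho> \<sigma> where *: "Y = fiber_op c d \<sigma>" "\<sigma> \<in> \<Theta>"
      "EF.tensorable \<mu> c c' \<rho> \<sigma> d d'" "tensor_op tF tF d (\<upsilon> \<sigma>) \<in> J \<Theta> \<upsilon> tF tF G"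
      using gen by blast
    have cY: "clinear_op Y" unfolding *(1) by (rule fiber_op(2)[OF *(3,2)])
    show "(adj U o\<^sub>L Y o\<^sub>L U) o\<^sub>L ket1 r D a \<in> ?V1"
    proof (rule RT.ket1_closed_span[where S = "range E.L_op"])
      show "clinear_op (adj U o\<^sub>L Y o\<^sub>L U)" by (intro clinear_op_compose cU cY)
      show "range E.L_op \<subseteq> A" using E.L_op_in_alpha by blast
      show "a \<in> \<lbrakk>range E.L_op\<rbrakk>" using a by (simp add: E.alpha_eq)
      show "(adj U o\<^sub>L Y o\<^sub>L U) o\<^sub>L ket1 r D s \<in> ?V1" if "s \<in> range E.L_op" for s
      proof -
        obtain \<xi> where s: "s = E.L_op \<xi>" using \<open>s \<in> range E.L_op\<close> by blast
        show ?thesis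
          unfolding s *(1) fiber_op_ket1[OF *(3,2)]
          using E.L_op_in_alpha *(4) by (intro closed_span_base) blast
      qed
    qed (use a in auto)
  qed
  show "(adj U o\<^sub>L Y o\<^sub>L U) o\<^sub>L ket2 r A b \<in> ?V2" if b: "b \<in> D"
  proof (rule closed_span_vimage[OF lin csubspace_closed_span closed_closed_span _ Y])
    fix Y assume "Y \<in> generators"
    then obtain c c' d d' \<mu> \<rho> \<sigma> where *: "Y = fiber_op c d \<sigma>"
      "\<mu> \<in> \<Theta>" "\<rho> \<in> \<Theta>" "\<sigma> \<in> \<Theta>"
      "EF.tensorable \<mu> c c' \<rho> \<sigma> d d'" "tensor_op tE tE c (\<upsilon> \<mu>) \<in> J \<Theta> \<upsilon> tE tE C"
      using gen by blast
    have cY: "clinear_op Y" unfolding *(1) by (rule fiber_op(2)[OF *(5,4)])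
    let ?S = "{F.R_op \<eta> \<theta> | \<eta> \<theta>. \<theta> \<in> \<Theta> \<and> \<eta> \<in> hom_elts (pinv \<theta>) F}"
    have "(adj U o\<^sub>L Y o\<^sub>L U) o\<^sub>L ket1 (\<lambda>d \<zeta> a. r a \<zeta> d) A b \<in> ?V2"
    proof (rule RT'.ket1_closed_span[where S = ?S])
      show "clinear_op (adj U o\<^sub>L Y o\<^sub>L U)" by (intro clinear_op_compose cU cY)
      show "?S \<subseteq> D" using R_op_in_beta by blast
      show "b \<in> \<lbrakk>?S\<rbrakk>" using b by (simp add: F.beta_eq)
      show "(adj U o\<^sub>L Y o\<^sub>L U) o\<^sub>L ket1 (\<lambda>d \<zeta> a. r a \<zeta> d) A s \<in> ?V2" if "s \<in> ?S" for s
      proof -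
        obtain \<eta> \<theta> where s: "s = F.R_op \<eta> \<theta>" "\<theta> \<in> \<Theta>" "\<eta> \<in> hom_elts (pinv \<theta>) F" using \<open>s \<in> ?S\<close> by blast
        have "F.R_op (d \<eta>) (\<sigma> \<circ>\<^sub>m \<theta> \<circ>\<^sub>m pinv \<rho>) \<in> D"
          by (intro R_op_in_beta hom_elts_image[OF *(5,3,4) s(2,3)] E.B.Theta_comp E.B.Theta_pinv * s(2))
        then show ?thesis
          unfolding ket2_eq_ket1[symmetric] s(1) *(1) fiber_op_ket2[OF *(5,2,3,4) s(2,3)]
          using *(6) by (intro closed_span_base) blast
      qed
    qed (use b in auto)
    then show "(adj U o\<^sub>L Y o\<^sub>L U) o\<^sub>L ket2 r A b \<in> ?V2" by (simp add: ket2_eq_ket1)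
  qed
qed

lemma fiber_product_inclusion:
  assumes T: "clinear_op T" and Y: "Ad U T \<in> J \<Theta> \<upsilon> tX tX (fam_fiber_product t C G)"
  shows "T \<in> fiber_product r A D (J \<Theta> \<upsilon> tE tE C) (J \<Theta> \<upsilon> tF tF G)"
proof -
  define Y where "Y = Ad U T"
  have Y': "Y \<in> \<lbrakk>generators\<rbrakk>" using assms(2) J_fiber_product_le by (auto simp: Y_def)
  note cU = unitary_adj[OF unitary_U] and aY = adj_generators[OF Y']
  have T_eq: "T = adj U o\<^sub>L Y o\<^sub>L U"
    by (rule blinfun_eqI) (simp add: Y_def Ad_def cU)
  have adj_T: "adj T = adj U o\<^sub>L adj Y o\<^sub>L U"
    unfolding T_eq
    by (rule blinfun_eqI) (simp add: adj_compose adj_adj clinear_op_compose cU aY)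
  show ?thesis
    unfolding fiber_product_def mem_Collect_eq adj_T
    using T generators_kets[OF Y'] generators_kets[OF aY(2)] by (simp add: T_eq[symmetric])
qed

end

end

theorem theorem5p19:
  fixes \<Theta> :: "('b::cstar_algebra \<rightharpoonup> 'b) set"
    and \<pi> :: "'b \<Rightarrow> 'k::chilbert_space \<Rightarrow>\<^sub>L 'k"
    and \<upsilon> :: "('b \<rightharpoonup> 'b) \<Rightarrow> 'k \<Rightarrow>\<^sub>L 'k"
    and E :: "('b, 'e::complex_banach) bimodule"
    and F :: "('b, 'f::complex_banach) bimodule"
    and EF :: "('b, 'x::complex_banach) bimodule"
    and \<C> :: "('b, 'e, 'e) opfam"
    and \<D> :: "('b, 'f, 'f) opfam"
    and t :: "'e \<Rightarrow> 'f \<Rightarrow> 'x"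
    and tB :: "'b \<Rightarrow> 'k \<Rightarrow> 'h::chilbert_space"
    and tE :: "'e \<Rightarrow> 'k \<Rightarrow> 'ie::chilbert_space"
    and tF :: "'f \<Rightarrow> 'k \<Rightarrow> 'jf::chilbert_space"
    and tEF :: "'x \<Rightarrow> 'k \<Rightarrow> 'ix::chilbert_space"
    and r :: "('h \<Rightarrow>\<^sub>L 'ie) \<Rightarrow> 'h \<Rightarrow> ('h \<Rightarrow>\<^sub>L 'jf) \<Rightarrow> 'r::chilbert_space"
  assumes "decomposable (self_bimodule :: ('b, 'b) bimodule)"
    and "admissible_semigroup \<Theta>"
    and "covariant_rep \<Theta> \<pi> \<upsilon>" and "inj \<pi>"
    and "cstar_bimodule E" and "cstar_bimodule F"
    and "admissible_family \<Theta> E \<C>" and "admissible_family \<Theta> F \<D>"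
    and "bimodule_tensor E F EF t"
    and "induced_space self_bimodule \<pi> tB"
    and "induced_space E \<pi> tE" and "induced_space F \<pi> tF" and "induced_space EF \<pi> tEF"
    and "relative_tensor (\<alpha> \<Theta> \<upsilon> tB tE E) (\<beta> \<Theta> \<upsilon> tB tF F) r"
  shows "{T. clinear_op T \<and>
             Ad (\<tau> E t tB tE tF tEF r (\<beta> \<Theta> \<upsilon> tB tF F)) T
               \<in> J \<Theta> \<upsilon> tEF tEF (fam_fiber_product t \<C> \<D>)}
         \<subseteq> fiber_product r (\<alpha> \<Theta> \<upsilon> tB tE E) (\<beta> \<Theta> \<upsilon> tB tF F)
             (J \<Theta> \<upsilon> tE tE \<C>) (J \<Theta> \<upsilon> tF tF \<D>)"
proof -
  have "cstar_bimodule EF" using assms(9) by (simp add: bimodule_tensor_def)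
  note bimods = bimod_self[where 'b = 'b] assms(5,6)[THEN bimod_cstar_bimodule] this[THEN bimod_cstar_bimodule]
  have cov: "covariant \<Theta> \<pi> \<upsilon>" by (rule covariant.intro) fact+
  have dec: "decomposable_wrt \<Theta> E" "decomposable_wrt \<Theta> F"
    using assms(7,8) by (simp_all add: admissible_family_def admissible_bimodule_def)
  interpret setting \<Theta> \<pi> \<upsilon> tB E tE F tF EF tEF t r
    by (intro setting.intro based.intro based_axioms.intro induced.intro induced_axioms.intro
        bimod_tensor.intro bimod_tensor_axioms.intro setting_axioms.intro bimods cov dec assms)
  show ?thesis
    using fiber_product_inclusion[OF assms(7,8)] by (auto simp: U_def)
qed

end
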